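(* Let $\mathbb{F}_q$ be a fixed finite field. Then there exists an algorithm which, given as input a quiver $(\Gamma,\Omega)$ and a representation $\pi = (\{U_v\}_{v\in\mathcal{V}}, \{U_v \to U_w\})$ of $(\Gamma,\Omega)$ over $\mathbb{F}_q$ of dimension $\sum_{v\in\mathcal{V}} n_v\alpha_v$, can decide in time polynomial in $N := \sum_{v\in\mathcal{V}} n_v$ whether or not $\pi$ is absolutely indecomposable.
   Context: A quiver $(\Gamma,\Omega)$ is a finite graph $\Gamma$ without self-loops (several edges connecting two vertices are allowed), with vertex set $\mathcal{V}$, together with an orientation $\Omega$ of its edges. A representation of $(\Gamma,\Omega)$ over a field $\mathbb{F}$ is a collection of finite-dimensional $\mathbb{F}$-vector spaces $\{U_v\}_{v\in\mathcal{V}}$ and a linear map $U_v\to U_w$ for each oriented edge $v\to w$. Homomorphisms and isomorphisms of representations are defined in the obvious way (families of linear maps on the vertex spaces commuting with the edge maps). The direct sum of two representations is obtained by taking direct sums of the vertex spaces and of the edge maps. A representation is indecomposable if it is not isomorphic to a direct sum of two non-zero representations; it is absolutely indecomposable if it is indecomposable over the algebraic closure $\overline{\mathbb{F}}$, i.e. if the representation obtained by extending scalars from $\mathbb{F}$ to $\overline{\mathbb{F}}$ is indecomposable. Let $\{\alpha_v\}_{v\in\mathcal{V}}$ be the fixed basis of the free abelian group $Q=\bigoplus_{v\in\mathcal{V}}\mathbb{Z}\alpha_v$; the dimension of $\pi$ is $\sum_{v\in\mathcal{V}}(\dim U_v)\alpha_v$, so $n_v=\dim U_v$. In terms of matrices,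 a representation over $\mathbb{F}_q$ of dimension $\sum_v n_v\alpha_v$ is given by an $n_w\times n_v$ matrix over $\mathbb{F}_q$ for each oriented edge $v\to w$.
   Formalization: The time bound proved is polynomial in N plus the numbers of vertices and edges of the quiver; a bound in N alone is impossible when the quiver is part of the input (two vertices of dimension 1 with m parallel edges have N = 2, yet all m scalars must be read). *)

theory Defs
  imports
    "Graph_Theory.Digraph"
    "Jordan_Normal_Form.Matrix"
    "HOL-Algebra.Algebraic_Closure_Type"
    "HOL-Computational_Algebra.Polynomial"
begin

section \<open>Quivers and their representations\<close>

definition quiver :: "('v, 'e) pre_digraph \<Rightarrow> bool" where
  "quiver G \<longleftrightarrow> fin_digraph G \<and> loopfree_digraph G"

text \<open>
  The space at a vertex \<open>v\<close> is the coordinate space of dimension \<open>vdim \<pi> v\<close>, and the linear map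
  along an arc is a matrix acting on column vectors.  Values at non-vertices and non-arcs are
  irrelevant.
\<close>

record ('v, 'e, 'k) rep =
  vdim :: "'v \<Rightarrow> nat"
  emat :: "'e \<Rightarrow> 'k mat"

definition quiver_rep :: "('v, 'e) pre_digraph \<Rightarrow> ('v, 'e, 'k) rep \<Rightarrow> bool" where
  "quiver_rep G \<pi> \<longleftrightarrow>
     (\<forall>e\<in>arcs G. emat \<pi> e \<in> carrier_mat (vdim \<pi> (head G e)) (vdim \<pi> (tail G e)))"

definition total_dim :: "('v, 'e) pre_digraph \<Rightarrow> ('v, 'e, 'k) rep \<Rightarrow> nat" where
  "total_dim G \<pi> = (\<Sum>v\<in>verts G. vdim \<pi> v)"

definition zero_rep :: "('v, 'e) pre_digraph \<Rightarrow> ('v, 'e, 'k) rep \<Rightarrow> bool" where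
  "zero_rep G \<pi> \<longleftrightarrow> (\<forall>v\<in>verts G. vdim \<pi> v = 0)"

definition rep_hom ::
  "('v, 'e) pre_digraph \<Rightarrow> ('v, 'e, 'k::field) rep \<Rightarrow> ('v, 'e, 'k) rep \<Rightarrow> ('v \<Rightarrow> 'k mat) \<Rightarrow> bool" where
  "rep_hom G \<pi> \<rho> f \<longleftrightarrow>
     (\<forall>v\<in>verts G. f v \<in> carrier_mat (vdim \<rho> v) (vdim \<pi> v)) \<and>
     (\<forall>e\<in>arcs G. f (head G e) * emat \<pi> e = emat \<rho> e * f (tail G e))"

definition rep_isomorphic ::
  "('v, 'e) pre_digraph \<Rightarrow> ('v, 'e, 'k::field) rep \<Rightarrow> ('v, 'e, 'k) rep \<Rightarrow> bool" where
  "rep_isomorphic G \<pi> \<rho> \<longleftrightarrow> (\<exists>f. rep_hom G \<pi> \<rho> f \<and> (\<forall>v\<in>verts G. invertible_mat (f v)))"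

definition direct_sum :: "('v, 'e, 'k::field) rep \<Rightarrow> ('v, 'e, 'k) rep \<Rightarrow> ('v, 'e, 'k) rep" where
  "direct_sum \<rho> \<sigma> =
     \<lparr>vdim = (\<lambda>v. vdim \<rho> v + vdim \<sigma> v),
      emat = (\<lambda>e. four_block_mat
        (emat \<rho> e) (0\<^sub>m (dim_row (emat \<rho> e)) (dim_col (emat \<sigma> e)))
        (0\<^sub>m (dim_row (emat \<sigma> e)) (dim_col (emat \<rho> e))) (emat \<sigma> e))\<rparr>"

text \<open>Under this definition the zero representation counts as indecomposable.\<close>

definition indecomposable :: "('v, 'e) pre_digraph \<Rightarrow> ('v, 'e, 'k::field) rep \<Rightarrow> bool" where
  "indecomposable G \<pi> \<longleftrightarrow>
     \<not> (\<exists>\<rho> \<sigma>. quiver_rep G \<rho> \<and> quiver_rep G \<sigma> \<and>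
            \<not> zero_rep G \<rho> \<and> \<not> zero_rep G \<sigma> \<and> rep_isomorphic G \<pi> (direct_sum \<rho> \<sigma>))"

definition extend_to_closure :: "('v, 'e, 'k::field) rep \<Rightarrow> ('v, 'e, 'k alg_closure) rep" where
  "extend_to_closure \<pi> = \<lparr>vdim = vdim \<pi>, emat = (\<lambda>e. map_mat to_ac (emat \<pi> e))\<rparr>"

definition absolutely_indecomposable ::
  "('v, 'e) pre_digraph \<Rightarrow> ('v, 'e, 'k::field) rep \<Rightarrow> bool" where
  "absolutely_indecomposable G \<pi> \<longleftrightarrow> indecomposable G (extend_to_closure \<pi>)"


section \<open>Algorithms and running time\<close>

text \<open>
  The machine model is a first-order functional language over binary trees (pure Lisp with one
  atom; in essence N. D. Jones's language F).  A program is a finite list of function bodies;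
  each function has one argument, functions may be mutually recursive, calls are by value, and
  execution starts with function \<open>0\<close>.  The running time is the number of evaluation steps.
  Every step takes constant time on a pointer machine: an evaluation of time \<open>t\<close> allocates at
  most \<open>t\<close> cells, subtrees being shared, and trees are only tested for being \<open>Leaf\<close> and never
  compared or copied as a whole.  Hence time in this model is polynomially related to time on a
  Turing machine.
\<close>

datatype sexp = Leaf | Cell sexp sexp

fun left :: "sexp \<Rightarrow> sexp" where
  "left Leaf = Leaf"
| "left (Cell a b) = a"

fun right :: "sexp \<Rightarrow> sexp" where
  "right Leaf = Leaf"
| "right (Cell a b) = b"

datatype expr =
    Arg
  | MkLeaf
  | MkCell expr expr
  | Left expr
  | Right expr
  | Cond expr expr expr
  | Call nat expr

type_synonym program = "expr list"

text \<open>\<open>evaluates P a e v t\<close>: in program \<open>P\<close>, with current argument \<open>a\<close>, the expression \<open>e\<close>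
  evaluates to \<open>v\<close> in \<open>t\<close> steps.\<close>

inductive evaluates :: "program \<Rightarrow> sexp \<Rightarrow> expr \<Rightarrow> sexp \<Rightarrow> nat \<Rightarrow> bool" for P :: program where
  arg: "evaluates P a Arg a 1"
| leaf: "evaluates P a MkLeaf Leaf 1"
| cell: "evaluates P a e1 v1 t1 \<Longrightarrow> evaluates P a e2 v2 t2
    \<Longrightarrow> evaluates P a (MkCell e1 e2) (Cell v1 v2) (t1 + t2 + 1)"
| left: "evaluates P a e v t \<Longrightarrow> evaluates P a (Left e) (left v) (t + 1)"
| right: "evaluates P a e v t \<Longrightarrow> evaluates P a (Right e) (right v) (t + 1)"
| cond_cell: "evaluates P a e v t \<Longrightarrow> v \<noteq> Leaf \<Longrightarrow> evaluates P a e1 v1 t1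
    \<Longrightarrow> evaluates P a (Cond e e1 e2) v1 (t + t1 + 1)"
| cond_leaf: "evaluates P a e Leaf t \<Longrightarrow> evaluates P a e2 v2 t2
    \<Longrightarrow> evaluates P a (Cond e e1 e2) v2 (t + t2 + 1)"
| call: "evaluates P a e b t \<Longrightarrow> i < length P \<Longrightarrow> evaluates P b (P ! i) v t'
    \<Longrightarrow> evaluates P a (Call i e) v (t + t' + 1)"

definition runs :: "program \<Rightarrow> sexp \<Rightarrow> sexp \<Rightarrow> nat \<Rightarrow> bool" where
  "runs P input v t \<longleftrightarrow> evaluates P input (Call 0 Arg) v t"

text \<open>Evaluation is deterministic, so a terminating run has one result and one running time.\<close>

lemma evaluates_deterministic:
  "evaluates P a e v t \<Longrightarrow> evaluates P a e v' t' \<Longrightarrow> v' = v \<and> t' = t"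
proof (induction arbitrary: v' t' rule: evaluates.induct)
  case (arg a)
  then show ?case by cases auto
next
  case (leaf a)
  then show ?case by cases auto
next
  case (cell a e1 v1 t1 e2 v2 t2)
  from cell.prems show ?case by cases (use cell.IH in blast)
next
  case (left a e v t)
  from left.prems show ?case by cases (use left.IH in blast)
next
  case (right a e v t)
  from right.prems show ?case by cases (use right.IH in blast)
next
  case (cond_cell a e v t e1 v1 t1 e2)
  from cond_cell.prems show ?case by cases (use cond_cell.IH cond_cell.hyps in blast)+
next
  case (cond_leaf a e t e2 v2 t2 e1)
  from cond_leaf.prems show ?case by cases (use cond_leaf.IH in blast)+
next
  case (call a e b t i v t1)
  from call.prems show ?case by cases (use call.IH in blast)
qed

lemma runs_deterministic: "runs P x v t \<Longrightarrow> runs P x v' t' \<Longrightarrow> v' = v \<and> t' = t"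
  unfolding runs_def by (rule evaluates_deterministic)


section \<open>Quiver representations as inputs\<close>

text \<open>
  An input quiver has its vertices and its arcs numbered consecutively from \<open>0\<close>.  Naturals are
  encoded in unary; a field element is encoded by its number under a fixed injective numbering
  \<open>code\<close> of the finite field.  The dimension vector is part of the input.
\<close>

definition numbered :: "(nat, nat) pre_digraph \<Rightarrow> bool" where
  "numbered G \<longleftrightarrow> (\<exists>n. verts G = {..<n}) \<and> (\<exists>m. arcs G = {..<m})"

fun enc_list :: "('x \<Rightarrow> sexp) \<Rightarrow> 'x list \<Rightarrow> sexp" where
  "enc_list f [] = Leaf"
| "enc_list f (x # xs) = Cell (f x) (enc_list f xs)"

fun enc_nat :: "nat \<Rightarrow> sexp" where
  "enc_nat 0 = Leaf"
| "enc_nat (Suc n) = Cell Leaf (enc_nat n)"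

definition enc_mat :: "('k \<Rightarrow> nat) \<Rightarrow> 'k mat \<Rightarrow> sexp" where
  "enc_mat code A = enc_list (enc_list (\<lambda>x. enc_nat (code x))) (mat_to_list A)"

definition enc_input :: "('k \<Rightarrow> nat) \<Rightarrow> (nat, nat) pre_digraph \<Rightarrow> (nat, nat, 'k) rep \<Rightarrow> sexp" where
  "enc_input code G \<pi> =
     Cell (enc_list (\<lambda>v. enc_nat (vdim \<pi> v)) [0..<card (verts G)])
          (enc_list (\<lambda>e. Cell (enc_nat (tail G e)) (Cell (enc_nat (head G e)) (enc_mat code (emat \<pi> e))))
             [0..<card (arcs G)])"

end

(*
  A representation of total dimension N is turned into a finite set of N x N matrices (its arc maps
  and the projections to the vertex spaces, as block matrices), whose commutant A is the endomorphism
  algebra.  Over the algebraic closure K the representation is indecomposable iff the commutant A_K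
  has no idempotents besides 0 and 1, that is, iff A_K is local; since K is algebraically closed this
  means A_K = K + (nilpotent ideal).

  The algorithm computes a basis of A by linear elimination, subtracts from every basis element b a
  scalar c of the finite field for which b - c is nilpotent, and tests whether all products of N^2 of
  the resulting matrices vanish, keeping a spanning list of bounded length for the products of length k.
  If the test succeeds, then, the computation being the same over K, every element of A_K is a scalar
  plus a nilpotent, so A_K has only trivial idempotents.  Conversely, if A_K has only trivial
  idempotents, then every b in A has a single eigenvalue over K by Fitting's lemma, which lies in the
  finite field by a Frobenius argument, and the nilpotent elements of A form an ideal that moves every
  term of a composition series of the space of N x N matrices, as an A-module, into the next one.

  Polynomial running time comes from closure properties of the class of functions that some program
  computes in polynomial time with results of polynomial size: composition, pairs, conditionals, finite
  tables, and list recursion whose intermediate results are bounded polynomially in size.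
*)
theory Submission
  imports Defs
    "HOL-Library.Function_Algebras"
    "Jordan_Normal_Form.Determinant"
begin

section \<open>Functions computable in polynomial time\<close>

text \<open>Nilpotency of the shifted basis elements one by one would prove nothing, since a sum of
  nilpotent matrices need not be nilpotent; vanishing of all products of a fixed length controls
  every linear combination. The length n^2 is the dimension of the space of all n x n matrices,
  hence a bound for every strictly decreasing chain of subspaces in it. No arithmetic in the closure
  is ever performed. The algorithm branches only on whether a field element is 0, which a field
  homomorphism preserves, so a run over the small field is also a run over the closure. The converse
  direction needs the closure only for an eigenvalue of each basis element; ideals and composition
  series live over the finite field, where cardinalities take the place of dimensions. Fixing the
  field makes its operations finite tables and allows all its elements to be tried in turn. The
  algorithm computes with lists of rows, while the algebra is done with functions of two indices,
  which form one vector space for all sizes; \<open>den\<close> leads from the former to the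
  latter.\<close>

lemma nat_poly_mono: "m \<le> n \<Longrightarrow> poly (p :: nat poly) m \<le> poly p n"
  by (induction p) (auto intro!: add_mono mult_mono)

text \<open>Relocation of function numbers: when a program is placed behind \<open>k\<close> other
  functions, its calls to \<open>i\<close> must become calls to \<open>i + k\<close>.\<close>

fun shift :: "nat \<Rightarrow> expr \<Rightarrow> expr" where
  "shift k Arg = Arg"
| "shift k MkLeaf = MkLeaf"
| "shift k (MkCell a b) = MkCell (shift k a) (shift k b)"
| "shift k (Left a) = Left (shift k a)"
| "shift k (Right a) = Right (shift k a)"
| "shift k (Cond a b c) = Cond (shift k a) (shift k b) (shift k c)"
| "shift k (Call i a) = Call (i + k) (shift k a)"

text \<open>Relocated bodies find each other at the shifted positions, so a derivation is copied
  rule by rule, with the same running time.\<close>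

lemma evaluates_shift:
  "evaluates P a e v t \<Longrightarrow> evaluates (Q @ map (shift (length Q)) P @ R) a (shift (length Q) e) v t"
proof (induction rule: evaluates.induct)
  case (call a e b t i v t')
  have "(Q @ map (shift (length Q)) P @ R) ! (i + length Q) = shift (length Q) (P ! i)"
    using call.hyps by (simp add: nth_append)
  then show ?case
    using evaluates.call[OF call.IH(1), of "i + length Q" v t'] call by simp
qed (simp_all only: shift.simps, (rule evaluates.intros; assumption)+)

lemma shift_0 [simp]: "shift 0 e = e"
  by (induction e) auto

lemma map_shift_0 [simp]: "map (shift 0) P = P"
  by (induction P) auto

lemma evaluates_append:
  "evaluates P a e v t \<Longrightarrow> evaluates (P @ R) a e v t"
  using evaluates_shift[of P a e v t "[]" R] by simp

text \<open>The size of the result has to be bounded separately: because subtrees are shared, a program can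
  build a tree that is exponentially larger than its running time.\<close>

definition pt :: "('a \<Rightarrow> sexp) \<Rightarrow> ('b \<Rightarrow> sexp) \<Rightarrow> ('a \<Rightarrow> 'b) \<Rightarrow> bool" where
  "pt ea eb f \<longleftrightarrow> (\<exists>P e (p :: nat poly). \<forall>x.
     size (eb (f x)) \<le> poly p (size (ea x)) \<and>
     (\<exists>t \<le> poly p (size (ea x)). evaluates P (ea x) e (eb (f x)) t))"

lemma ptI:
  assumes "\<And>x. size (eb (f x)) \<le> poly p (size (ea x))"
    and "\<And>x. \<exists>t \<le> poly q (size (ea x)). evaluates P (ea x) e (eb (f x)) t"
  shows "pt ea eb f"
  unfolding pt_def
proof (intro exI[of _ P] exI[of _ e] exI[of _ "p + q"] allI conjI)
  fix x
  show "size (eb (f x)) \<le> poly (p + q) (size (ea x))"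
    using assms(1)[of x] by simp
  show "\<exists>t\<le>poly (p + q) (size (ea x)). evaluates P (ea x) e (eb (f x)) t"
    using assms(2)[of x] by (auto intro: trans_le_add2)
qed

lemma ptE:
  assumes "pt ea eb f"
  obtains P e p where "\<And>x. size (eb (f x)) \<le> poly p (size (ea x))"
    and "\<And>x. \<exists>t \<le> poly p (size (ea x)). evaluates P (ea x) e (eb (f x)) t"
  proof -
  from assms obtain P e p where *: "\<forall>x. size (eb (f x)) \<le> poly p (size (ea x)) \<and>
     (\<exists>t \<le> poly p (size (ea x)). evaluates P (ea x) e (eb (f x)) t)"
    unfolding pt_def by (elim exE)
  show ?thesis by (rule that[of p P e]) (use * in auto)
qed

lemma pt_runs:
  assumes "pt ea eb f"
  obtains P p where "\<And>x. \<exists>t \<le> poly p (size (ea x)). runs P (ea x) (eb (f x)) t"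
proof -
  obtain P e p where *: "\<And>x. \<exists>t \<le> poly p (size (ea x)). evaluates P (ea x) e (eb (f x)) t"
    using assms by (rule ptE) blast
  \<comment> \<open>\<open>runs\<close> enters at function 0, so the expression takes this place and
    the bodies of \<open>P\<close> move up by one. Entering costs 2 steps: the call and its argument
    \<open>Arg\<close>.\<close>
  define Q where "Q = shift 1 e # map (shift 1) P"
  have "\<exists>t \<le> poly (p + [:2:]) (size (ea x)). runs Q (ea x) (eb (f x)) t" for x
  proof -
    obtain t where t: "t \<le> poly p (size (ea x))" "evaluates P (ea x) e (eb (f x)) t"
      using * by blast
    have "evaluates Q (ea x) (shift 1 e) (eb (f x)) t"
      using evaluates_shift[OF t(2), of "[shift 1 e]" "[]"] by (simp add: Q_def)
    then have "runs Q (ea x) (eb (f x)) (1 + t + 1)"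
      unfolding runs_def by (intro evaluates.call[OF evaluates.arg]) (auto simp: Q_def)
    with t(1) show ?thesis
      by (intro exI[of _ "1 + t + 1"]) simp
  qed
  then show ?thesis by (rule that)
qed

section \<open>Closure under composition, pairing and case distinction\<close>

definition epair :: "('a \<Rightarrow> sexp) \<Rightarrow> ('b \<Rightarrow> sexp) \<Rightarrow> 'a \<times> 'b \<Rightarrow> sexp" where
  "epair ea eb p = Cell (ea (fst p)) (eb (snd p))"

lemma pt_id: "pt ea ea (\<lambda>x. x)"
  by (rule ptI[where p = "[:0, 1:]" and q = "[:1:]" and P = "[]" and e = Arg])
    (use evaluates.arg[of "[]"] in auto)

text \<open>Here the size bound in \<open>pt\<close> pays off: the time of \<open>f\<close> is
  polynomial in the size of \<open>g x\<close>, which the running time of \<open>g\<close> alone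
  would not bound.\<close>

lemma pt_comp:
  assumes f: "pt eb ec f" and g: "pt ea eb g"
  shows "pt ea ec (\<lambda>x. f (g x))"
proof -
  obtain P e p where f1: "\<And>x. size (ec (f x)) \<le> poly p (size (eb x))"
    and f2: "\<And>x. \<exists>t \<le> poly p (size (eb x)). evaluates P (eb x) e (ec (f x)) t"
    using f by (rule ptE) blast
  obtain P' e' p' where g1: "\<And>x. size (eb (g x)) \<le> poly p' (size (ea x))"
    and g2: "\<And>x. \<exists>t \<le> poly p' (size (ea x)). evaluates P' (ea x) e' (eb (g x)) t"
    using g by (rule ptE) blast
  let ?k = "length P'"
  \<comment> \<open>Only a call can bind \<open>Arg\<close> anew, so the expression for
    \<open>f\<close> becomes the last function and is called on the value of
    \<open>g\<close>.\<close>
  let ?Q = "P' @ map (shift ?k) P @ [shift ?k e]"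
  show ?thesis
  proof (rule ptI[where p = "pcompose p p'" and q = "pcompose p p' + p' + [:1:]" and P = ?Q
        and e = "Call (?k + length P) e'"])
    fix x
    have mono: "poly p (size (eb (g x))) \<le> poly (pcompose p p') (size (ea x))"
      using nat_poly_mono[OF g1[of x]] by (simp add: poly_pcompose)
    show "size (ec (f (g x))) \<le> poly (pcompose p p') (size (ea x))"
      using f1[of "g x"] mono by simp
    obtain t where t: "t \<le> poly p (size (eb (g x)))" "evaluates P (eb (g x)) e (ec (f (g x))) t"
      using f2 by blast
    obtain t' where t': "t' \<le> poly p' (size (ea x))" "evaluates P' (ea x) e' (eb (g x)) t'"
      using g2 by blast
    have "evaluates ?Q (ea x) (Call (?k + length P) e') (ec (f (g x))) (t' + t + 1)"
    proof (rule evaluates.call)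
      show "evaluates ?Q (ea x) e' (eb (g x)) t'"
        using t'(2) by (rule evaluates_append)
      have "?Q ! (?k + length P) = shift ?k e"
        by (simp add: nth_append)
      then show "evaluates ?Q (eb (g x)) (?Q ! (?k + length P)) (ec (f (g x))) t"
        using evaluates_shift[OF t(2), of P'] by simp
    qed simp
    then show "\<exists>t\<le>poly (pcompose p p' + p' + [:1:]) (size (ea x)).
        evaluates ?Q (ea x) (Call (?k + length P) e') (ec (f (g x))) t"
      using t(1) t'(1) mono by (intro exI[of _ "t' + t + 1"]) simp
  qed
qed

fun const_expr :: "sexp \<Rightarrow> expr" where
  "const_expr Leaf = MkLeaf"
| "const_expr (Cell a b) = MkCell (const_expr a) (const_expr b)"

text \<open>The quantifiers stand in this order so that one running time serves all arguments; it
  becomes a constant polynomial.\<close>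

lemma evaluates_const: "\<exists>t. \<forall>P a. evaluates P a (const_expr c) c t"
proof (induction c)
  case Leaf
  then show ?case by (auto intro: evaluates.leaf)
next
  case (Cell a b)
  then obtain t t' where "\<forall>P x. evaluates P x (const_expr a) a t" "\<forall>P x. evaluates P x (const_expr b) b t'"
    by blast
  then show ?case by (intro exI[of _ "t + t' + 1"]) (simp add: evaluates.cell del: One_nat_def)
qed

lemma pt_const: "pt ea eb (\<lambda>_. c)"
proof -
  obtain t where "\<And>P a. evaluates P a (const_expr (eb c)) (eb c) t"
    using evaluates_const by blast
  then show ?thesis
    by (intro ptI[where p = "[:size (eb c):]" and q = "[:t:]" and P = "[]" and e = "const_expr (eb c)"])
      auto
qed

lemma pt_Pair:
  assumes f: "pt ea eb f" and g: "pt ea ec g"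
  shows "pt ea (epair eb ec) (\<lambda>x. (f x, g x))"
proof -
  obtain P e p where f1: "\<And>x. size (eb (f x)) \<le> poly p (size (ea x))"
    and f2: "\<And>x. \<exists>t \<le> poly p (size (ea x)). evaluates P (ea x) e (eb (f x)) t"
    using f by (rule ptE) blast
  obtain P' e' p' where g1: "\<And>x. size (ec (g x)) \<le> poly p' (size (ea x))"
    and g2: "\<And>x. \<exists>t \<le> poly p' (size (ea x)). evaluates P' (ea x) e' (ec (g x)) t"
    using g by (rule ptE) blast
  let ?Q = "P' @ map (shift (length P')) P"
  show ?thesis
  proof (rule ptI[where p = "p + p' + [:1:]" and q = "p + p' + [:1:]" and P = ?Q
        and e = "MkCell (shift (length P') e) e'"])
    fix x
    show "size (epair eb ec (f x, g x)) \<le> poly (p + p' + [:1:]) (size (ea x))"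
      using f1[of x] g1[of x] by (simp add: epair_def)
    obtain t where t: "t \<le> poly p (size (ea x))" "evaluates P (ea x) e (eb (f x)) t"
      using f2 by blast
    obtain t' where t': "t' \<le> poly p' (size (ea x))" "evaluates P' (ea x) e' (ec (g x)) t'"
      using g2 by blast
    have "evaluates ?Q (ea x) (MkCell (shift (length P') e) e') (Cell (eb (f x)) (ec (g x))) (t + t' + 1)"
      using evaluates_shift[OF t(2), of P' "[]"] evaluates_append[OF t'(2)]
      by (intro evaluates.cell) simp_all
    then show "\<exists>t\<le>poly (p + p' + [:1:]) (size (ea x)).
        evaluates ?Q (ea x) (MkCell (shift (length P') e) e') (epair eb ec (f x, g x)) t"
      using t(1) t'(1) by (intro exI[of _ "t + t' + 1"]) (simp add: epair_def)
  qed
qed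

lemma pt_fst: assumes "pt ea (epair eb ec) f" shows "pt ea eb (\<lambda>x. fst (f x))"
proof (rule pt_comp[OF _ assms])
  show "pt (epair eb ec) eb fst"
  proof (rule ptI[where p = "[:0, 1:]" and q = "[:2:]" and P = "[]" and e = "Left Arg"])
    fix x
    show "size (eb (fst x)) \<le> poly [:0, 1:] (size (epair eb ec x))"
      by (simp add: epair_def)
    show "\<exists>t\<le>poly [:2:] (size (epair eb ec x)). evaluates [] (epair eb ec x) (Left Arg) (eb (fst x)) t"
      using evaluates.left[OF evaluates.arg, of "[]" "epair eb ec x"]
      by (intro exI[of _ "1 + 1"]) (simp add: epair_def del: One_nat_def)
  qed
qed

lemma pt_snd: assumes "pt ea (epair eb ec) f" shows "pt ea ec (\<lambda>x. snd (f x))"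
proof (rule pt_comp[OF _ assms])
  show "pt (epair eb ec) ec snd"
  proof (rule ptI[where p = "[:0, 1:]" and q = "[:2:]" and P = "[]" and e = "Right Arg"])
    fix x
    show "size (ec (snd x)) \<le> poly [:0, 1:] (size (epair eb ec x))"
      by (simp add: epair_def)
    show "\<exists>t\<le>poly [:2:] (size (epair eb ec x)). evaluates [] (epair eb ec x) (Right Arg) (ec (snd x)) t"
      using evaluates.right[OF evaluates.arg, of "[]" "epair eb ec x"]
      by (intro exI[of _ "1 + 1"]) (simp add: epair_def del: One_nat_def)
  qed
qed

definition ebool :: "bool \<Rightarrow> sexp" where
  "ebool b = (if b then Cell Leaf Leaf else Leaf)"

text \<open>Both branches are computed into a triple beforehand and the conditional merely selects a
  component; this reduces the claim to pairing and composition.\<close>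

lemma pt_If:
  assumes b: "pt ea ebool b" and f: "pt ea eb f" and g: "pt ea eb g"
  shows "pt ea eb (\<lambda>x. if b x then f x else g x)"
proof -
  have "pt (epair ebool (epair eb eb)) eb (\<lambda>z. if fst z then fst (snd z) else snd (snd z))"
  proof (rule ptI[where p = "[:0, 1:]" and q = "[:10:]" and P = "[]"
        and e = "Cond (Left Arg) (Left (Right Arg)) (Right (Right Arg))"])
    fix x :: "bool \<times> 'b \<times> 'b"
    show "size (eb (if fst x then fst (snd x) else snd (snd x)))
        \<le> poly [:0, 1:] (size (epair ebool (epair eb eb) x))"
      by (simp add: epair_def)
    let ?E = "epair ebool (epair eb eb)"
    have 1: "evaluates [] (?E x) (Left Arg) (left (?E x)) (1 + 1)"
      and 2: "evaluates [] (?E x) (Left (Right Arg)) (left (right (?E x))) (1 + 1 + 1)"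
      and 3: "evaluates [] (?E x) (Right (Right Arg)) (right (right (?E x))) (1 + 1 + 1)"
      by (intro evaluates.intros)+
    show "\<exists>t\<le>poly [:10:] (size (?E x)). evaluates [] (?E x) (Cond (Left Arg) (Left (Right Arg)) (Right (Right Arg)))
         (eb (if fst x then fst (snd x) else snd (snd x))) t"
    proof (cases "fst x")
      case True
      then have ne: "left (?E x) \<noteq> Leaf"
        by (simp add: epair_def ebool_def)
      show ?thesis
        using evaluates.cond_cell[OF 1 ne 2, of "Right (Right Arg)"] True
        by (intro exI[of _ "1 + 1 + (1 + 1 + 1) + 1"]) (simp add: epair_def)
    next
      case False
      then have 4: "evaluates [] (?E x) (Left Arg) Leaf (1 + 1)"
        using 1 by (simp add: epair_def ebool_def)
      show ?thesis
        using evaluates.cond_leaf[OF 4 3, of "Left (Right Arg)"] False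
        by (intro exI[of _ "1 + 1 + (1 + 1 + 1) + 1"]) (simp add: epair_def)
    qed
  qed
  from pt_comp[OF this pt_Pair[OF b pt_Pair[OF f g]]] show ?thesis
    unfolding fst_conv snd_conv .
qed

section \<open>Recursion over lists\<close>

lemma size_enc_list: "size (enc_list f xs) = (\<Sum>x\<leftarrow>xs. Suc (size (f x)))"
  by (induction xs) auto

text \<open>Iterating a step of polynomial growth may produce exponential sizes, so a bound
  \<open>q\<close> on all intermediate results is a hypothesis. Each round then works on an argument
  of polynomial size, and there are as many rounds as list elements.\<close>

lemma pt_foldr_raw:
  assumes g: "pt (epair ea (epair eb es)) es (\<lambda>z. g (fst z) (fst (snd z)) (snd (snd z)))"
    and bound: "\<And>a xs s. size (es (foldr (g a) xs s)) \<le> poly q (size (epair ea (epair (enc_list eb) es) (a, xs, s)))"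
  shows "pt (epair ea (epair (enc_list eb) es)) es (\<lambda>z. foldr (g (fst z)) (fst (snd z)) (snd (snd z)))"
proof -
  obtain P e p where
    g2: "\<And>z. \<exists>t \<le> poly p (size (epair ea (epair eb es) z)).
      evaluates P (epair ea (epair eb es) z) e (es (g (fst z) (fst (snd z)) (snd (snd z)))) t"
    using g by (rule ptE) blast
  let ?E = "epair ea (epair (enc_list eb) es)"
  let ?l = "length P"
  \<comment> \<open>On the argument \<open>(a, xs, s)\<close>: if the list is nonempty, function
    \<open>?l\<close> (the step) is applied to \<open>a\<close>, the head, and the value that
    function \<open>Suc ?l\<close> (the loop itself) returns on the tail; otherwise the value is
    \<open>s\<close>.\<close>
  define loop where "loop = Cond (Left (Right Arg))
      (Call ?l (MkCell (Left Arg) (MkCell (Left (Left (Right Arg)))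
         (Call (Suc ?l) (MkCell (Left Arg) (MkCell (Right (Left (Right Arg))) (Right (Right Arg))))))))
      (Right (Right Arg))"
  define Q where "Q = P @ [e, loop]"
  have Ql: "Q ! ?l = e" "Q ! Suc ?l = loop" "?l < length Q" "Suc ?l < length Q"
    by (simp_all add: Q_def nth_append)
  \<comment> \<open>The bound \<open>n\<close> stays fixed while the list shrinks. The triple given
    to the step has size at most \<open>2 * n + 3\<close> plus that of an intermediate result; 40
    generously covers the remaining steps of one round.\<close>
  have run: "\<exists>t \<le> (length xs + 1) * (poly p (2 * n + 3 + poly q n) + 40).
      evaluates Q (?E (a, xs, s)) loop (es (foldr (g a) xs s)) t"
    if "size (?E (a, xs, s)) \<le> n" for a xs s n
    using that
  proof (induction xs)
    case Nil
    have "evaluates Q (?E (a, [], s)) (Left (Right Arg)) (left (right (?E (a, [], s)))) (1 + 1 + 1)"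
      by (intro evaluates.intros)
    then have 1: "evaluates Q (?E (a, [], s)) (Left (Right Arg)) Leaf (1 + 1 + 1)"
      by (simp add: epair_def)
    have 2: "evaluates Q (?E (a, [], s)) (Right (Right Arg)) (right (right (?E (a, [], s)))) (1 + 1 + 1)"
      by (intro evaluates.intros)
    show ?case
      using evaluates.cond_leaf[OF 1 2]
      by (intro exI[of _ "1 + 1 + 1 + (1 + 1 + 1) + 1"]) (simp add: loop_def epair_def)
  next
    case (Cons x xs)
    let ?X = "?E (a, x # xs, s)" and ?v = "foldr (g a) xs s"
    let ?B = "poly p (2 * n + 3 + poly q n)"
    have less: "size (?E (a, xs, s)) \<le> n"
      using Cons.prems by (simp add: epair_def)
    obtain t1 where t1: "t1 \<le> (length xs + 1) * (?B + 40)"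
      "evaluates Q (?E (a, xs, s)) loop (es ?v) t1"
      using Cons.IH[OF less] by blast
    obtain t2 where t2: "t2 \<le> poly p (size (epair ea (epair eb es) (a, x, ?v)))"
      "evaluates P (epair ea (epair eb es) (a, x, ?v)) e (es (g a x ?v)) t2"
      using g2[of "(a, x, ?v)"] by auto
    have "size (epair ea (epair eb es) (a, x, ?v)) \<le> 2 * n + 3 + size (es ?v)"
      using Cons.prems by (simp add: epair_def)
    also have "size (es ?v) \<le> poly q n"
      using bound[where a = a and xs = xs and s = s] nat_poly_mono[OF less, of q] by linarith
    finally have "poly p (size (epair ea (epair eb es) (a, x, ?v))) \<le> ?B"
      by (intro nat_poly_mono) simp
    then have t2': "t2 \<le> ?B"
      using t2(1) by simp
    have 1: "evaluates Q ?X (Left (Right Arg)) (left (right ?X)) (1 + 1 + 1)"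
      and 2: "evaluates Q ?X (Left Arg) (left ?X) (1 + 1)"
      and 3: "evaluates Q ?X (Left (Left (Right Arg))) (left (left (right ?X))) (1 + 1 + 1 + 1)"
      and 4: "evaluates Q ?X (Right (Left (Right Arg))) (right (left (right ?X))) (1 + 1 + 1 + 1)"
      and 5: "evaluates Q ?X (Right (Right Arg)) (right (right ?X)) (1 + 1 + 1)"
      by (intro evaluates.intros)+
    have eq: "?E (a, xs, s) = Cell (left ?X) (Cell (right (left (right ?X))) (right (right ?X)))"
      "epair ea (epair eb es) (a, x, ?v) = Cell (left ?X) (Cell (left (left (right ?X))) (es ?v))"
      by (simp_all add: epair_def)
    note rec = evaluates.call[OF evaluates.cell[OF 2 evaluates.cell[OF 4 5]] Ql(4),
        unfolded Ql, OF t1(2)[unfolded eq]]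
    note body = evaluates.call[OF evaluates.cell[OF 2 evaluates.cell[OF 3 rec]] Ql(3),
        unfolded Ql, OF evaluates_append[OF t2(2), of "[e, loop]", folded Q_def, unfolded eq]]
    have loop_eval: "evaluates Q ?X loop v t" if "evaluates Q ?X (Cond (Left (Right Arg))
      (Call ?l (MkCell (Left Arg) (MkCell (Left (Left (Right Arg)))
         (Call (Suc ?l) (MkCell (Left Arg) (MkCell (Right (Left (Right Arg))) (Right (Right Arg))))))))
      (Right (Right Arg))) v t" for v t
      using that by (simp only: loop_def)
    have ne: "left (right ?X) \<noteq> Leaf"
      by (simp add: epair_def)
    show ?case
      apply (rule exI, rule conjI[rotated])
       apply (simp only: foldr.simps o_def)
       apply (rule loop_eval[OF evaluates.cond_cell[OF 1 ne body]])
      using t1(1) t2' by simp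
  qed
  let ?r = "[:1, 1:] * (pcompose p ([:3, 2:] + q) + [:40:]) + [:2:] :: nat poly"
  show ?thesis
  proof (rule ptI[where P = Q and e = "Call (Suc ?l) Arg" and p = q and q = ?r])
    fix z :: "'a \<times> 'b list \<times> 'c"
    obtain a xs s where z: "z = (a, xs, s)" by (cases z) auto
    show "size (es (foldr (g (fst z)) (fst (snd z)) (snd (snd z)))) \<le> poly q (size (?E z))"
      using bound by (simp add: z)
    obtain t where t: "t \<le> (length xs + 1) * (poly p (2 * size (?E z) + 3 + poly q (size (?E z))) + 40)"
      "evaluates Q (?E z) loop (es (foldr (g a) xs s)) t"
      using run[where a = a and xs = xs and s = s and n = "size (?E z)"] by (auto simp: z)
    have "length xs \<le> size (enc_list eb xs)"
      by (induction xs) auto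
    then have len: "length xs + 1 \<le> size (?E z) + 1"
      by (simp add: z epair_def)
    have "t \<le> (size (?E z) + 1) * (poly p (2 * size (?E z) + 3 + poly q (size (?E z))) + 40)"
      using t(1) mult_le_mono1[OF len] by (meson order_trans)
    moreover have "evaluates Q (?E z) (Call (Suc ?l) Arg) (es (foldr (g a) xs s)) (1 + t + 1)"
      by (rule evaluates.call[OF evaluates.arg Ql(4), unfolded Ql, OF t(2)])
    ultimately show "\<exists>t\<le>poly ?r (size (?E z)). evaluates Q (?E z) (Call (Suc ?l) Arg)
        (es (foldr (g (fst z)) (fst (snd z)) (snd (snd z)))) t"
      by (intro exI[of _ "1 + t + 1"]) (simp add: z poly_pcompose algebra_simps)
  qed
qed

text \<open>Only encodings matter to \<open>pt\<close>, so results in different types with equal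
  encodings can be exchanged: a nonempty list is a pair, a unary number is a list of leaves.\<close>

lemma pt_cong_enc: "pt ea eb f \<Longrightarrow> (\<And>x. eb (f x) = ec (g x)) \<Longrightarrow> pt ea ec g"
  unfolding pt_def by simp

lemma pt_comp2:
  assumes "pt (epair eb ec) ed (\<lambda>z. f (fst z) (snd z))" "pt ea eb g" "pt ea ec h"
  shows "pt ea ed (\<lambda>x. f (g x) (h x))"
  using pt_comp[OF assms(1) pt_Pair[OF assms(2,3)]] by (simp only: fst_conv snd_conv)

lemma pt_comp3:
  assumes "pt (epair eb (epair ec ed)) ee (\<lambda>z. f (fst z) (fst (snd z)) (snd (snd z)))"
    "pt ea eb g" "pt ea ec h" "pt ea ed k"
  shows "pt ea ee (\<lambda>x. f (g x) (h x) (k x))"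
  using pt_comp[OF assms(1) pt_Pair[OF assms(2) pt_Pair[OF assms(3,4)]]]
  by (simp only: fst_conv snd_conv)

text \<open>The environment \<open>A a\<close> may be a small part of the whole argument, so that
  the size bound mentions only the data that the step uses.\<close>

lemma pt_foldr_env:
  assumes g: "pt (epair ea (epair eb es)) es (\<lambda>z. g (fst z) (fst (snd z)) (snd (snd z)))"
    and bound: "\<And>a xs s. size (es (foldr (g a) xs s))
      \<le> poly q (size (ea a) + size (enc_list eb xs) + size (es s))"
    and "pt e ea A" "pt e (enc_list eb) L" "pt e es s"
  shows "pt e es (\<lambda>a. foldr (g (A a)) (L a) (s a))"
proof -
  have "pt (epair ea (epair (enc_list eb) es)) es
    (\<lambda>z. foldr (g (fst z)) (fst (snd z)) (snd (snd z)))"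
  proof (rule pt_foldr_raw[OF g, where q = q])
    fix a xs s
    have "size (es (foldr (g a) xs s)) \<le> poly q (size (ea a) + size (enc_list eb xs) + size (es s))"
      by (rule bound)
    also have "\<dots> \<le> poly q (size (epair ea (epair (enc_list eb) es) (a, xs, s)))"
      by (intro nat_poly_mono) (simp add: epair_def)
    finally show "size (es (foldr (g a) xs s))
      \<le> poly q (size (epair ea (epair (enc_list eb) es) (a, xs, s)))" .
  qed
  from pt_comp3[OF this assms(3-5)] show ?thesis .
qed

lemma pt_foldr:
  assumes "pt (epair ea (epair eb es)) es (\<lambda>z. g (fst z) (fst (snd z)) (snd (snd z)))"
    and "pt ea (enc_list eb) L" and "pt ea es s"
    and "\<And>a xs s. size (es (foldr (g a) xs s))
      \<le> poly q (size (ea a) + size (enc_list eb xs) + size (es s))"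
  shows "pt ea es (\<lambda>a. foldr (g a) (L a) (s a))"
  by (rule pt_foldr_env[OF assms(1,4) pt_id assms(2,3)])

lemma pt_foldr_bounded:
  assumes g: "pt (epair ea (epair eb es)) es (\<lambda>z. g (fst z) (fst (snd z)) (snd (snd z)))"
    and L: "pt ea (enc_list eb) L" and s: "pt ea es s"
    and bound: "\<And>a x s. size (es (g a x s)) \<le> poly q (size (ea a))"
  shows "pt ea es (\<lambda>a. foldr (g a) (L a) (s a))"
proof (rule pt_foldr[OF g L s, where q = "q + [:0, 1:]"])
  fix a xs s
  show "size (es (foldr (g a) xs s))
    \<le> poly (q + [:0, 1:]) (size (ea a) + size (enc_list eb xs) + size (es s))"
  proof (cases xs)
    case (Cons x ys)
    have "size (es (foldr (g a) xs s)) \<le> poly q (size (ea a))"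
      using bound Cons by simp
    also have "\<dots> \<le> poly q (size (ea a) + size (enc_list eb xs) + size (es s))"
      by (intro nat_poly_mono) simp
    finally show ?thesis by simp
  qed simp
qed

lemma length_le_size_enc_list: "length xs \<le> size (enc_list f xs)"
  by (induction xs) auto

lemma size_le_size_enc_list: "x \<in> set xs \<Longrightarrow> size (f x) \<le> size (enc_list f xs)"
  by (induction xs) auto

lemma size_enc_list_le:
  assumes "\<And>x. x \<in> set xs \<Longrightarrow> size (f x) \<le> K"
  shows "size (enc_list f xs) \<le> length xs * (K + 1)"
  using assms
proof (induction xs)
  case (Cons x xs)
  have "size (f x) \<le> K" "size (enc_list f xs) \<le> length xs * (K + 1)"
    using Cons by auto
  then show ?case by simp
qed simp

section \<open>Functions on lists and unary numbers\<close>

lemma pt_Cons: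
  assumes "pt ea eb x" "pt ea (enc_list eb) xs"
  shows "pt ea (enc_list eb) (\<lambda>a. x a # xs a)"
  using pt_Pair[OF assms] by (rule pt_cong_enc) (simp add: epair_def)

lemma pt_map:
  assumes f: "pt (epair ea eb) ec (\<lambda>z. f (fst z) (snd z))" and L: "pt ea (enc_list eb) L"
  shows "pt ea (enc_list ec) (\<lambda>a. map (f a) (L a))"
proof -
  obtain p where p: "\<And>z. size (ec (f (fst z) (snd z))) \<le> poly p (size (epair ea eb z))"
    using f by (rule ptE) blast
  have step: "pt (epair ea (epair eb (enc_list ec))) (enc_list ec)
      (\<lambda>z. f (fst z) (fst (snd z)) # snd (snd z))"
    by (rule pt_Cons pt_comp2[where f = f, OF f] pt_fst pt_snd pt_id)+
  have "pt ea (enc_list ec) (\<lambda>a. foldr (\<lambda>x s. f a x # s) (L a) [])"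
  proof (rule pt_foldr[OF step L pt_const, where q = "[:0, 1:] * (pcompose p [:1, 1:] + 1) + [:0, 1:]"])
    fix a :: 'a and xs s
    let ?n = "size (ea a) + size (enc_list eb xs) + size (enc_list ec s)"
    \<comment> \<open>The induction runs over lists \<open>ys\<close> with elements from the fixed
      list \<open>xs\<close>, so that \<open>?n\<close> does not shrink with the list; the 1 in
      \<open>?n + 1\<close> is the cell of the pair \<open>(a, x)\<close>.\<close>
    have "size (enc_list ec (foldr (\<lambda>x s. f a x # s) ys s)) \<le> length ys * (poly p (?n + 1) + 1) + size (enc_list ec s)"
      if "set ys \<subseteq> set xs" for ys
      using that
    proof (induction ys)
      case (Cons x ys)
      have "size (ec (f a x)) \<le> poly p (size (epair ea eb (a, x)))"
        using p[of "(a, x)"] by simp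
      also have "\<dots> \<le> poly p (?n + 1)"
        using size_le_size_enc_list[of x xs eb] Cons.prems by (intro nat_poly_mono) (simp add: epair_def)
      finally show ?case
        using Cons by simp
    qed simp
    from this[of xs]
    have "size (enc_list ec (foldr (\<lambda>x s. f a x # s) xs s)) \<le> length xs * (poly p (?n + 1) + 1) + size (enc_list ec s)"
      by simp
    also have "length xs * (poly p (?n + 1) + 1) \<le> ?n * (poly p (?n + 1) + 1)"
      using length_le_size_enc_list[of xs eb] by (intro mult_le_mono1) simp
    finally show "size (enc_list ec (foldr (\<lambda>x s. f a x # s) xs s))
      \<le> poly ([:0, 1:] * (pcompose p [:1, 1:] + 1) + [:0, 1:]) ?n"
      by (simp add: poly_pcompose add.commute)
  qed
  moreover have "foldr (\<lambda>x s. f a x # s) xs [] = map (f a) xs" for a xs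
    by (induction xs) auto
  ultimately show ?thesis by simp
qed

lemma pt_append:
  assumes "pt ea (enc_list eb) xs" "pt ea (enc_list eb) ys"
  shows "pt ea (enc_list eb) (\<lambda>a. xs a @ ys a)"
proof -
  have "size (enc_list eb (foldr (#) xs s)) \<le> size (enc_list eb xs) + size (enc_list eb s)" for xs s
    by (induction xs) auto
  then have "pt ea (enc_list eb) (\<lambda>a. foldr (#) (xs a) (ys a))"
    by (intro pt_foldr[where q = "[:0, 1:]", OF _ assms])
      ((rule pt_Cons pt_fst pt_snd pt_id)+, simp add: add.assoc trans_le_add2)
  moreover have "foldr (#) xs ys = xs @ ys" for xs ys :: "'b list"
    by (induction xs) auto
  ultimately show ?thesis by simp
qed

lemma pt_concat:
  assumes "pt ea (enc_list (enc_list eb)) xss"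
  shows "pt ea (enc_list eb) (\<lambda>a. concat (xss a))"
proof -
  have app: "size (enc_list eb (xs @ ys)) = size (enc_list eb xs) + size (enc_list eb ys)" for xs ys
    by (induction xs) auto
  have "size (enc_list eb (foldr (@) xs s)) \<le> size (enc_list (enc_list eb) xs) + size (enc_list eb s)" for xs s
    by (induction xs) (auto simp: app)
  then have "pt ea (enc_list eb) (\<lambda>a. foldr (@) (xss a) [])"
    by (intro pt_foldr[where q = "[:0, 1:]", OF _ assms])
      ((rule pt_append pt_fst pt_snd pt_id pt_const)+, simp add: add.assoc trans_le_add2)
  then show ?thesis by (simp add: concat_conv_foldr)
qed

text \<open>The explicit default gives the empty list a chosen value, so that reading a matrix
  outside its range can be made to return 0.\<close>

definition hdd :: "'a \<Rightarrow> 'a list \<Rightarrow> 'a" where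
  "hdd d xs = (case xs of [] \<Rightarrow> d | x # _ \<Rightarrow> x)"

lemma pt_hdd:
  assumes "pt ea eb d" "pt ea (enc_list eb) xs"
  shows "pt ea eb (\<lambda>a. hdd (d a) (xs a))"
proof (rule pt_comp2[OF _ assms])
  let ?E = "epair eb (enc_list eb)"
  let ?e = "Cond (Right Arg) (Left (Right Arg)) (Left Arg)"
  show "pt ?E eb (\<lambda>z. hdd (fst z) (snd z))"
  proof (rule ptI[where p = "[:0, 1:]" and q = "[:10:]" and P = "[]" and e = ?e])
    fix z :: "'b \<times> 'b list"
    show "size (eb (hdd (fst z) (snd z))) \<le> poly [:0, 1:] (size (?E z))"
      by (auto simp: epair_def hdd_def split: list.split)
    have 1: "evaluates [] (?E z) (Right Arg) (right (?E z)) (1 + 1)"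
      and 2: "evaluates [] (?E z) (Left (Right Arg)) (left (right (?E z))) (1 + 1 + 1)"
      and 3: "evaluates [] (?E z) (Left Arg) (left (?E z)) (1 + 1)"
      by (intro evaluates.intros)+
    show "\<exists>t\<le>poly [:10:] (size (?E z)). evaluates [] (?E z) ?e (eb (hdd (fst z) (snd z))) t"
    proof (cases "snd z")
      case Nil
      then have 4: "evaluates [] (?E z) (Right Arg) Leaf (1 + 1)"
        using 1 by (simp add: epair_def)
      show ?thesis
        using evaluates.cond_leaf[OF 4 3, of "Left (Right Arg)"] Nil
        by (intro exI[of _ "1 + 1 + (1 + 1) + 1"]) (simp add: epair_def hdd_def)
    next
      case (Cons x xs)
      then have ne: "right (?E z) \<noteq> Leaf"
        by (simp add: epair_def)
      show ?thesis
        using evaluates.cond_cell[OF 1 ne 2, of "Left Arg"] Cons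
        by (intro exI[of _ "1 + 1 + (1 + 1 + 1) + 1"]) (simp add: epair_def hdd_def)
    qed
  qed
qed

text \<open>Serves both lists and numbers: on encodings tail and predecessor are the same operation,
  and \<open>right Leaf = Leaf\<close> matches \<open>tl [] = []\<close> as well as
  \<open>0 - 1 = 0\<close>.\<close>

lemma pt_right_op:
  assumes "\<And>x. eb (f x) = right (ea x)"
  shows "pt ea eb f"
proof (rule ptI[where p = "[:0, 1:]" and q = "[:2:]" and P = "[]" and e = "Right Arg"])
  fix x
  have "size (right s) \<le> size s" for s by (cases s) auto
  then show "size (eb (f x)) \<le> poly [:0, 1:] (size (ea x))"
    by (simp add: assms)
  show "\<exists>t\<le>poly [:2:] (size (ea x)). evaluates [] (ea x) (Right Arg) (eb (f x)) t"
    using evaluates.right[OF evaluates.arg, of "[]" "ea x"]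
    by (intro exI[of _ "1 + 1"]) (simp add: assms del: One_nat_def)
qed

lemma pt_tl:
  assumes "pt ea (enc_list eb) xs" shows "pt ea (enc_list eb) (\<lambda>a. tl (xs a))"
proof (rule pt_comp[OF _ assms])
  have "enc_list eb (tl x) = right (enc_list eb x)" for x by (cases x) auto
  then show "pt (enc_list eb) (enc_list eb) tl" by (rule pt_right_op)
qed

lemma pt_pred: "pt ea enc_nat n \<Longrightarrow> pt ea enc_nat (\<lambda>a. n a - 1)"
proof (rule pt_comp[OF pt_right_op, where f = "\<lambda>x. x - 1"])
  show "enc_nat (x - 1) = right (enc_nat x)" for x by (cases x) auto
qed

lemma pt_Suc:
  assumes "pt ea enc_nat n" shows "pt ea enc_nat (\<lambda>a. Suc (n a))"
  using pt_Pair[OF pt_const[of ea "\<lambda>_. Leaf" "()"] assms] by (rule pt_cong_enc) (simp add: epair_def)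

lemma pt_test:
  assumes "\<And>x. b x \<longleftrightarrow> ea x = Leaf"
  shows "pt ea ebool b"
proof (rule ptI[where p = "[:1:]" and q = "[:10:]" and P = "[]" and e = "Cond Arg MkLeaf (MkCell MkLeaf MkLeaf)"])
  fix x
  show "size (ebool (b x)) \<le> poly [:1:] (size (ea x))" by (simp add: ebool_def)
  have 1: "evaluates [] (ea x) MkLeaf Leaf 1"
    and 2: "evaluates [] (ea x) (MkCell MkLeaf MkLeaf) (Cell Leaf Leaf) (1 + 1 + 1)"
    and 3: "evaluates [] (ea x) Arg (ea x) 1"
    by (intro evaluates.intros)+
  show "\<exists>t\<le>poly [:10:] (size (ea x)).
    evaluates [] (ea x) (Cond Arg MkLeaf (MkCell MkLeaf MkLeaf)) (ebool (b x)) t"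
  proof (cases "b x")
    case True
    then have 4: "evaluates [] (ea x) Arg Leaf 1" using 3 assms by simp
    show ?thesis
      using evaluates.cond_leaf[OF 4 2, of MkLeaf] True
      by (intro exI[of _ "1 + (1 + 1 + 1) + 1"]) (simp add: ebool_def)
  next
    case False
    then have ne: "ea x \<noteq> Leaf" using assms by simp
    show ?thesis
      using evaluates.cond_cell[OF 3 ne 1, of "MkCell MkLeaf MkLeaf"] False
      by (intro exI[of _ "1 + 1 + 1"]) (simp add: ebool_def)
  qed
qed

lemma pt_nat_zero: "pt ea enc_nat n \<Longrightarrow> pt ea ebool (\<lambda>a. n a = 0)"
proof (rule pt_comp[OF pt_test, where f = "\<lambda>x. x = 0"])
  show "x = 0 \<longleftrightarrow> enc_nat x = Leaf" for x by (cases x) auto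
qed

lemma pt_conj:
  assumes "pt ea ebool b" "pt ea ebool c" shows "pt ea ebool (\<lambda>a. b a \<and> c a)"
  using pt_If[OF assms pt_const[where c = False]] by (rule pt_cong_enc) simp

text \<open>A unary number is a list without content; bounded iteration thereby becomes a special
  case of list recursion.\<close>

lemma enc_nat_eq: "enc_nat n = enc_list (\<lambda>_ :: unit. Leaf) (replicate n ())"
  by (induction n) auto

lemma pt_funpow:
  assumes g: "pt (epair ea es) es (\<lambda>z. g (fst z) (snd z))"
    and n: "pt ea enc_nat n" and s: "pt ea es s"
    and bound: "\<And>a n s. size (es ((g a ^^ n) s)) \<le> poly q (size (ea a) + n + size (es s))"
  shows "pt ea es (\<lambda>a. (g a ^^ n a) (s a))"
proof -
  have fp: "foldr (\<lambda>_ :: unit. f) xs s = (f ^^ length xs) s" for f :: "'b \<Rightarrow> 'b" and xs s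
    by (induction xs) auto
  have L: "pt ea (enc_list (\<lambda>_ :: unit. Leaf)) (\<lambda>a. replicate (n a) ())"
    using n by (rule pt_cong_enc) (simp add: enc_nat_eq)
  have "pt ea es (\<lambda>a. foldr (\<lambda>_. g a) (replicate (n a) ()) (s a))"
  proof (rule pt_foldr[OF _ L s])
    show "pt (epair ea (epair (\<lambda>_. Leaf) es)) es (\<lambda>z. g (fst z) (snd (snd z)))"
      by (rule pt_comp2[where f = g, OF g] pt_fst pt_snd pt_id)+
    fix a and xs :: "unit list" and s
    have "size (es ((g a ^^ length xs) s)) \<le> poly q (size (ea a) + length xs + size (es s))"
      by (rule bound)
    also have "\<dots> \<le> poly q (size (ea a) + size (enc_list (\<lambda>_ :: unit. Leaf) xs) + size (es s))"
      using length_le_size_enc_list by (intro nat_poly_mono add_mono) auto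
    finally show "size (es (foldr (\<lambda>_. g a) xs s))
      \<le> poly q (size (ea a) + size (enc_list (\<lambda>_ :: unit. Leaf) xs) + size (es s))"
      by (simp add: fp)
  qed
  then show ?thesis by (simp add: fp)
qed

definition nthd :: "'a \<Rightarrow> 'a list \<Rightarrow> nat \<Rightarrow> 'a" where
  "nthd d xs i = hdd d ((tl ^^ i) xs)"

lemma nthd_nth: "i < length xs \<Longrightarrow> nthd d xs i = xs ! i"
proof (induction i arbitrary: xs)
  case 0
  then show ?case by (cases xs) (auto simp: nthd_def hdd_def)
next
  case (Suc i)
  then show ?case by (cases xs) (auto simp: nthd_def funpow_swap1)
qed

lemma pt_nthd:
  assumes "pt ea eb d" "pt ea (enc_list eb) xs" "pt ea enc_nat i"
  shows "pt ea eb (\<lambda>a. nthd (d a) (xs a) (i a))"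
  unfolding nthd_def
proof (intro pt_hdd assms pt_funpow[where q = "[:0, 1:]" and g = "\<lambda>_. tl"])
  show "pt (epair ea (enc_list eb)) (enc_list eb) (\<lambda>z. tl (snd z))"
    by (rule pt_tl pt_snd pt_id)+
  fix n and s :: "'b list"
  have tl: "size (enc_list eb (tl s)) \<le> size (enc_list eb s)" for s :: "'b list"
    by (cases s) auto
  have "size (enc_list eb ((tl ^^ n) s)) \<le> size (enc_list eb s)"
    by (induction n) (auto intro: order_trans[OF tl])
  then show "size (enc_list eb ((tl ^^ n) s)) \<le> poly [:0, 1:] (size (ea a) + n + size (enc_list eb s))" for a
    by simp
qed

lemma size_enc_nat [simp]: "size (enc_nat n) = n"
  by (induction n) auto

lemma pt_minus:
  assumes "pt ea enc_nat m" "pt ea enc_nat n"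
  shows "pt ea enc_nat (\<lambda>a. m a - n a)"
proof -
  have eq: "((\<lambda>k. k - 1) ^^ n) m = m - n" for n m :: nat
    by (induction n) auto
  have "pt ea enc_nat (\<lambda>a. ((\<lambda>k. k - 1) ^^ n a) (m a))"
    by (rule pt_funpow[where q = "[:0, 1:]" and g = "\<lambda>_ k. k - 1"])
      ((rule assms pt_pred pt_snd pt_id)+, simp only: eq size_enc_nat, simp)
  then show ?thesis unfolding eq .
qed

lemma pt_nat_eq:
  assumes "pt ea enc_nat m" "pt ea enc_nat n"
  shows "pt ea ebool (\<lambda>a. m a = n a)"
proof -
  have "pt ea ebool (\<lambda>a. m a - n a = 0 \<and> n a - m a = 0)"
    by (intro pt_conj pt_nat_zero pt_minus assms)
  then show ?thesis by (rule pt_cong_enc) (auto intro!: arg_cong[where f = ebool])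
qed

lemma pt_upt:
  assumes "pt ea enc_nat n"
  shows "pt ea (enc_list enc_nat) (\<lambda>a. [0..<n a])"
proof -
  \<comment> \<open>Counting down yields the largest element first, so that every element can be
    prepended to the list of the later ones.\<close>
  define g where "g = (\<lambda>z :: nat \<times> nat list. (fst z - 1, (fst z - 1) # snd z))"
  let ?E = "epair enc_nat (enc_list enc_nat)"
  have inv: "fst ((g ^^ m) z) \<le> fst z \<and>
      size (enc_list enc_nat (snd ((g ^^ m) z))) \<le> m * (fst z + 1) + size (enc_list enc_nat (snd z))" for m z
    by (induction m) (auto simp: g_def)
  have size_pair: "size (?E w) = fst w + size (enc_list enc_nat (snd w)) + 1" for w
    by (simp add: epair_def)
  have bound: "size (?E ((g ^^ m) z)) \<le> 1 + fst z + m * (fst z + 1) + size (enc_list enc_nat (snd z))" for m z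
    using inv[of m z] size_pair[of "(g ^^ m) z"] by linarith
  have "pt ea ?E (\<lambda>a. (g ^^ n a) (n a, []))"
  proof (rule pt_funpow[where q = "[:1,1:] + [:0,1:] * [:1,1:] + [:0,1:]" and g = "\<lambda>_. g", OF _ assms])
    show "pt (epair ea ?E) ?E (\<lambda>z. g (snd z))"
      unfolding g_def by (rule pt_Pair pt_Cons pt_pred pt_fst pt_snd pt_id)+
    show "pt ea ?E (\<lambda>a. (n a, []))"
      by (intro pt_Pair assms pt_const)
    fix a m and z :: "nat \<times> nat list"
    let ?n = "size (ea a) + m + size (?E z)"
    have "m * (fst z + 1) \<le> ?n * (?n + 1)"
      by (intro mult_le_mono) (auto simp: epair_def)
    moreover have "fst z \<le> ?n" "size (enc_list enc_nat (snd z)) \<le> ?n"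
      by (auto simp: epair_def)
    ultimately have "1 + fst z + m * (fst z + 1) + size (enc_list enc_nat (snd z)) \<le> (1 + ?n) + ?n * (?n + 1) + ?n"
      by linarith
    with bound[of m z] have "size (?E ((g ^^ m) z)) \<le> (1 + ?n) + ?n * (?n + 1) + ?n"
      by linarith
    then show "size (?E ((g ^^ m) z)) \<le> poly ([:1,1:] + [:0,1:] * [:1,1:] + [:0,1:]) ?n"
      by (simp add: mult.commute)
  qed
  from pt_snd[OF this] show ?thesis
  proof (rule pt_cong_enc)
    fix x
    have "m \<le> k \<Longrightarrow> (g ^^ m) (k, []) = (k - m, [k - m..<k])" for k m
      by (induction m) (auto simp: g_def upt_conv_Cons Suc_diff_Suc)
    then show "enc_list enc_nat (snd ((g ^^ n x) (n x, []))) = enc_list enc_nat [0..<n x]"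
      by simp
  qed
qed

lemma pt_length:
  assumes "pt ea (enc_list eb) xs"
  shows "pt ea enc_nat (\<lambda>a. length (xs a))"
proof -
  have eq: "foldr (\<lambda>_. Suc) xs n = length xs + n" for xs :: "'b list" and n
    by (induction xs) auto
  have "pt ea enc_nat (\<lambda>a. foldr (\<lambda>_. Suc) (xs a) 0)"
  proof (rule pt_foldr[where q = "[:0, 1:]" and g = "\<lambda>_ _. Suc", OF _ assms])
    fix a and xs :: "'b list" and s
    show "size (enc_nat (foldr (\<lambda>_. Suc) xs s))
        \<le> poly [:0, 1:] (size (ea a) + size (enc_list eb xs) + size (enc_nat s))"
      using length_le_size_enc_list[of xs eb] by (simp add: eq)
  qed (rule pt_Suc pt_snd pt_id pt_const)+
  then show ?thesis by (simp add: eq)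
qed

lemma pt_list_all:
  assumes P: "pt (epair ea eb) ebool (\<lambda>z. P (fst z) (snd z))" and L: "pt ea (enc_list eb) L"
  shows "pt ea ebool (\<lambda>a. list_all (P a) (L a))"
proof -
  have "pt ea ebool (\<lambda>a. foldr (\<lambda>x b. if P a x then b else False) (L a) True)"
    by (rule pt_foldr_bounded[where q = "[:1:]" and g = "\<lambda>a x b. if P a x then b else False", OF _ L])
      ((rule pt_If pt_comp2[where f = P, OF P] pt_fst pt_snd pt_id pt_const)+, simp add: ebool_def)
  moreover have "foldr (\<lambda>x b. if Q x then b else False) xs True = list_all Q xs" for Q and xs :: "'b list"
    by (induction xs) auto
  ultimately show ?thesis by simp
qed

section \<open>The algorithm\<close>

text \<open>The index range is passed as a list, later \<open>[0..<n]\<close>, because recursion in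
  this class of functions runs over lists.\<close>

definition tab :: "nat list \<Rightarrow> (nat \<Rightarrow> nat \<Rightarrow> 'k) \<Rightarrow> 'k list list" where
  "tab J f = map (\<lambda>i. map (f i) J) J"

text \<open>Positions outside the list read as 0. This makes the entries compatible with entrywise
  field homomorphisms on lists of any shape.\<close>

definition ent :: "'k::field list list \<Rightarrow> nat \<Rightarrow> nat \<Rightarrow> 'k" where
  "ent A i j = nthd 0 (nthd [] A i) j"

definition dot :: "nat list \<Rightarrow> 'k::field list list \<Rightarrow> 'k list list \<Rightarrow> nat \<Rightarrow> nat \<Rightarrow> 'k" where
  "dot J A Y i j = foldr (\<lambda>k s. ent A i k * ent Y k j + s) J 0"

definition mmul :: "nat list \<Rightarrow> 'k::field list list \<Rightarrow> 'k list list \<Rightarrow> 'k list list" where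
  "mmul J A Y = tab J (dot J A Y)"

definition msub :: "nat list \<Rightarrow> 'k::field \<Rightarrow> 'k list list \<Rightarrow> 'k list list \<Rightarrow> 'k list list" where
  "msub J c P A = tab J (\<lambda>i j. ent A i j - c * ent P i j)"

definition prs :: "nat list \<Rightarrow> (nat \<times> nat) list" where
  "prs J = concat (map (\<lambda>i. map (Pair i) J) J)"

definition ident :: "nat list \<Rightarrow> 'k::field list list" where
  "ident J = tab J (\<lambda>i j. if i = j then 1 else 0)"

definition units :: "nat list \<Rightarrow> 'k::field list list list" where
  "units J = map (\<lambda>q. tab J (\<lambda>i j. if i = fst q \<and> j = snd q then 1 else 0)) (prs J)"

text \<open>A pivot is a matrix together with its (preferably nonzero) value under the functional that is
  being eliminated.  If the functional vanishes on the whole list, then the pivot has value 0 and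
  \<open>clear\<close> changes nothing, because division by 0 gives 0.\<close>

definition pivot :: "nat list \<Rightarrow> ('k::field \<times> 'k list list) list \<Rightarrow> 'k \<times> 'k list list" where
  "pivot J L = foldr (\<lambda>x p. if fst x \<noteq> 0 then x else p) L (0, tab J (\<lambda>_ _. 0))"

definition clear ::
  "nat list \<Rightarrow> ('k::field \<times> 'k list list) \<Rightarrow> ('k \<times> 'k list list) list \<Rightarrow> 'k list list list" where
  "clear J p L = map (\<lambda>x. msub J (fst x / fst p) (snd p) (snd x)) L"

text \<open>For \<open>q = (M, i, j)\<close> this is the entry \<open>(i, j)\<close> of
  \<open>A M - M A\<close>, a linear functional of \<open>A\<close>; the commutant is the common
  kernel of these functionals.\<close>

definition commutator_entry ::
  "nat list \<Rightarrow> 'k::field list list \<times> nat \<times> nat \<Rightarrow> 'k list list \<Rightarrow> 'k" where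
  "commutator_entry J q A = dot J A (fst q) (fst (snd q)) (snd (snd q))
     - dot J (fst q) A (fst (snd q)) (snd (snd q))"

text \<open>Clearing a pivot against itself leaves a zero matrix in the list instead of removing it,
  so the length never changes.\<close>

definition kernel_step ::
  "nat list \<Rightarrow> 'k::field list list \<times> nat \<times> nat \<Rightarrow> 'k list list list \<Rightarrow> 'k list list list" where
  "kernel_step J q L =
     clear J (pivot J (map (\<lambda>A. (commutator_entry J q A, A)) L))
       (map (\<lambda>A. (commutator_entry J q A, A)) L)"

definition commutant_basis :: "nat list \<Rightarrow> 'k::field list list list \<Rightarrow> 'k list list list" where
  "commutant_basis J Ms =
     foldr (kernel_step J) (concat (map (\<lambda>M. map (Pair M) (prs J)) Ms)) (units J)"

text \<open>Row reduction with the matrix entries as functionals. The state holds the matrices still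
  to be reduced and the pivots collected so far; a position without pivot contributes a zero
  matrix.\<close>

definition reduce_step ::
  "nat list \<Rightarrow> nat \<times> nat \<Rightarrow> 'k::field list list list \<times> 'k list list list
    \<Rightarrow> 'k list list list \<times> 'k list list list" where
  "reduce_step J q S =
     (clear J (pivot J (map (\<lambda>A. (ent A (fst q) (snd q), A)) (fst S)))
        (map (\<lambda>A. (ent A (fst q) (snd q), A)) (fst S)),
      snd (pivot J (map (\<lambda>A. (ent A (fst q) (snd q), A)) (fst S))) # snd S)"

definition reduce :: "nat list \<Rightarrow> 'k::field list list list \<Rightarrow> 'k list list list" where
  "reduce J L = snd (foldr (reduce_step J) (prs J) (L, []))"

text \<open>The unreduced list is longer than \<open>W\<close> by the factor
  \<open>length ms\<close>; reduction in every round prevents exponential growth.\<close>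

definition chain_step ::
  "nat list \<Rightarrow> 'k::field list list list \<Rightarrow> 'k list list list \<Rightarrow> 'k list list list" where
  "chain_step J ms W = reduce J (concat (map (\<lambda>m. map (\<lambda>w. mmul J w m) W) ms))"

text \<open>There are as many rounds as index pairs, because in the nilpotent case the products of length \<open>k\<close>
  lie in the \<open>k\<close>-th term of a chain of matrix spaces that decreases strictly down to 0.\<close>

definition nilpotent_list :: "nat list \<Rightarrow> 'k::field list list list \<Rightarrow> bool" where
  "nilpotent_list J ms = list_all (\<lambda>A. list_all (\<lambda>q. ent A (fst q) (snd q) = 0) (prs J))
     (foldr (\<lambda>_. chain_step J ms) (prs J) [ident J])"

text \<open>On a one-element list \<open>nilpotent_list\<close> tests nilpotency of a single matrix,
  so the unknown eigenvalue is found by trying the scalars in \<open>Fs\<close>, whose number is a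
  constant.\<close>

definition pick :: "'k::field list \<Rightarrow> nat list \<Rightarrow> 'k list list \<Rightarrow> 'k list list" where
  "pick Fs J b = foldr (\<lambda>c r. if nilpotent_list J [msub J c (ident J) b]
     then msub J c (ident J) b else r) Fs b"

text \<open>If \<open>b - c\<close> is nilpotent for no scalar \<open>c\<close>, then \<open>pick\<close> returns \<open>b\<close> itself, which makes the
  final test fail.\<close>

definition decide :: "'k::field list \<Rightarrow> nat list \<Rightarrow> 'k list list list \<Rightarrow> bool" where
  "decide Fs J Ms = nilpotent_list J (map (pick Fs J) (commutant_basis J Ms))"

text \<open>Commuting with the projections to the vertex spaces means being block diagonal.\<close>

definition vertex_mat :: "(nat \<times> nat) list \<Rightarrow> nat \<Rightarrow> 'k::field list list" where
  "vertex_mat idx v = tab [0..<length idx]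
     (\<lambda>a b. if a = b \<and> fst (nthd (0, 0) idx a) = v then 1 else 0)"

text \<open>\<open>A\<close> consists of tail, head and entries in the order of the input; the head
  selects the block row, the tail the block column.\<close>

definition arc_mat :: "(nat \<times> nat) list \<Rightarrow> nat \<times> nat \<times> 'k::field list list \<Rightarrow> 'k list list" where
  "arc_mat idx A = tab [0..<length idx]
     (\<lambda>a b. if fst (nthd (0, 0) idx a) = fst (snd A) \<and> fst (nthd (0, 0) idx b) = fst A
        then ent (snd (snd A)) (snd (nthd (0, 0) idx a)) (snd (nthd (0, 0) idx b)) else 0)"

text \<open>The basis of the direct sum of all vertex spaces, as pairs of a vertex and a coordinate.
  A position in this list is a row or column number of the block matrices.\<close>

definition index_list :: "nat list \<Rightarrow> (nat \<times> nat) list" where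
  "index_list ds = concat (map (\<lambda>v. map (Pair v) [0..<nthd 0 ds v]) [0..<length ds])"

definition algorithm :: "'k::field list \<Rightarrow> nat list \<times> (nat \<times> nat \<times> 'k list list) list \<Rightarrow> bool" where
  "algorithm Fs I = decide Fs [0..<length (index_list (fst I))]
     (map (vertex_mat (index_list (fst I))) [0..<length (fst I)] @
      map (arc_mat (index_list (fst I))) (snd I))"

section \<open>Lengths and shapes of the intermediate lists\<close>

lemma pivot_mem: "snd (pivot J (map (\<lambda>A. (f A, A)) L)) \<in> set L \<union> range (tab J)"
  unfolding pivot_def by (induction L) auto

text \<open>Membership in \<open>range (tab J)\<close> is what bounds encodings later: over a finite
  field the size of such a matrix depends only on \<open>length J\<close>, whatever it was computed
  from.\<close>

lemma clear_mem: "set (clear J p L) \<subseteq> range (tab J)"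
  by (auto simp: clear_def msub_def)

lemma length_kernel_step [simp]: "length (kernel_step J q L) = length L"
  by (simp add: kernel_step_def clear_def)

lemma kernel_step_mem: "set (kernel_step J q L) \<subseteq> range (tab J)"
  by (simp add: kernel_step_def clear_mem)

lemma length_kernel [simp]: "length (foldr (kernel_step J) qs L) = length L"
  by (induction qs) auto

lemma reduce_step_mem:
  "length (fst (reduce_step J q T)) = length (fst T)"
  "length (snd (reduce_step J q T)) = Suc (length (snd T))"
  "set (fst (reduce_step J q T)) \<subseteq> range (tab J)"
  "set (snd (reduce_step J q T)) \<subseteq> set (fst T) \<union> set (snd T) \<union> range (tab J)"
  using pivot_mem[of J "\<lambda>A. ent A (fst q) (snd q)" "fst T"]
  by (simp_all add: reduce_step_def clear_mem) (auto simp: clear_def)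

lemma reduce_steps_mem:
  "length (fst (foldr (reduce_step J) qs S)) = length (fst S) \<and>
   length (snd (foldr (reduce_step J) qs S)) = length qs + length (snd S) \<and>
   set (fst (foldr (reduce_step J) qs S)) \<subseteq> set (fst S) \<union> range (tab J) \<and>
   set (snd (foldr (reduce_step J) qs S)) \<subseteq> set (fst S) \<union> set (snd S) \<union> range (tab J)"
proof (induction qs)
  case (Cons q qs)
  then show ?case
    using reduce_step_mem[of J q "foldr (reduce_step J) qs S"] by (auto simp: subset_iff)
qed auto

lemma reduce_mem: "set (reduce J L) \<subseteq> set L \<union> range (tab J)"
  using reduce_steps_mem[of "J" "prs J" "(L, [])"] by (simp add: reduce_def)

lemma length_reduce: "length (reduce J L) = length (prs J)"
  using reduce_steps_mem[of "J" "prs J" "(L, [])"] by (simp add: reduce_def)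

lemma length_prs: "length (prs J) = length J * length J"
  by (simp add: prs_def length_concat comp_def sum_list_triv)

lemma chain_step_mem: "set (chain_step J ms W) \<subseteq> range (tab J)"
  using reduce_mem by (fastforce simp: chain_step_def mmul_def)

section \<open>Running time\<close>

text \<open>Over a finite type termination is enough: the maxima of time and size over all arguments
  are constant polynomials.\<close>

lemma pt_finiteI:
  fixes f :: "'a::finite \<Rightarrow> 'b"
  assumes "\<And>x. \<exists>t. evaluates P (ea x) e (eb (f x)) t"
  shows "pt ea eb f"
proof -
  obtain t where t: "\<And>x. evaluates P (ea x) e (eb (f x)) (t x)"
    using assms by metis
  show ?thesis
  proof (rule ptI[where p = "[:Max (range (\<lambda>x. size (eb (f x)))):]" and q = "[:Max (range t):]" and P = P and e = e])
    fix x
    show "size (eb (f x)) \<le> poly [:Max (range (\<lambda>x. size (eb (f x)))):] (size (ea x))"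
      by (simp add: Max_ge)
    show "\<exists>s\<le>poly [:Max (range t):] (size (ea x)). evaluates P (ea x) e (eb (f x)) s"
      using t by (intro exI[of _ "t x"]) (simp add: Max_ge)
  qed
qed

text \<open>Lookup by a unary number: the nested conditionals peel off one cell per entry and stop
  at the entry where \<open>Leaf\<close> is reached.\<close>

fun table_expr :: "expr \<Rightarrow> expr list \<Rightarrow> expr" where
  "table_expr e [] = MkLeaf"
| "table_expr e (c # cs) = Cond e (table_expr (Right e) cs) c"

lemma evaluates_table:
  assumes "evaluates P a e (enc_nat n) t" "n < length cs" "evaluates P a (cs ! n) v t'"
  shows "\<exists>s. evaluates P a (table_expr e cs) v s"
  using assms
proof (induction cs arbitrary: e n t)
  case (Cons c cs)
  show ?case
  proof (cases n)
    case 0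
    then show ?thesis
      using Cons.prems evaluates.cond_leaf[of P a e t c v t'] by (auto intro!: exI)
  next
    case (Suc m)
    have "evaluates P a (Right e) (enc_nat m) (t + 1)"
      using evaluates.right[OF Cons.prems(1)] Suc by simp
    then obtain s where "evaluates P a (table_expr (Right e) cs) v s"
      using Cons.IH[of "Right e" m "t + 1"] Cons.prems Suc by auto
    with Cons.prems(1) Suc show ?thesis
      by (auto intro!: exI evaluates.cond_cell)
  qed
qed simp

section \<open>Arithmetic with coded field elements and matrices\<close>

locale coded_field =
  fixes code :: "'k::{field,finite} \<Rightarrow> nat"
  assumes inj_code: "inj code"
begin

abbreviation ek :: "'k \<Rightarrow> sexp" where "ek \<equiv> \<lambda>x. enc_nat (code x)"
abbreviation em :: "'k list list \<Rightarrow> sexp" where "em \<equiv> enc_list (enc_list ek)"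

definition bound :: nat where "bound = Max (range code)"

lemma code_le_bound: "code x \<le> bound"
  by (simp add: bound_def Max_ge)

lemma pt_field2:
  fixes f :: "'k \<Rightarrow> 'k \<Rightarrow> 'b"
  assumes "pt ea ek x" "pt ea ek y"
  shows "pt ea eb (\<lambda>a. f (x a) (y a))"
proof (rule pt_comp2[OF _ assms])
  \<comment> \<open>The codes are inverted when the tables are written down, not at run time;
    entries at numbers outside the range of \<open>code\<close> are never looked up.\<close>
  define row where "row = (\<lambda>m. table_expr (Right Arg)
    (map (\<lambda>n. const_expr (eb (f (inv_into UNIV code m) (inv_into UNIV code n)))) [0..<Suc bound]))"
  define e where "e = table_expr (Left Arg) (map row [0..<Suc bound])"
  show "pt (epair ek ek) eb (\<lambda>z. f (fst z) (snd z))"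
  proof (rule pt_finiteI[where P = "[]" and e = e])
    fix z :: "'k \<times> 'k"
    obtain x y where z: "z = (x, y)" by (cases z)
    have inv: "inv_into UNIV code (code u) = u" for u
      using inj_code by simp
    have less: "code u < Suc bound" for u
      using code_le_bound[of u] by simp
    have l: "evaluates [] (epair ek ek z) (Left Arg) (enc_nat (code x)) (1 + 1)"
      using evaluates.left[OF evaluates.arg, of "[]" "epair ek ek z"] by (simp add: epair_def z)
    have r: "evaluates [] (epair ek ek z) (Right Arg) (enc_nat (code y)) (1 + 1)"
      using evaluates.right[OF evaluates.arg, of "[]" "epair ek ek z"] by (simp add: epair_def z)
    obtain t where "evaluates [] (epair ek ek z) (const_expr (eb (f x y))) (eb (f x y)) t"
      using evaluates_const by blast
    then have "\<exists>s. evaluates [] (epair ek ek z) (row (code x)) (eb (f x y)) s"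
      unfolding row_def using less
      by (intro evaluates_table[OF r]) (simp_all add: inv del: upt_Suc)
    then obtain s where "evaluates [] (epair ek ek z) (row (code x)) (eb (f x y)) s"
      by blast
    then have "\<exists>s. evaluates [] (epair ek ek z) e (eb (f x y)) s"
      unfolding e_def using less
      by (intro evaluates_table[OF l]) (simp_all del: upt_Suc)
    then show "\<exists>t. evaluates [] (epair ek ek z) e (eb (f (fst z) (snd z))) t"
      by (simp add: z)
  qed
qed

lemma pt_field1:
  fixes f :: "'k \<Rightarrow> 'b"
  assumes "pt ea ek x" shows "pt ea eb (\<lambda>a. f (x a))"
  using pt_field2[OF assms assms, of eb "\<lambda>u _. f u"] .

lemma size_tab: "size (em (tab J f)) \<le> length J * (length J * (bound + 1) + 1)"
proof -
  have row: "size (enc_list ek (map (f i) J)) \<le> length J * (bound + 1)" for i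
    using size_enc_list_le[of "map (f i) J" ek bound] code_le_bound by simp
  have "size (em (tab J f)) \<le> length (tab J f) * (length J * (bound + 1) + 1)"
    by (rule size_enc_list_le) (use row in \<open>auto simp: tab_def\<close>)
  then show ?thesis by (simp add: tab_def)
qed

definition tab_poly :: "nat poly" where
  "tab_poly = [:0, 1:] * ([:0, 1:] * [:bound + 1:] + 1)"

lemma size_tab_poly: "A \<in> range (tab J) \<Longrightarrow> length J \<le> n \<Longrightarrow> size (em A) \<le> poly tab_poly n"
proof -
  assume "A \<in> range (tab J)" and n: "length J \<le> n"
  then have "size (em A) \<le> length J * (length J * (bound + 1) + 1)"
    using size_tab by auto
  also have "\<dots> \<le> n * (n * (bound + 1) + 1)"
    using n by (intro mult_le_mono add_mono) auto
  finally show ?thesis by (simp add: tab_poly_def)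
qed

lemma pt_tab:
  assumes "pt (epair (epair ea enc_nat) enc_nat) ek (\<lambda>z. f (fst (fst z)) (snd (fst z)) (snd z))"
    and "pt ea (enc_list enc_nat) I"
  shows "pt ea em (\<lambda>a. tab (I a) (f a))"
  unfolding tab_def
  by (rule pt_map[OF pt_map[OF assms(1) pt_comp[OF assms(2) pt_fst[OF pt_id]]] assms(2)])

lemma pt_ent:
  assumes "pt ea em A" "pt ea enc_nat i" "pt ea enc_nat j"
  shows "pt ea ek (\<lambda>a. ent (A a) (i a) (j a))"
  unfolding ent_def by (rule pt_nthd assms pt_const)+

lemma pt_add: "pt ea ek x \<Longrightarrow> pt ea ek y \<Longrightarrow> pt ea ek (\<lambda>a. x a + y a)"
  and pt_mult: "pt ea ek x \<Longrightarrow> pt ea ek y \<Longrightarrow> pt ea ek (\<lambda>a. x a * y a)"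
  and pt_diff: "pt ea ek x \<Longrightarrow> pt ea ek y \<Longrightarrow> pt ea ek (\<lambda>a. x a - y a)"
  and pt_divide: "pt ea ek x \<Longrightarrow> pt ea ek y \<Longrightarrow> pt ea ek (\<lambda>a. x a / y a)"
  and pt_field_zero: "pt ea ek x \<Longrightarrow> pt ea ebool (\<lambda>a. x a = 0)"
  and pt_field_nonzero: "pt ea ek x \<Longrightarrow> pt ea ebool (\<lambda>a. x a \<noteq> 0)"
  by (rule pt_field2 pt_field1; assumption)+

lemmas pt_rules = pt_Pair pt_fst pt_snd pt_id pt_ent pt_add pt_mult pt_diff pt_divide
  pt_field_zero pt_field_nonzero pt_conj pt_nat_eq pt_If pt_Cons pt_append pt_concat pt_map
  pt_upt pt_length pt_nthd pt_list_all pt_tab pt_const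

lemma pt_dot:
  assumes "pt ea (enc_list enc_nat) I" "pt ea em A" "pt ea em Y" "pt ea enc_nat i" "pt ea enc_nat j"
  shows "pt ea ek (\<lambda>a. dot (I a) (A a) (Y a) (i a) (j a))"
proof -
  let ?E = "epair (enc_list enc_nat) (epair em (epair em (epair enc_nat enc_nat)))"
  let ?g = "\<lambda>z :: nat list \<times> 'k list list \<times> 'k list list \<times> nat \<times> nat.
    \<lambda>k s. ent (fst (snd z)) (fst (snd (snd (snd z)))) k * ent (fst (snd (snd z))) k (snd (snd (snd (snd z)))) + s"
  have "pt ?E ek (\<lambda>z. foldr (?g z) (fst z) 0)"
  \<comment> \<open>The accumulator is a single field element, whose code is at most
    \<open>bound\<close>.\<close>
  proof (rule pt_foldr_bounded[where q = "[:bound:]"])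
    show "pt (epair ?E (epair enc_nat ek)) ek (\<lambda>z. ?g (fst z) (fst (snd z)) (snd (snd z)))"
      by (rule pt_rules)+
  qed (rule pt_rules | simp add: code_le_bound)+
  from pt_comp[OF this pt_Pair[OF assms(1) pt_Pair[OF assms(2) pt_Pair[OF assms(3) pt_Pair[OF assms(4,5)]]]]]
  show ?thesis by (simp only: dot_def fst_conv snd_conv)
qed


text \<open>Inside a tabulation the argument has grown to a nested pair containing the indices. The
  instances of \<open>pt_comp\<close> with a fixed function recover the given data from the
  component that holds the original argument.\<close>

lemma pt_mmul:
  assumes "pt ea (enc_list enc_nat) I" "pt ea em A" "pt ea em B"
  shows "pt ea em (\<lambda>a. mmul (I a) (A a) (B a))"
  unfolding mmul_def
  by (rule pt_tab pt_dot assms pt_comp[where f = I, OF assms(1)] pt_comp[where f = A, OF assms(2)]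
      pt_comp[where f = B, OF assms(3)] pt_rules)+

lemma pt_msub:
  assumes "pt ea (enc_list enc_nat) I" "pt ea ek c" "pt ea em A" "pt ea em B"
  shows "pt ea em (\<lambda>a. msub (I a) (c a) (A a) (B a))"
  unfolding msub_def
  by (rule pt_tab assms pt_comp[where f = I, OF assms(1)] pt_comp[where f = c, OF assms(2)]
      pt_comp[where f = A, OF assms(3)] pt_comp[where f = B, OF assms(4)] pt_rules)+

lemma pt_prs:
  assumes "pt ea (enc_list enc_nat) I"
  shows "pt ea (enc_list (epair enc_nat enc_nat)) (\<lambda>a. prs (I a))"
  unfolding prs_def by (rule assms pt_comp[where f = I, OF assms(1)] pt_rules)+

lemma pt_ident:
  assumes "pt ea (enc_list enc_nat) I"
  shows "pt ea em (\<lambda>a. ident (I a))"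
  unfolding ident_def by (rule assms pt_comp[where f = I, OF assms(1)] pt_rules)+

lemma pt_units:
  assumes "pt ea (enc_list enc_nat) I"
  shows "pt ea (enc_list em) (\<lambda>a. units (I a))"
  unfolding units_def by (rule assms pt_prs pt_comp[where f = I, OF assms(1)] pt_rules)+

lemmas pt_rules2 = pt_mmul pt_msub pt_prs pt_ident pt_units pt_dot pt_rules

end

section \<open>The components of the algorithm\<close>

context coded_field
begin

abbreviation eJ :: "nat list \<Rightarrow> sexp" where "eJ \<equiv> enc_list enc_nat"
abbreviation ep :: "nat \<times> nat \<Rightarrow> sexp" where "ep \<equiv> epair enc_nat enc_nat"

text \<open>The fold returns a list element or its start value, so no new size arises. Its step has
  no parameter, hence the unit environment.\<close>

lemma pt_pivot:
  assumes "pt ea eJ I" "pt ea (enc_list (epair ek em)) L"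
  shows "pt ea (epair ek em) (\<lambda>a. pivot (I a) (L a))"
  unfolding pivot_def
proof (rule pt_foldr_env[where q = "[:0, 1:]" and g = "\<lambda>_ x p. if fst x \<noteq> 0 then x else p" and ea = "\<lambda>_. Leaf" and A = "\<lambda>_. ()"])
  fix xs and s :: "'k \<times> 'k list list"
  show "size (epair ek em (foldr (\<lambda>x p. if fst x \<noteq> 0 then x else p) xs s))
     \<le> poly [:0, 1:] (size Leaf + size (enc_list (epair ek em) xs) + size (epair ek em s))"
    by (induction xs) auto
qed (rule assms pt_comp[where f = I, OF assms(1)] pt_rules2)+

lemma pt_clear:
  assumes "pt ea eJ I" "pt ea (epair ek em) p" "pt ea (enc_list (epair ek em)) L"
  shows "pt ea (enc_list em) (\<lambda>a. clear (I a) (p a) (L a))"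
  unfolding clear_def
  by (rule pt_msub pt_map assms pt_comp[where f = I, OF assms(1)] pt_comp[where f = p, OF assms(2)] pt_rules2)+

lemma pt_commutator_entry:
  assumes "pt ea eJ I" "pt ea (epair em ep) q" "pt ea em A"
  shows "pt ea ek (\<lambda>a. commutator_entry (I a) (q a) (A a))"
  unfolding commutator_entry_def by (rule assms pt_rules2)+

lemma pt_kernel_step:
  assumes "pt ea eJ I" "pt ea (epair em ep) q" "pt ea (enc_list em) L"
  shows "pt ea (enc_list em) (\<lambda>a. kernel_step (I a) (q a) (L a))"
  unfolding kernel_step_def
  by (rule pt_clear pt_pivot pt_commutator_entry assms pt_comp[where f = I, OF assms(1)]
      pt_comp[where f = q, OF assms(2)] pt_rules2)+

lemma size_enc_list_le':
  assumes "length xs \<le> n" "\<And>x. x \<in> set xs \<Longrightarrow> size (f x) \<le> K"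
  shows "size (enc_list f xs) \<le> n * (K + 1)"
proof -
  have "size (enc_list f xs) \<le> length xs * (K + 1)"
    using assms(2) by (rule size_enc_list_le)
  also have "\<dots> \<le> n * (K + 1)" using assms(1) by (rule mult_le_mono1)
  finally show ?thesis .
qed

text \<open>The length of the list is constant, and after at least one step all its matrices are
  tables; the summand \<open>[:0, 1:]\<close> covers the case of no step, in which \<open>s\<close>
  itself is returned.\<close>

lemma pt_kernel:
  assumes "pt ea eJ I" "pt ea (enc_list (epair em ep)) Q" "pt ea (enc_list em) L"
  shows "pt ea (enc_list em) (\<lambda>a. foldr (kernel_step (I a)) (Q a) (L a))"
proof (rule pt_foldr_env[OF _ _ assms, where q = "[:0, 1:] * (tab_poly + 1) + [:0, 1:]"])
  show "pt (epair eJ (epair (epair em ep) (enc_list em))) (enc_list em)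
    (\<lambda>z. kernel_step (fst z) (fst (snd z)) (snd (snd z)))"
    by (rule pt_kernel_step pt_rules2)+
  fix J and xs :: "('k list list \<times> nat \<times> nat) list" and s :: "'k list list list"
  let ?n = "size (eJ J) + size (enc_list (epair em ep) xs) + size (enc_list em s)"
  have "size (enc_list em (foldr (kernel_step J) xs s)) \<le> ?n * (poly tab_poly ?n + 1) + ?n"
  proof (cases xs)
    case (Cons x ys)
    have "size (em A) \<le> poly tab_poly ?n" if "A \<in> set (foldr (kernel_step J) xs s)" for A
      using that kernel_step_mem[of J x] length_le_size_enc_list[of J enc_nat]
      by (intro size_tab_poly[of A J]) (auto simp: Cons)
    then have "size (enc_list em (foldr (kernel_step J) xs s)) \<le> ?n * (poly tab_poly ?n + 1)"
      using length_le_size_enc_list[of s em] by (intro size_enc_list_le') auto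
    then show ?thesis by linarith
  qed simp
  then show "size (enc_list em (foldr (kernel_step J) xs s)) \<le> poly ([:0, 1:] * (tab_poly + 1) + [:0, 1:]) ?n"
    by (simp add: add.commute)
qed

lemma pt_reduce_step:
  assumes "pt ea eJ I" "pt ea ep q" "pt ea (epair (enc_list em) (enc_list em)) S"
  shows "pt ea (epair (enc_list em) (enc_list em)) (\<lambda>a. reduce_step (I a) (q a) (S a))"
  unfolding reduce_step_def
  by (rule pt_clear pt_pivot assms pt_comp[where f = I, OF assms(1)]
      pt_comp[where f = q, OF assms(2)] pt_rules2)+

lemma pt_reduce:
  assumes "pt ea eJ I" "pt ea (enc_list em) L"
  shows "pt ea (enc_list em) (\<lambda>a. reduce (I a) (L a))"
proof -
  let ?E = "epair (enc_list em) (enc_list em)"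
  \<comment> \<open>Both lists of the state have length at most \<open>?n\<close> and consist of
    tables and of matrices given at the start, hence the factor 2 and the sum
    \<open>[:0, 1:] + tab_poly\<close>.\<close>
  let ?q = "[:1:] + [:2:] * ([:0, 1:] * (([:0, 1:] + tab_poly) + 1))"
  have "pt ea ?E (\<lambda>a. foldr (reduce_step (I a)) (prs (I a)) (L a, []))"
  proof (rule pt_foldr_env[OF _ _ assms(1), where q = ?q and eb = ep])
    show "pt (epair eJ (epair ep ?E)) ?E
      (\<lambda>z. reduce_step (fst z) (fst (snd z)) (snd (snd z)))"
      by (rule pt_reduce_step pt_rules2)+
    fix J and xs :: "(nat \<times> nat) list" and s :: "'k list list list \<times> 'k list list list"
    let ?n = "size (eJ J) + size (enc_list ep xs) + size (?E s)"
    let ?T = "foldr (reduce_step J) xs s"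
    have tab: "size (em A) \<le> ?n + poly tab_poly ?n"
      if "A \<in> set (fst s) \<union> set (snd s) \<union> range (tab J)" for A
    proof (cases "A \<in> range (tab J)")
      case True
      then show ?thesis
        using size_tab_poly[of A J ?n] length_le_size_enc_list[of J enc_nat] by auto
    next
      case False
      then have "A \<in> set (fst s) \<or> A \<in> set (snd s)"
        using that by blast
      then have "size (em A) \<le> size (?E s)"
        using size_le_size_enc_list[of A "fst s" em] size_le_size_enc_list[of A "snd s" em]
        by (fastforce simp: epair_def)
      then show ?thesis by linarith
    qed
    note mem = reduce_steps_mem[of J xs s]
    have len: "length (fst s) \<le> ?n" "length xs + length (snd s) \<le> ?n"
      using length_le_size_enc_list[of "fst s" em] length_le_size_enc_list[of "snd s" em]
        length_le_size_enc_list[of xs ep] by (simp_all add: epair_def)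
    have "size (enc_list em (fst ?T)) \<le> ?n * ((?n + poly tab_poly ?n) + 1)"
      using mem len tab by (intro size_enc_list_le') (simp, blast)
    moreover have "size (enc_list em (snd ?T)) \<le> ?n * ((?n + poly tab_poly ?n) + 1)"
      using mem len tab by (intro size_enc_list_le') (simp, blast)
    moreover have "size (?E ?T) = 1 + size (enc_list em (fst ?T)) + size (enc_list em (snd ?T))"
      by (simp add: epair_def)
    ultimately have "size (?E ?T) \<le> 1 + 2 * (?n * ((?n + poly tab_poly ?n) + 1))"
      by linarith
    moreover have "poly ?q n = 1 + 2 * (n * ((n + poly tab_poly n) + 1))" for n
      by (simp add: algebra_simps)
    ultimately show "size (?E ?T) \<le> poly ?q ?n"
      by (simp only:)
  qed (rule assms pt_rules2)+
  then show ?thesis unfolding reduce_def by (rule pt_snd)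
qed

lemma pt_chain_step:
  assumes "pt ea eJ I" "pt ea (enc_list em) ms" "pt ea (enc_list em) W"
  shows "pt ea (enc_list em) (\<lambda>a. chain_step (I a) (ms a) (W a))"
  unfolding chain_step_def
  by (rule pt_reduce assms pt_comp[where f = I, OF assms(1)] pt_comp[where f = W, OF assms(3)] pt_rules2)+

lemma pt_nilpotent_list:
  assumes "pt ea eJ I" "pt ea (enc_list em) ms"
  shows "pt ea ebool (\<lambda>a. nilpotent_list (I a) (ms a))"
proof -
  let ?E = "epair eJ (enc_list em)"
  \<comment> \<open>The square \<open>[:0, 0, 1:]\<close> is the number of matrices that
    \<open>reduce\<close> returns, one for each index pair.\<close>
  let ?q = "[:0, 0, 1:] * (tab_poly + 1) + [:0, 1:]"
  have "pt ea (enc_list em) (\<lambda>a. foldr (\<lambda>_. chain_step (fst (I a, ms a)) (snd (I a, ms a))) (prs (I a)) [ident (I a)])"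
  proof (rule pt_foldr_env[where q = ?q and ea = ?E and eb = ep and g = "\<lambda>z _. chain_step (fst z) (snd z)"])
    show "pt (epair ?E (epair ep (enc_list em))) (enc_list em)
      (\<lambda>z. chain_step (fst (fst z)) (snd (fst z)) (snd (snd z)))"
      by (rule pt_chain_step pt_rules2)+
    show "pt ea (epair eJ (enc_list em)) (\<lambda>a. (I a, ms a))"
      by (rule assms pt_rules2)+
    show "pt ea (enc_list ep) (\<lambda>a. prs (I a))"
      by (rule assms pt_rules2)+
    show "pt ea (enc_list em) (\<lambda>a. [ident (I a)])"
      by (rule assms pt_rules2)+
    fix z :: "nat list \<times> 'k list list list" and xs :: "(nat \<times> nat) list" and s
    obtain J ms where z: "z = (J, ms)" by (cases z)
    let ?n = "size (?E z) + size (enc_list ep xs) + size (enc_list em s)"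
    have "size (enc_list em (foldr (\<lambda>_. chain_step J ms) xs s)) \<le> (?n * ?n) * (poly tab_poly ?n + 1) + ?n"
    proof (cases xs)
      case (Cons x ys)
      have J: "length J \<le> ?n"
        using length_le_size_enc_list[of J enc_nat] by (simp add: z epair_def)
      have "size (em A) \<le> poly tab_poly ?n" if "A \<in> set (foldr (\<lambda>_. chain_step J ms) xs s)" for A
        using that chain_step_mem[of J ms] J
        by (intro size_tab_poly[of A J]) (auto simp: Cons)
      then have "size (enc_list em (foldr (\<lambda>_. chain_step J ms) xs s)) \<le> (?n * ?n) * (poly tab_poly ?n + 1)"
        using mult_le_mono[OF J J]
        by (intro size_enc_list_le') (simp_all add: Cons chain_step_def length_reduce length_prs)
      then show ?thesis by linarith
    qed simp
    moreover have "poly ?q n = (n * n) * (poly tab_poly n + 1) + n" for n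
      by (simp add: algebra_simps)
    ultimately show "size (enc_list em (foldr (\<lambda>_. chain_step (fst z) (snd z)) xs s)) \<le> poly ?q ?n"
      by (simp only: z fst_conv snd_conv)
  qed
  then show ?thesis
    unfolding nilpotent_list_def fst_conv snd_conv
    by - (rule pt_list_all pt_prs assms pt_comp[where f = I, OF assms(1)] pt_rules2 | assumption)+
qed

lemma pt_pick:
  assumes "pt ea eJ I" "pt ea em b"
  shows "pt ea em (\<lambda>a. pick Fs (I a) (b a))"
proof -
  let ?E = "epair eJ em"
  let ?m = "\<lambda>z c. msub (fst z) c (ident (fst z)) (snd z)"
  let ?g = "\<lambda>z c r. if nilpotent_list (fst z) [?m z c] then ?m z c else r"
  have "pt ea em (\<lambda>a. foldr (?g (I a, b a)) Fs (b a))"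
  proof (rule pt_foldr_env[where q = "tab_poly + [:0, 1:]" and ea = ?E and eb = ek and g = ?g])
    show "pt (epair ?E (epair ek em)) em (\<lambda>z. ?g (fst z) (fst (snd z)) (snd (snd z)))"
      by (rule pt_nilpotent_list pt_rules2)+
    show "pt ea (epair eJ em) (\<lambda>a. (I a, b a))"
      by (rule assms pt_rules2)+
    fix z :: "nat list \<times> 'k list list" and xs :: "'k list" and s
    let ?n = "size (?E z) + size (enc_list ek xs) + size (em s)"
    have "foldr (?g z) xs s \<in> insert s (range (tab (fst z)))"
      by (induction xs) (auto simp: msub_def)
    moreover have "length (fst z) \<le> ?n"
      using length_le_size_enc_list[of "fst z" enc_nat] by (simp add: epair_def)
    ultimately show "size (em (foldr (?g z) xs s)) \<le> poly (tab_poly + [:0, 1:]) ?n"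
      using size_tab_poly[of "foldr (?g z) xs s" "fst z" ?n] by auto
  qed (rule assms pt_rules2)+
  then show ?thesis by (simp only: pick_def fst_conv snd_conv)
qed

lemma pt_decide:
  assumes "pt ea eJ I" "pt ea (enc_list em) Ms"
  shows "pt ea ebool (\<lambda>a. decide Fs (I a) (Ms a))"
  unfolding decide_def commutant_basis_def
  by (rule pt_nilpotent_list pt_pick pt_kernel assms pt_comp[where f = I, OF assms(1)] pt_rules2)+

abbreviation eI :: "nat list \<times> (nat \<times> nat \<times> 'k list list) list \<Rightarrow> sexp" where
  "eI \<equiv> epair eJ (enc_list (epair enc_nat (epair enc_nat em)))"

lemma pt_index_list:
  assumes "pt ea eJ I"
  shows "pt ea (enc_list ep) (\<lambda>a. index_list (I a))"
  unfolding index_list_def by (rule assms pt_comp[where f = I, OF assms(1)] pt_rules2)+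

lemma pt_vertex_mat:
  assumes "pt ea (enc_list ep) I" "pt ea enc_nat v"
  shows "pt ea em (\<lambda>a. vertex_mat (I a) (v a))"
  unfolding vertex_mat_def
  by (rule assms pt_comp[where f = I, OF assms(1)] pt_comp[where f = v, OF assms(2)] pt_rules2)+

lemma pt_arc_mat:
  assumes "pt ea (enc_list ep) I" "pt ea (epair enc_nat (epair enc_nat em)) A"
  shows "pt ea em (\<lambda>a. arc_mat (I a) (A a))"
  unfolding arc_mat_def
  by (rule assms pt_comp[where f = I, OF assms(1)] pt_comp[where f = A, OF assms(2)] pt_rules2)+

lemma pt_algorithm: "pt eI ebool (algorithm Fs)"
  unfolding algorithm_def
  by (rule pt_decide pt_index_list pt_vertex_mat pt_arc_mat pt_rules2)+

end

section \<open>Matrices as functions\<close>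

text \<open>Matrices are functions with pointwise addition, and the size is not part of the type: n
  x n matrices are the functions in \<open>mats n\<close>, which vanish outside. Thus one vector
  space serves all sizes.\<close>

definition mscale :: "'k::field \<Rightarrow> (nat \<Rightarrow> nat \<Rightarrow> 'k) \<Rightarrow> nat \<Rightarrow> nat \<Rightarrow> 'k" where
  "mscale c f = (\<lambda>i j. c * f i j)"

interpretation mat: vector_space "mscale :: 'k::field \<Rightarrow> _"
  by unfold_locales (auto simp: mscale_def fun_eq_iff algebra_simps)

definition mm :: "nat \<Rightarrow> (nat \<Rightarrow> nat \<Rightarrow> 'k::field) \<Rightarrow> (nat \<Rightarrow> nat \<Rightarrow> 'k) \<Rightarrow> nat \<Rightarrow> nat \<Rightarrow> 'k" where
  "mm n f g = (\<lambda>i j. \<Sum>k<n. f i k * g k j)"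

definition mone :: "nat \<Rightarrow> nat \<Rightarrow> nat \<Rightarrow> 'k::field" where
  "mone n = (\<lambda>i j. if i = j \<and> i < n then 1 else 0)"

definition mats :: "nat \<Rightarrow> (nat \<Rightarrow> nat \<Rightarrow> 'k::field) set" where
  "mats n = {f. \<forall>i j. f i j \<noteq> 0 \<longrightarrow> i < n \<and> j < n}"

lemma mm_assoc: "mm n (mm n f g) h = mm n f (mm n g h)"
  unfolding mm_def
  by (intro ext) (simp add: sum_distrib_left sum_distrib_right mult.assoc, rule sum.swap)

lemma mm_add_left: "mm n (f + g) h = mm n f h + mm n g h"
  by (simp add: mm_def fun_eq_iff algebra_simps sum.distrib)

lemma mm_add_right: "mm n f (g + h) = mm n f g + mm n f h"
  by (simp add: mm_def fun_eq_iff algebra_simps sum.distrib)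

lemma mm_diff_left: "mm n (f - g) h = mm n f h - mm n g h"
  by (simp add: mm_def fun_eq_iff algebra_simps sum_subtractf)

lemma mm_diff_right: "mm n f (g - h) = mm n f g - mm n f h"
  by (simp add: mm_def fun_eq_iff algebra_simps sum_subtractf)

lemma mm_scale_left: "mm n (mscale c f) g = mscale c (mm n f g)"
  by (simp add: mm_def mscale_def fun_eq_iff sum_distrib_left mult.assoc)

lemma mm_scale_right: "mm n f (mscale c g) = mscale c (mm n f g)"
  by (simp add: mm_def mscale_def fun_eq_iff sum_distrib_left mult.left_commute)

lemma mm_zero_left [simp]: "mm n 0 f = 0"
  and mm_zero_right [simp]: "mm n f 0 = 0"
  by (simp_all add: mm_def fun_eq_iff)

lemma mats_outside: "f \<in> mats n \<Longrightarrow> \<not> (i < n \<and> j < n) \<Longrightarrow> f i j = 0"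
  by (auto simp: mats_def)

lemma mm_one_right: assumes "f \<in> mats n" shows "mm n f (mone n) = f"
proof (intro ext)
  fix i j
  have "mm n f (mone n) i j = (\<Sum>k<n. if k = j then f i j else 0)"
    unfolding mm_def mone_def by (rule sum.cong) auto
  then show "mm n f (mone n) i j = f i j"
    using mats_outside[OF assms, of i j] by (simp add: sum.delta)
qed

lemma mm_one_left: assumes "f \<in> mats n" shows "mm n (mone n) f = f"
proof (intro ext)
  fix i j
  have "mm n (mone n) f i j = (\<Sum>k<n. if k = i then f i j else 0)"
    unfolding mm_def mone_def by (rule sum.cong) auto
  then show "mm n (mone n) f i j = f i j"
    using mats_outside[OF assms, of i j] by (simp add: sum.delta)
qed

lemma mm_mats:
  assumes "f \<in> mats n" "g \<in> mats n" shows "mm n f g \<in> mats n"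
proof -
  have "mm n f g i j = 0" if "\<not> (i < n \<and> j < n)" for i j
    unfolding mm_def using that mats_outside[OF assms(1)] mats_outside[OF assms(2)]
    by (intro sum.neutral) auto
  then show ?thesis unfolding mats_def by blast
qed

lemma mone_mats [simp]: "mone n \<in> mats n"
  by (simp add: mats_def mone_def)

lemma subspace_mats: "mat.subspace (mats n)"
  by (auto simp: mat.subspace_def mats_def mscale_def) (metis add.right_neutral)+


text \<open>The matrix denoted by a list of rows; cutting off at \<open>n\<close> makes it an
  element of \<open>mats n\<close> for lists of any shape.\<close>

definition den :: "nat \<Rightarrow> 'k::field list list \<Rightarrow> nat \<Rightarrow> nat \<Rightarrow> 'k" where
  "den n A = (\<lambda>i j. if i < n \<and> j < n then ent A i j else 0)"

lemma den_mats [simp]: "den n A \<in> mats n"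
  by (auto simp: den_def mats_def)

lemma ent_tab: "i < n \<Longrightarrow> j < n \<Longrightarrow> ent (tab [0..<n] f) i j = f i j"
  by (simp add: ent_def tab_def nthd_nth)

lemma den_tab: "den n (tab [0..<n] f) = (\<lambda>i j. if i < n \<and> j < n then f i j else 0)"
  by (auto simp: den_def ent_tab fun_eq_iff)

lemma foldr_add_sum: "distinct J \<Longrightarrow> foldr (\<lambda>k s. g k + s) J (0::'k::field) = (\<Sum>k\<in>set J. g k)"
  by (induction J) auto

lemma dot_sum: "dot [0..<n] A B i j = (\<Sum>k<n. ent A i k * ent B k j)"
  by (simp add: dot_def foldr_add_sum atLeast0LessThan)

lemma den_mmul: "den n (mmul [0..<n] A B) = mm n (den n A) (den n B)"
proof (intro ext)
  fix i j
  show "den n (mmul [0..<n] A B) i j = mm n (den n A) (den n B) i j"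
    by (auto simp: mmul_def den_tab ent_tab dot_sum mm_def den_def intro!: sum.cong)
qed

lemma den_msub: "den n (msub [0..<n] c P A) = den n A - mscale c (den n P)"
  by (auto simp: msub_def den_tab mscale_def fun_eq_iff) (auto simp: den_def)

lemma den_ident: "den n (ident [0..<n]) = mone n"
  by (auto simp: ident_def den_tab mone_def fun_eq_iff)

lemma set_prs: "set (prs [0..<n]) = {..<n} \<times> {..<n}"
  by (auto simp: prs_def)

lemma commutator_entry_eq:
  assumes "i < n" "j < n"
  shows "commutator_entry [0..<n] (M, i, j) A = (mm n (den n A) (den n M) - mm n (den n M) (den n A)) i j"
  using assms by (simp add: commutator_entry_def dot_sum mm_def den_def)

section \<open>Elimination\<close>

lemma pivot_cases:
  fixes f :: "'k::field list list \<Rightarrow> 'k" and L :: "'k list list list" and J :: "nat list"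
  defines "p \<equiv> pivot J (map (\<lambda>A. (f A, A)) L)"
  shows "(fst p \<noteq> 0 \<and> snd p \<in> set L \<and> fst p = f (snd p)) \<or>
    (fst p = 0 \<and> snd p = tab J (\<lambda>_ _. 0) \<and> (\<forall>A\<in>set L. f A = 0))"
  unfolding p_def pivot_def by (induction L) auto

context
  fixes n :: nat and f :: "'k::field list list \<Rightarrow> 'k" and \<Phi> :: "(nat \<Rightarrow> nat \<Rightarrow> 'k) \<Rightarrow> 'k"
    and L :: "'k list list list" and p :: "'k \<times> 'k list list" and L' :: "'k list list list"
  assumes f: "\<And>A. f A = \<Phi> (den n A)"
    and \<Phi>_add: "\<And>u v. \<Phi> (u + v) = \<Phi> u + \<Phi> v"
    and \<Phi>_scale: "\<And>c u. \<Phi> (mscale c u) = c * \<Phi> u"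
  defines "p \<equiv> pivot [0..<n] (map (\<lambda>A. (f A, A)) L)"
    and "L' \<equiv> clear [0..<n] p (map (\<lambda>A. (f A, A)) L)"
begin

private lemma \<Phi>_diff: "\<Phi> (u - v) = \<Phi> u - \<Phi> v"
proof -
  have "\<Phi> (u - v) + \<Phi> v = \<Phi> u"
    using \<Phi>_add[of "u - v" v] by simp
  then show ?thesis by (simp add: eq_diff_eq)
qed

private lemma subspace_ker: "mat.subspace {u. \<Phi> u = 0}"
  using \<Phi>_scale[of 0 0] by (auto simp: mat.subspace_def \<Phi>_add \<Phi>_scale mat.scale_zero_left)

private lemma den_L': "den n ` set L' = (\<lambda>u. u - mscale (\<Phi> u / fst p) (den n (snd p))) ` den n ` set L"
  by (force simp: L'_def clear_def den_msub f image_iff)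

text \<open>Clearing applies T u = u - (\<Phi> u / \<Phi> P) P, the projection onto the kernel of
  \<Phi> along the pivot P. It maps the span onto its intersection with the kernel, and adding P
  restores the span. If \<Phi> vanishes on the list, then T is the identity there and P = 0.\<close>

lemma clear_span:
  shows clear_span_kernel: "mat.span (den n ` set L') = mat.span (den n ` set L) \<inter> {u. \<Phi> u = 0}" (is ?A)
    and clear_span_insert: "mat.span (insert (den n (snd p)) (den n ` set L')) = mat.span (den n ` set L)" (is ?B)
proof -
  let ?S = "den n ` set L" and ?P = "den n (snd p)"
  have "?A \<and> ?B"
  proof (cases "fst p = 0")
    case True
    then have z: "\<forall>A\<in>set L. f A = 0" and P: "?P = 0"
      using pivot_cases[of "[0..<n]" f L] by (auto simp: p_def den_tab fun_eq_iff)
    have eq: "den n ` set L' = ?S"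
      unfolding den_L' using z P by (force simp: f image_iff)
    have "mat.span ?S \<subseteq> {u. \<Phi> u = 0}"
      using z f by (intro mat.span_minimal subspace_ker) auto
    then show ?thesis by (auto simp: eq P mat.span_insert_0)
  next
    case False
    then have P: "?P \<in> ?S" "\<Phi> ?P = fst p"
      using pivot_cases[of "[0..<n]" f L] by (auto simp: p_def f)
    define T where "T = (\<lambda>u. u - mscale (\<Phi> u / fst p) ?P)"
    have T_add: "T (u + v) = T u + T v" and T_scale: "T (mscale c u) = mscale c (T u)" for u v c
      unfolding T_def \<Phi>_add \<Phi>_scale
      by (simp_all add: mscale_def fun_eq_iff algebra_simps add_divide_distrib)
    have T0: "\<Phi> (T u) = 0" for u
      using False P by (simp add: T_def \<Phi>_diff \<Phi>_scale)
    have TS: "T u \<in> mat.span ?S" if "u \<in> mat.span ?S" for u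
      using that mat.span_base[OF P(1)] unfolding T_def by (intro mat.span_diff mat.span_scale)
    have L': "den n ` set L' = T ` ?S"
      by (simp add: den_L' T_def)
    have T_span: "T u \<in> mat.span (T ` ?S)" if "u \<in> mat.span ?S" for u
      using that
    proof (induction rule: mat.span_induct_alt)
      case base
      have "T 0 = 0" using T_scale[of 0 0] by (simp add: mat.scale_zero_left)
      then show ?case using mat.span_zero[of "T ` ?S"] by (simp add: zero_fun_def)
    next
      case (step c x y)
      have "(\<lambda>a b. mscale c x a b + y a b) = mscale c x + y"
        by (simp add: fun_eq_iff)
      moreover have "T (mscale c x + y) \<in> mat.span (T ` ?S)"
        using step unfolding T_add T_scale
        by (auto intro!: mat.span_add mat.span_scale intro: mat.span_base)
      ultimately show ?case by simp
    qed
    have A: ?A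
    proof (intro equalityI subsetI)
      fix u assume "u \<in> mat.span (den n ` set L')"
      moreover have "mat.span (T ` ?S) \<subseteq> mat.span ?S \<inter> {u. \<Phi> u = 0}"
        using T0 TS by (intro mat.span_minimal mat.subspace_inter subspace_ker mat.subspace_span)
          (auto intro: mat.span_base)
      ultimately show "u \<in> mat.span ?S \<inter> {u. \<Phi> u = 0}"
        by (auto simp: L')
    next
      fix u assume u: "u \<in> mat.span ?S \<inter> {u. \<Phi> u = 0}"
      \<comment> \<open>The projection fixes the kernel pointwise, so every kernel element of the
        span is an image under T.\<close>
      then have "T u = u" by (simp add: T_def mscale_def fun_eq_iff)
      with T_span[of u] u show "u \<in> mat.span (den n ` set L')"
        by (simp add: L')
    qed
    have "mat.span (insert ?P (T ` ?S)) = mat.span ?S"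
    proof (intro equalityI mat.span_minimal mat.subspace_span)
      show "insert ?P (T ` ?S) \<subseteq> mat.span ?S"
        using P TS by (auto intro: mat.span_base)
      show "?S \<subseteq> mat.span (insert ?P (T ` ?S))"
      proof
        fix u assume "u \<in> ?S"
        then have "T u + mscale (\<Phi> u / fst p) ?P \<in> mat.span (insert ?P (T ` ?S))"
          by (intro mat.span_add mat.span_scale mat.span_base) auto
        then show "u \<in> mat.span (insert ?P (T ` ?S))" by (simp add: T_def)
      qed
    qed
    with A show ?thesis by (simp add: L')
  qed
  then show ?A ?B by blast+
qed

end

lemma span_kernel:
  assumes "\<And>M i j. (M, i, j) \<in> set qs \<Longrightarrow> i < n \<and> j < n"
  shows "mat.span (den n ` set (foldr (kernel_step [0..<n]) qs L)) =
    mat.span (den n ` set L) \<inter>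
    {u. \<forall>(M, i, j)\<in>set qs. (mm n u (den n M) - mm n (den n M) u) i j = 0}"
  using assms
proof (induction qs)
  case (Cons q qs)
  obtain M i j where q: "q = (M, i, j)" by (cases q)
  have ij: "i < n" "j < n" using Cons.prems q by auto
  let ?\<Phi> = "\<lambda>u. (mm n u (den n M) - mm n (den n M) u) i j"
  have "mat.span (den n ` set (foldr (kernel_step [0..<n]) (q # qs) L)) =
    mat.span (den n ` set (foldr (kernel_step [0..<n]) qs L)) \<inter> {u. ?\<Phi> u = 0}"
    unfolding foldr.simps o_def kernel_step_def
    by (rule clear_span_kernel)
      (simp_all add: q commutator_entry_eq ij mm_add_left mm_add_right mm_scale_left mm_scale_right,
        simp add: mscale_def algebra_simps)
  also have "mat.span (den n ` set (foldr (kernel_step [0..<n]) qs L)) = mat.span (den n ` set L) \<inter>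
    {u. \<forall>(M, i, j)\<in>set qs. (mm n u (den n M) - mm n (den n M) u) i j = 0}"
    using Cons.prems by (intro Cons.IH) auto
  finally show ?case by (auto simp: q)
qed simp

lemma span_units: "mat.span (den n ` set (units [0..<n])) = mats n"
proof (intro equalityI mat.span_minimal subspace_mats)
  show "mats n \<subseteq> mat.span (den n ` set (units [0..<n]))"
  proof
    fix u :: "nat \<Rightarrow> nat \<Rightarrow> 'k::field" assume u: "u \<in> mats n"
    let ?e = "\<lambda>a b. den n (tab [0..<n] (\<lambda>i j. if i = a \<and> j = b then 1 else 0)) :: nat \<Rightarrow> nat \<Rightarrow> 'k"
    have "(\<Sum>a<n. \<Sum>b<n. mscale (u a b) (?e a b)) \<in> mat.span (den n ` set (units [0..<n]))"
      by (intro mat.span_sum mat.span_scale mat.span_base) (force simp: units_def set_prs)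
    moreover have "u = (\<Sum>a<n. \<Sum>b<n. mscale (u a b) (?e a b))"
    proof (intro ext)
      fix i j
      have app: "(\<Sum>a\<in>S. (g a :: nat \<Rightarrow> nat \<Rightarrow> 'k)) i j = (\<Sum>a\<in>S. g a i j)" for g and S :: "nat set"
        by (induction S rule: infinite_finite_induct) auto
      have "(\<Sum>a<n. \<Sum>b<n. mscale (u a b) (?e a b)) i j =
          (\<Sum>a<n. \<Sum>b<n. if a = i \<and> b = j then u i j else 0)"
        unfolding app by (intro sum.cong refl) (auto simp: mscale_def den_tab)
      also have "\<dots> = (\<Sum>a<n. if a = i then (\<Sum>b<n. if b = j then u i j else 0) else 0)"
        by (intro sum.cong refl) auto
      also have "\<dots> = u i j"
        using mats_outside[OF u, of i j] by (simp add: sum.delta)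
      finally show "u i j = (\<Sum>a<n. \<Sum>b<n. mscale (u a b) (?e a b)) i j" by simp
    qed
    ultimately show "u \<in> mat.span (den n ` set (units [0..<n]))" by simp
  qed
qed auto

definition commutant :: "nat \<Rightarrow> (nat \<Rightarrow> nat \<Rightarrow> 'k::field) set \<Rightarrow> (nat \<Rightarrow> nat \<Rightarrow> 'k) set" where
  "commutant n Ms = {u \<in> mats n. \<forall>M\<in>Ms. mm n u M = mm n M u}"

lemma span_commutant_basis:
  "mat.span (den n ` set (commutant_basis [0..<n] Ms)) = commutant n (den n ` set Ms)"
proof -
  let ?qs = "concat (map (\<lambda>M. map (Pair M) (prs [0..<n])) Ms)"
  have "mat.span (den n ` set (commutant_basis [0..<n] Ms)) = mats n \<inter>
    {u. \<forall>(M, i, j)\<in>set ?qs. (mm n u (den n M) - mm n (den n M) u) i j = 0}"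
    unfolding commutant_basis_def by (subst span_kernel) (auto simp: set_prs span_units)
  also have "\<dots> = commutant n (den n ` set Ms)"
  proof (intro equalityI subsetI)
    fix u assume u: "u \<in> mats n \<inter> {u. \<forall>(M, i, j)\<in>set ?qs. (mm n u (den n M) - mm n (den n M) u) i j = 0}"
    have "mm n u (den n M) i j = mm n (den n M) u i j" if "M \<in> set Ms" for M i j
    proof (cases "i < n \<and> j < n")
      case True
      then show ?thesis using u that by (auto simp: set_prs)
    next
      case False
      then show ?thesis
        using mats_outside[OF mm_mats, of u n "den n M" i j] mats_outside[OF mm_mats, of "den n M" n u i j] u
        by auto
    qed
    then show "u \<in> commutant n (den n ` set Ms)"
      using u by (auto simp: commutant_def fun_eq_iff)
  qed (auto simp: commutant_def)
  finally show ?thesis .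
qed

text \<open>When \<open>qs\<close> contains all positions, the first equation forces the remaining
  matrices to be 0, and the second then says that the pivots alone span.\<close>

lemma span_reduce_steps:
  assumes "\<And>i j. (i, j) \<in> set qs \<Longrightarrow> i < n \<and> j < n"
  shows "mat.span (den n ` set (fst (foldr (reduce_step [0..<n]) qs (L, [])))) =
      mat.span (den n ` set L) \<inter> {u. \<forall>(i, j)\<in>set qs. u i j = 0} \<and>
    mat.span (den n ` set (snd (foldr (reduce_step [0..<n]) qs (L, []))) \<union>
      den n ` set (fst (foldr (reduce_step [0..<n]) qs (L, [])))) = mat.span (den n ` set L)"
  using assms
proof (induction qs)
  case (Cons q qs)
  obtain i j where q: "q = (i, j)" by (cases q)
  have ij: "i < n" "j < n" using Cons.prems q by auto
  let ?T = "foldr (reduce_step [0..<n]) qs (L, [])"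
  let ?p = "pivot [0..<n] (map (\<lambda>A. (ent A (fst q) (snd q), A)) (fst ?T))"
  let ?L = "clear [0..<n] ?p (map (\<lambda>A. (ent A (fst q) (snd q), A)) (fst ?T))"
  have step: "foldr (reduce_step [0..<n]) (q # qs) (L, []) = (?L, snd ?p # snd ?T)"
    by (simp add: reduce_step_def)
  have 1: "mat.span (den n ` set ?L) = mat.span (den n ` set (fst ?T)) \<inter> {u. u i j = 0}"
    by (rule clear_span_kernel) (simp_all add: q ij den_def mscale_def)
  have 2: "mat.span (insert (den n (snd ?p)) (den n ` set ?L)) = mat.span (den n ` set (fst ?T))"
    by (rule clear_span_insert[where \<Phi> = "\<lambda>u. u i j"]) (simp_all add: q ij den_def mscale_def)
  have IH: "mat.span (den n ` set (fst ?T)) = mat.span (den n ` set L) \<inter> {u. \<forall>(i, j)\<in>set qs. u i j = 0}"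
    "mat.span (den n ` set (snd ?T) \<union> den n ` set (fst ?T)) = mat.span (den n ` set L)"
    using Cons by auto
  have "mat.span (den n ` set (snd ?p # snd ?T) \<union> den n ` set ?L) =
      mat.span (den n ` set (snd ?T) \<union> insert (den n (snd ?p)) (den n ` set ?L))"
    by (rule arg_cong[where f = mat.span]) auto
  also have "\<dots> = mat.span (den n ` set (snd ?T) \<union> den n ` set (fst ?T))"
    using 2 by (simp only: mat.span_Un)
  finally show ?case
    unfolding step fst_conv snd_conv using 1 IH by (auto simp: q)
qed simp

lemma span_reduce: "mat.span (den n ` set (reduce [0..<n] L)) = mat.span (den n ` set L)"
proof -
  let ?T = "foldr (reduce_step [0..<n]) (prs [0..<n]) (L, [])"
  have S: "mat.span (den n ` set (fst ?T)) = mat.span (den n ` set L) \<inter> {u. \<forall>(i, j)\<in>set (prs [0..<n]). u i j = 0}"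
    "mat.span (den n ` set (snd ?T) \<union> den n ` set (fst ?T)) = mat.span (den n ` set L)"
    using span_reduce_steps[of "prs [0..<n]" n L] by (auto simp: set_prs)
  have "u = 0" if "u \<in> den n ` set (fst ?T)" for u
  proof -
    have "u \<in> mats n" using that by auto
    moreover have "u i j = 0" if "i < n" "j < n" for i j
      using S(1) mat.span_base[OF \<open>u \<in> den n ` set (fst ?T)\<close>] that by (auto simp: set_prs)
    ultimately show "u = 0" using mats_outside[of u n] by (intro ext) (metis zero_fun_def)
  qed
  then have "den n ` set (fst ?T) \<subseteq> mat.span (den n ` set (snd ?T))"
    by (metis mat.span_zero subsetI)
  then have "mat.span (den n ` set (snd ?T) \<union> den n ` set (fst ?T)) = mat.span (den n ` set (snd ?T))"
    by (intro equalityI mat.span_minimal mat.subspace_span mat.span_mono) (auto intro: mat.span_base)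
  then show ?thesis
    using S(2) by (simp add: reduce_def)
qed

section \<open>The nilpotency test\<close>

lemma span_chain_step:
  "mat.span (den n ` set (chain_step [0..<n] ms W)) =
   mat.span {mm n w m | w m. w \<in> den n ` set W \<and> m \<in> den n ` set ms}"
proof -
  have "den n ` set (concat (map (\<lambda>m. map (\<lambda>w. mmul [0..<n] w m) W) ms)) =
      {mm n w m | w m. w \<in> den n ` set W \<and> m \<in> den n ` set ms}"
    by (force simp: den_mmul image_iff)
  then show ?thesis by (simp add: chain_step_def span_reduce)
qed

lemma mm_span:
  assumes "\<And>w m. w \<in> S \<Longrightarrow> m \<in> T \<Longrightarrow> mm n w m \<in> U" "mat.subspace U"
    and "w \<in> mat.span S" "m \<in> mat.span T"
  shows "mm n w m \<in> U"
proof -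
  have "mm n w m \<in> U" if "w \<in> S" for w
    using assms(4)
  proof (induction rule: mat.span_induct_alt)
    case base
    then show ?case using mat.subspace_0[OF assms(2)] mm_zero_right[of n w] by (simp add: zero_fun_def)
  next
    case (step c x y)
    have "(\<lambda>a b. mscale c x a b + y a b) = mscale c x + y"
      by (simp add: fun_eq_iff)
    moreover have "mm n w (mscale c x + y) \<in> U"
      unfolding mm_add_right mm_scale_right using step assms(1)[OF that]
      by (intro mat.subspace_add mat.subspace_scale assms(2))
    ultimately show ?case by simp
  qed
  note * = this
  show ?thesis
    using assms(3)
  proof (induction rule: mat.span_induct_alt)
    case base
    then show ?case using mat.subspace_0[OF assms(2)] mm_zero_left[of n m] by (simp add: zero_fun_def)
  next
    case (step c x y)
    have "(\<lambda>a b. mscale c x a b + y a b) = mscale c x + y"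
      by (simp add: fun_eq_iff)
    moreover have "mm n (mscale c x + y) m \<in> U"
      unfolding mm_add_left mm_scale_left using step *
      by (intro mat.subspace_add mat.subspace_scale assms(2))
    ultimately show ?case by simp
  qed
qed

definition mpow :: "nat \<Rightarrow> (nat \<Rightarrow> nat \<Rightarrow> 'k::field) \<Rightarrow> nat \<Rightarrow> nat \<Rightarrow> nat \<Rightarrow> 'k" where
  "mpow n f k = ((\<lambda>u. mm n u f) ^^ k) (mone n)"

lemma mpow_0 [simp]: "mpow n f 0 = mone n"
  and mpow_Suc: "mpow n f (Suc k) = mm n (mpow n f k) f"
  by (simp_all add: mpow_def)

lemma foldr_const: "foldr (\<lambda>_. f) xs s = (f ^^ length xs) s"
  by (induction xs) auto

lemma nilpotent_list_iff:
  "nilpotent_list [0..<n] ms \<longleftrightarrow>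
    mat.span (den n ` set ((chain_step [0..<n] ms ^^ (n * n)) [ident [0..<n]])) \<subseteq> {0}"
proof -
  let ?W = "(chain_step [0..<n] ms ^^ (n * n)) [ident [0..<n]]"
  have "nilpotent_list [0..<n] ms \<longleftrightarrow> (\<forall>A\<in>set ?W. \<forall>i<n. \<forall>j<n. ent A i j = 0)"
    by (auto simp: nilpotent_list_def foldr_const length_prs list_all_iff set_prs)
  also have "\<dots> \<longleftrightarrow> (\<forall>A\<in>set ?W. den n A = 0)"
    by (auto simp: den_def fun_eq_iff)
  also have "\<dots> \<longleftrightarrow> den n ` set ?W \<subseteq> {0}"
    by auto
  also have "\<dots> \<longleftrightarrow> mat.span (den n ` set ?W) \<subseteq> {0}"
  proof
    assume "den n ` set ?W \<subseteq> {0}"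
    then show "mat.span (den n ` set ?W) \<subseteq> {0}"
      by (intro mat.span_minimal) (auto simp: mat.subspace_def mscale_def fun_eq_iff)
  qed (use mat.span_superset in blast)
  finally show ?thesis .
qed

text \<open>The test multiplies list members only, but by bilinearity the k-th power of any linear
  combination lies in the span of the products of length k.\<close>

lemma nilpotent_listD:
  assumes "nilpotent_list [0..<n] ms" "m \<in> mat.span (den n ` set ms)"
  shows "mpow n m (n * n) = 0"
proof -
  have "mpow n m k \<in> mat.span (den n ` set ((chain_step [0..<n] ms ^^ k) [ident [0..<n]]))" for k
  proof (induction k)
    case 0
    then show ?case by (simp add: den_ident mat.span_base)
  next
    case (Suc k)
    then show ?case
      unfolding mpow_Suc funpow.simps o_def span_chain_step
      by (intro mm_span[OF _ mat.subspace_span Suc assms(2)] mat.span_base) blast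
  qed
  then show ?thesis using assms(1) unfolding nilpotent_list_iff by blast
qed

text \<open>The filtration \<open>U\<close> is a certificate: by induction the span of the products
  of length k lies in \<open>U k\<close>.\<close>

lemma nilpotent_listI:
  assumes "mone n \<in> U 0" "\<And>k. mat.subspace (U k)" "U (n * n) \<subseteq> {0}"
    and "\<And>k u m. u \<in> U k \<Longrightarrow> m \<in> den n ` set ms \<Longrightarrow> mm n u m \<in> U (Suc k)"
  shows "nilpotent_list [0..<n] ms"
proof -
  have "mat.span (den n ` set ((chain_step [0..<n] ms ^^ k) [ident [0..<n]])) \<subseteq> U k" for k
  proof (induction k)
    case 0
    then show ?case using assms(1,2) by (intro mat.span_minimal) (auto simp: den_ident)
  next
    case (Suc k)
    then show ?case
      unfolding funpow.simps o_def span_chain_step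
      using assms(2,4) mat.span_superset by (intro mat.span_minimal) blast+
  qed
  then show ?thesis using assms(3) unfolding nilpotent_list_iff by blast
qed

section \<open>Naturality under field homomorphisms\<close>

context field_hom
begin

abbreviation hm :: "'a list list \<Rightarrow> 'b list list" where "hm \<equiv> map (map hom)"

lemma nthd_map: "nthd (f d) (map f xs) i = f (nthd d xs i)"
proof -
  have "(tl ^^ i) (map f xs) = map f ((tl ^^ i) xs)" for xs
    by (induction i arbitrary: xs) (auto simp: map_tl)
  then show ?thesis by (simp add: nthd_def hdd_def split: list.split)
qed

lemma ent_hm: "ent (hm A) i j = hom (ent A i j)"
  using nthd_map[of "map hom" "[]" A i] nthd_map[of hom 0 "nthd [] A i" j] by (simp add: ent_def)

lemma hm_tab: "hm (tab J f) = tab J (\<lambda>i j. hom (f i j))"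
  by (simp add: tab_def comp_def)

lemma dot_hm: "dot J (hm A) (hm B) i j = hom (dot J A B i j)"
  unfolding dot_def by (induction J) (simp_all add: ent_hm hom_distribs)

lemma mmul_hm: "mmul J (hm A) (hm B) = hm (mmul J A B)"
  by (simp add: mmul_def hm_tab flip: dot_hm)

lemma msub_hm: "msub J (hom c) (hm A) (hm B) = hm (msub J c A B)"
  by (simp add: msub_def hm_tab ent_hm hom_distribs)

text \<open>The only branching of the elimination is the test for 0; a field homomorphism is
  injective, so the same list element is selected on both sides.\<close>

lemma pivot_hm:
  "pivot J (map (\<lambda>A. (hom (f A), hm A)) L) = (\<lambda>p. (hom (fst p), hm (snd p))) (pivot J (map (\<lambda>A. (f A, A)) L))"
  unfolding pivot_def by (induction L) (simp_all add: hm_tab)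

lemma clear_hm:
  "clear J (hom (fst p), hm (snd p)) (map (\<lambda>A. (hom (f A), hm A)) L) = map hm (clear J p (map (\<lambda>A. (f A, A)) L))"
  by (simp add: clear_def msub_hm flip: hom_div)

lemma kernel_step_hm: "kernel_step J (hm M, ij) (map hm L) = map hm (kernel_step J (M, ij) L)"
proof -
  have "commutator_entry J (hm M, ij) (hm A) = hom (commutator_entry J (M, ij) A)" for A
    by (simp add: commutator_entry_def dot_hm hom_distribs)
  then show ?thesis
    by (simp add: kernel_step_def comp_def pivot_hm clear_hm)
qed

lemma commutant_basis_hm: "commutant_basis J (map hm Ms) = map hm (commutant_basis J Ms)"
proof -
  have "foldr (kernel_step J) (map (\<lambda>(M, ij). (hm M, ij)) qs) (map hm L) = map hm (foldr (kernel_step J) qs L)" for qs L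
    by (induction qs) (auto simp: kernel_step_hm)
  moreover have "concat (map (\<lambda>M. map (Pair M) (prs J)) (map hm Ms)) =
      map (\<lambda>(M, ij). (hm M, ij)) (concat (map (\<lambda>M. map (Pair M) (prs J)) Ms))"
    by (simp add: map_concat comp_def)
  moreover have "units J = map hm (units J)"
    by (simp add: units_def hm_tab if_distrib cong: if_cong)
  ultimately show ?thesis
    unfolding commutant_basis_def by metis
qed

lemma reduce_hm: "reduce J (map hm L) = map hm (reduce J L)"
proof -
  have "foldr (reduce_step J) qs (map hm L, map hm K) = map_prod (map hm) (map hm) (foldr (reduce_step J) qs (L, K))" for qs K
    by (induction qs) (simp_all add: reduce_step_def comp_def ent_hm pivot_hm clear_hm)
  from this[of _ "[]"] show ?thesis by (simp add: reduce_def)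
qed

text \<open>A test passed over the small field thus says something about all linear combinations
  with coefficients in the large field.\<close>

lemma nilpotent_list_hm: "nilpotent_list J (map hm ms) = nilpotent_list J ms"
proof -
  have step: "chain_step J (map hm ms) (map hm W) = map hm (chain_step J ms W)" for W
    by (simp add: chain_step_def map_concat comp_def mmul_hm flip: reduce_hm)
  have "foldr (\<lambda>_. chain_step J (map hm ms)) qs (map hm W) = map hm (foldr (\<lambda>_. chain_step J ms) qs W)" for qs :: "(nat \<times> nat) list" and W
    by (induction qs) (simp_all add: step)
  from this[of "prs J" "[ident J]"] show ?thesis
    by (simp add: nilpotent_list_def list_all_iff ent_hm ident_def hm_tab if_distrib cong: if_cong)
qed

end

section \<open>Algebras of matrices\<close>

text \<open>Induction rules eta-expand matrix-valued terms; pointwise simplification would then not let them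
  contract again.\<close>

declare zero_fun_apply [simp del] plus_fun_apply [simp del] minus_apply [simp del]

lemma mpow_mats [simp]: "f \<in> mats n \<Longrightarrow> mpow n f k \<in> mats n"
  by (induction k) (simp_all add: mpow_Suc mm_mats)

lemma mscale_simps [simp]:
  "mscale 0 f = 0" "mscale 1 f = f" "mscale c 0 = 0"
  "mscale a (mscale b f) = mscale (a * b) f"
  by (simp_all add: mscale_def fun_eq_iff mult.assoc zero_fun_apply)

lemma mscale_add: "mscale c (f + g) = mscale c f + mscale c g"
  and mscale_add_left: "mscale (a + b) f = mscale a f + mscale b f"
  by (simp_all add: mscale_def fun_eq_iff algebra_simps plus_fun_apply)

lemma mm_mone_pow:
  assumes "a \<in> mats n" "mm n a f = mscale c a"
  shows "mm n a (mpow n f k) = mscale (c ^ k) a"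
proof (induction k)
  case 0
  then show ?case using assms by (simp add: mm_one_right)
next
  case (Suc k)
  have "mm n a (mpow n f (Suc k)) = mm n (mm n a (mpow n f k)) f"
    by (simp add: mpow_Suc mm_assoc)
  also have "\<dots> = mscale (c ^ k) (mm n a f)"
    by (simp add: Suc mm_scale_left)
  finally show ?case by (simp add: assms(2) mult.commute)
qed

text \<open>The matrix \<open>a\<close> plays the role of a left eigenvector of \<open>f\<close>: a
  nilpotent \<open>f\<close> has no nonzero eigenvalue, so \<open>a\<close> must vanish.\<close>

lemma not_nilpotent_eigen:
  assumes "a \<in> mats n" "mm n a f = mscale c a" "c \<noteq> 0" "mpow n f k = 0"
  shows "a = 0"
proof -
  have "mscale (c ^ k) a = 0"
    using mm_mone_pow[OF assms(1,2), of k] assms(4) by simp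
  then have "mscale (inverse (c ^ k)) (mscale (c ^ k) a) = 0" by simp
  then show ?thesis using assms(3) by simp
qed

section \<open>The evaluation p(f) of a polynomial at a matrix, by Horner's scheme, and Fitting's
  lemma\<close>

definition act :: "nat \<Rightarrow> (nat \<Rightarrow> nat \<Rightarrow> 'k::field) \<Rightarrow> 'k poly \<Rightarrow> nat \<Rightarrow> nat \<Rightarrow> 'k" where
  "act n f p = fold_coeffs (\<lambda>c u. mscale c (mone n) + mm n u f) p 0"

lemma act_0 [simp]: "act n f 0 = 0"
  by (simp add: act_def)

lemma act_pCons: "act n f (pCons a p) = mscale a (mone n) + mm n (act n f p) f"
  by (cases "p = 0 \<and> a = 0") (auto simp: act_def)

lemma act_add: "act n f (p + q) = act n f p + act n f q"
proof (induction p q rule: poly_induct2)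
  case (pCons a p b q)
  then show ?case by (simp only: add_pCons act_pCons mm_add_left mscale_add_left) (simp add: algebra_simps)
qed simp

lemma act_smult: "act n f (smult c p) = mscale c (act n f p)"
proof (induction p)
  case (pCons a p)
  then show ?case by (simp only: smult_pCons act_pCons mm_scale_left mscale_add mscale_simps)
qed simp

lemma act_diff: "act n f (p - q) = act n f p - act n f q"
proof -
  have "act n f (p - q) + act n f q = act n f p"
    by (simp flip: act_add)
  then show ?thesis by (simp add: eq_diff_eq)
qed

context
  fixes n :: nat and f :: "nat \<Rightarrow> nat \<Rightarrow> 'k::field"
  assumes f: "f \<in> mats n"
begin

lemma act_mats [simp]: "act n f p \<in> mats n"
  using f by (induction p)
    (auto simp: act_pCons mat.subspace_0[OF subspace_mats]
      intro!: mat.subspace_add[OF subspace_mats] mat.subspace_scale[OF subspace_mats] mm_mats)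

lemma act_comm: "mm n f (act n f p) = mm n (act n f p) f"
proof (induction p)
  case (pCons a p)
  have "mm n f (act n f (pCons a p)) = mscale a f + mm n (mm n f (act n f p)) f"
    using f by (simp only: act_pCons mm_add_right mm_scale_right mm_one_right mm_assoc)
  also have "\<dots> = mm n (act n f (pCons a p)) f"
    using f by (simp only: pCons act_pCons mm_add_left mm_scale_left mm_one_left)
  finally show ?case .
qed simp

lemma act_mult: "act n f (p * q) = mm n (act n f p) (act n f q)"
proof (induction p)
  case (pCons a p)
  have "act n f (pCons a p * q) = mscale a (act n f q) + mm n (mm n (act n f p) (act n f q)) f"
    by (simp only: mult_pCons_left act_add act_smult act_pCons pCons mscale_simps add_0)
  also have "mm n (mm n (act n f p) (act n f q)) f = mm n (mm n (act n f p) f) (act n f q)"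
    by (simp only: mm_assoc act_comm)
  also have "mscale a (act n f q) + \<dots> = mm n (act n f (pCons a p)) (act n f q)"
    by (simp only: act_pCons mm_add_left mm_scale_left mm_one_left act_mats)
  finally show ?case .
qed simp

lemma act_1: "act n f 1 = mone n"
  by (simp add: one_pCons act_pCons del: pCons_one)

lemma act_linear: "act n f [:c, 1:] = f + mscale c (mone n)"
  using f by (simp only: act_pCons act_0 mm_zero_left mscale_simps mm_one_left add_0_right) (simp add: add.commute)

lemma act_X: "act n f [:0, 1:] = f"
  by (simp only: act_linear mscale_simps add_0_right)

lemma act_power: "act n f (p ^ k) = mpow n (act n f p) k"
proof (induction k)
  case (Suc k)
  then show ?case by (simp only: power_Suc2 act_mult mpow_Suc)
qed (simp add: act_1)

lemma act_const: "act n f [:c:] = mscale c (mone n)"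
  by (simp only: act_pCons act_0 mm_zero_left add_0_right)

lemma act_monom: "act n f (monom c k) = mscale c (mpow n f k)"
proof -
  have "monom c k = smult c ([:0, 1:] ^ k)"
    by (simp add: monom_altdef)
  then show ?thesis by (simp only: act_smult act_power act_X)
qed

lemma act_sum: "act n f (\<Sum>x\<in>S. g x) = (\<Sum>x\<in>S. act n f (g x))"
  by (induction S rule: infinite_finite_induct) (simp_all only: sum.infinite sum.empty sum.insert act_0 act_add not_False_eq_True)

text \<open>One power more than there are matrices in a finite spanning set of \<open>mats n\<close>
  cannot be independent. Dependence is a property of sets, hence the separate case of two equal
  powers.\<close>

lemma annihilating_poly: "\<exists>p. p \<noteq> 0 \<and> act n f p = 0"
proof -
  let ?B = "den n ` set (units [0..<n]) :: (nat \<Rightarrow> nat \<Rightarrow> 'k) set"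
  define N where "N = card ?B"
  show ?thesis
  proof (cases "inj_on (mpow n f) {..N}")
    case False
    then obtain i j where ij: "i \<noteq> j" "mpow n f i = mpow n f j"
      unfolding inj_on_def by blast
    have "coeff (monom (1 :: 'k) i - monom 1 j) i \<noteq> 0"
      using ij by simp
    then have "monom (1 :: 'k) i - monom 1 j \<noteq> 0" by force
    moreover have "act n f (monom 1 i - monom 1 j) = 0"
      using ij by (simp add: act_diff act_monom)
    ultimately show ?thesis by blast
  next
    case True
    let ?S = "mpow n f ` {..N}"
    have card: "card ?S = Suc N" using card_image[OF True] by simp
    have "?S \<subseteq> mat.span ?B" using f by (auto simp: span_units)
    then have "mat.dependent ?S"
      using mat.independent_span_bound[of ?B ?S] card by (auto simp: N_def)
    then obtain u where u: "\<exists>v\<in>?S. u v \<noteq> 0" "(\<Sum>v\<in>?S. mscale (u v) v) = 0"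
      using mat.dependent_finite[of ?S] by auto
    define p where "p = (\<Sum>i\<le>N. monom (u (mpow n f i)) i)"
    have "act n f p = (\<Sum>i\<le>N. mscale (u (mpow n f i)) (mpow n f i))"
      by (simp only: p_def act_sum act_monom)
    also have "\<dots> = 0" using u(2) by (simp only: sum.reindex[OF True] o_def)
    finally have "act n f p = 0" .
    moreover have "p \<noteq> 0"
    proof -
      obtain i where i: "i \<le> N" "u (mpow n f i) \<noteq> 0" using u(1) by auto
      then have "coeff p i \<noteq> 0" by (simp add: p_def coeff_sum sum.delta)
      then show ?thesis by force
    qed
    ultimately show ?thesis by blast
  qed
qed

text \<open>Fitting's lemma: a polynomial annihilating \<open>f\<close> gives \<open>f\<^sup>k = f\<^sup>k\<^sup>+\<^sup>1 g(f)\<close>, and then \<open>f\<^sup>k g(f)\<^sup>k\<close>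
  is idempotent.\<close>

lemma fitting:
  obtains k g where "mm n (act n f ([:0, 1:] ^ k * g ^ k)) (act n f ([:0, 1:] ^ k * g ^ k)) = act n f ([:0, 1:] ^ k * g ^ k)"
    and "act n f ([:0, 1:] ^ k * g ^ k) = 0 \<Longrightarrow> mpow n f k = 0"
    and "act n f ([:0, 1:] ^ k * g ^ k) = mone n \<Longrightarrow> \<exists>q. mm n f (act n f q) = mone n"
proof -
  let ?X = "[:0, 1:] :: 'k poly"
  obtain p where p: "p \<noteq> 0" "act n f p = 0" using annihilating_poly by blast
  \<comment> \<open>All factors X are split off, so that the remaining factor has a nonzero constant
    term.\<close>
  obtain q where q: "p = ?X ^ order 0 p * q" "\<not> ?X dvd q"
    using order_decomp[OF p(1), of 0] by auto
  define k where "k = order 0 p"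
  obtain c r where cr: "q = pCons c r" by (cases q)
  have "c \<noteq> 0"
  proof
    assume "c = 0"
    then have "q = ?X * r" by (simp add: cr)
    then show False using q(2) by (metis dvd_triv_left)
  qed
  \<comment> \<open>Chosen so that q = c (1 - X g), the constant term c having been factored
    out.\<close>
  define g where "g = smult (- inverse c) r"
  have "q = smult c (1 - ?X * g)"
    using \<open>c \<noteq> 0\<close> by (simp add: cr g_def one_pCons)
  then have "p = smult c (?X ^ k * (1 - ?X * g))"
    using q(1) by (simp add: k_def)
  then have "mscale (inverse c) (act n f p) = act n f (?X ^ k * (1 - ?X * g))"
    using \<open>c \<noteq> 0\<close> by (simp only: act_smult mscale_simps) simp
  then have z: "act n f (?X ^ k * (1 - ?X * g)) = 0" using p(2) by simp
  \<comment> \<open>By the geometric sum, X^k (1 - (X g)^k) is a multiple of X^k (1 - X g), which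
    annihilates f; hence X^k and X^k (X g)^k agree at f.\<close>
  have dvd: "1 - ?X * g dvd 1 - (?X * g) ^ k"
    using one_diff_power_eq[of "?X * g" k] by (metis dvd_triv_left)
  have z': "act n f (a * (?X ^ k * (1 - (?X * g) ^ k))) = 0" for a
  proof -
    obtain b where "1 - (?X * g) ^ k = (1 - ?X * g) * b" using dvd by blast
    then have "a * (?X ^ k * (1 - (?X * g) ^ k)) = (?X ^ k * (1 - ?X * g)) * (a * b)"
      by (simp only: ac_simps)
    then show ?thesis using z by (simp only: act_mult[of "?X ^ k * (1 - ?X * g)"] mm_zero_left)
  qed
  let ?e = "?X ^ k * g ^ k"
  show ?thesis
  proof (rule that[of k g])
    have "?e - ?e * ?e = g ^ k * (?X ^ k * (1 - (?X * g) ^ k))"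
      by (simp only: power_mult_distrib right_diff_distrib mult_1_right) (simp only: ac_simps)
    then have "act n f ?e - act n f (?e * ?e) = 0"
      using z'[of "g ^ k"] by (simp only: act_diff[symmetric])
    then show "mm n (act n f ?e) (act n f ?e) = act n f ?e"
      by (simp only: act_mult[of ?e ?e, symmetric]) simp
    assume e0: "act n f ?e = 0"
    have "?X ^ k = 1 * (?X ^ k * (1 - (?X * g) ^ k)) + ?e * ?X ^ k"
      by (simp only: power_mult_distrib right_diff_distrib mult_1_right mult_1_left) (simp add: ac_simps)
    then have "act n f (?X ^ k) = act n f (1 * (?X ^ k * (1 - (?X * g) ^ k)) + ?e * ?X ^ k)"
      by (rule arg_cong)
    also have "\<dots> = 0"
      using z'[of 1] e0 by (simp only: act_add act_mult[of ?e] mm_zero_left add_0)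
    finally have "act n f (?X ^ k) = 0" .
    then show "mpow n f k = 0" by (simp only: act_power act_X)
  next
    assume e1: "act n f ?e = mone n"
    show "\<exists>q. mm n f (act n f q) = mone n"
    proof (cases k)
      \<comment> \<open>For k = 0 the idempotent is 1 in any case and carries no information; the
        annihilating polynomial 1 - X g itself gives the inverse g(f).\<close>
      case 0
      then have "act n f (1 - ?X * g) = 0" using z by simp
      then have "act n f 1 = act n f (?X * g)" by (simp only: act_diff) simp
      then show ?thesis by (metis act_mult act_X act_1)
    next
      case (Suc l)
      then have "?e = ?X * (?X ^ l * g ^ k)" by (simp only: power_Suc mult.assoc)
      then have "mm n (act n f ?X) (act n f (?X ^ l * g ^ k)) = mone n"
        using e1 act_mult by metis
      then show ?thesis by (metis act_X)
    qed
  qed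
qed

end

section \<open>Matrix algebras without nontrivial idempotents\<close>

locale mat_algebra =
  fixes n :: nat and C :: "(nat \<Rightarrow> nat \<Rightarrow> 'k::field) set"
  assumes sub: "mat.subspace C"
    and C_mats: "C \<subseteq> mats n"
    and one_C: "mone n \<in> C"
    and mm_C: "\<And>u v. u \<in> C \<Longrightarrow> v \<in> C \<Longrightarrow> mm n u v \<in> C"
begin

lemma act_C: "u \<in> C \<Longrightarrow> act n u p \<in> C"
  by (induction p)
    (auto simp: act_pCons mat.subspace_0[OF sub] one_C mm_C
      intro!: mat.subspace_add[OF sub] mat.subspace_scale[OF sub])

text \<open>For n = 0 the condition holds because 0 = 1, in accordance with the convention that the
  zero representation is indecomposable.\<close>

definition connected_algebra :: bool where
  "connected_algebra \<longleftrightarrow> (\<forall>e\<in>C. mm n e e = e \<longrightarrow> e = 0 \<or> e = mone n)"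

text \<open>The Fitting idempotent is a polynomial in \<open>u\<close> and therefore lies in
  \<open>C\<close>. Its only possible values 0 and 1 make \<open>u\<close> nilpotent or invertible,
  and the inverse is again a polynomial in \<open>u\<close>, hence two-sided and in
  \<open>C\<close>.\<close>

lemma nilpotent_or_unit:
  assumes "connected_algebra" "u \<in> C"
  shows "(\<exists>k. mpow n u k = 0) \<or> (\<exists>v\<in>C. mm n u v = mone n \<and> mm n v u = mone n)"
proof -
  have u: "u \<in> mats n" using assms(2) C_mats by blast
  obtain k g where e: "mm n (act n u ([:0, 1:] ^ k * g ^ k)) (act n u ([:0, 1:] ^ k * g ^ k)) = act n u ([:0, 1:] ^ k * g ^ k)"
    and 0: "act n u ([:0, 1:] ^ k * g ^ k) = 0 \<Longrightarrow> mpow n u k = 0"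
    and 1: "act n u ([:0, 1:] ^ k * g ^ k) = mone n \<Longrightarrow> \<exists>q. mm n u (act n u q) = mone n"
    by (rule fitting[OF u]) blast
  show ?thesis
    using assms(1) e 0 1 act_C[OF assms(2)] act_comm[OF u] unfolding connected_algebra_def by metis
qed

end

context mat_algebra
begin

definition nilpotents :: "(nat \<Rightarrow> nat \<Rightarrow> 'k) set" where
  "nilpotents = {u \<in> C. \<exists>k. mpow n u k = 0}"

text \<open>\<open>C\<close> acts from the right, the side on which \<open>chain_step\<close>
  appends factors.\<close>

definition submodule :: "(nat \<Rightarrow> nat \<Rightarrow> 'k) set \<Rightarrow> bool" where
  "submodule U \<longleftrightarrow> mat.subspace U \<and> U \<subseteq> mats n \<and> (\<forall>u\<in>U. \<forall>v\<in>C. mm n u v \<in> U)"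

lemma submodule_zero: "submodule {0}"
  using mat.subspace_0[OF subspace_mats] by (auto simp: submodule_def mat.subspace_def)

lemma submodule_mats: "submodule (mats n)"
  using C_mats by (auto simp: submodule_def subspace_mats intro: mm_mats)

context
  assumes conn: connected_algebra and pos: "n > 0"
begin

lemma mone_nonzero: "(mone n :: nat \<Rightarrow> nat \<Rightarrow> 'k) \<noteq> 0"
proof
  assume "(mone n :: nat \<Rightarrow> nat \<Rightarrow> 'k) = 0"
  then have "mone n 0 0 = (0 :: 'k)" by (simp add: zero_fun_apply)
  then show False using pos by (simp add: mone_def)
qed

text \<open>Multiplication by the right inverse \<open>v\<close> strips one factor from a vanishing
  power of \<open>u\<close>, down to 1 = 0.\<close>

lemma nilpotent_not_unit:
  assumes "mpow n u k = 0" "mm n u v = mone n" "u \<in> C" "v \<in> C"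
  shows False
proof -
  have "mpow n u k = 0 \<Longrightarrow> (mone n :: nat \<Rightarrow> nat \<Rightarrow> 'k) = 0" for k
  proof (induction k)
    case (Suc k)
    have "mpow n u k = mm n (mpow n u k) (mm n u v)"
      using assms(2,3) C_mats by (simp add: mm_one_right subset_iff)
    also have "\<dots> = mm n (mpow n u (Suc k)) v"
      by (simp only: mpow_Suc mm_assoc)
    finally show ?case using Suc by simp
  qed simp
  with assms(1) mone_nonzero show False by blast
qed

text \<open>Otherwise \<open>mm n u v\<close> would be a unit, and \<open>u\<close> would have a
  right inverse.\<close>

lemma nilpotents_mult_right:
  assumes "u \<in> nilpotents" "v \<in> C" shows "mm n u v \<in> nilpotents"
proof (rule ccontr)
  assume neg: "mm n u v \<notin> nilpotents"
  have uv: "u \<in> C" "mm n u v \<in> C" using assms mm_C by (auto simp: nilpotents_def)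
  then obtain w where "w \<in> C" "mm n (mm n u v) w = mone n"
    using nilpotent_or_unit[OF conn, of "mm n u v"] neg by (auto simp: nilpotents_def)
  then show False
    using nilpotent_not_unit[of u _ "mm n v w"] assms by (auto simp: nilpotents_def mm_assoc mm_C)
qed

text \<open>The last nonzero power of \<open>u\<close> is annihilated by \<open>u\<close>, so it is
  a left eigenvector of the nilpotent 1 - u with eigenvalue 1.\<close>

lemma nilpotents_one_minus:
  assumes "u \<in> nilpotents" "mone n - u \<in> nilpotents"
  shows False
proof -
  have u: "u \<in> mats n" using assms C_mats by (auto simp: nilpotents_def)
  define k where "k = (LEAST k. mpow n u k = 0)"
  have k: "mpow n u k = 0" unfolding k_def
    using assms(1) by (auto simp: nilpotents_def intro: LeastI_ex)
  moreover have "k \<noteq> 0" using k mone_nonzero by (metis mpow_0)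
  ultimately obtain l where l: "k = Suc l" by (cases k) auto
  have nz: "mpow n u l \<noteq> 0"
    using not_less_Least[of l "\<lambda>k. mpow n u k = 0"] l by (auto simp: k_def)
  have "mm n (mpow n u l) (mone n - u) = mscale 1 (mpow n u l)"
    using k u by (simp add: l mm_diff_right mm_one_right flip: mpow_Suc)
  then show False
    using not_nilpotent_eigen[of "mpow n u l" n "mone n - u" 1] assms(2) nz u
    by (auto simp: nilpotents_def)
qed

text \<open>For sums this is the usual argument for local rings: if u + v had the inverse w, then u
  w and 1 - u w = v w would both be nilpotent. Scaling is multiplication by a scalar matrix from the
  right.\<close>

lemma nilpotents_subspace: "mat.subspace nilpotents"
  unfolding mat.subspace_def
proof (intro conjI ballI allI)
  have "mpow n (0 :: nat \<Rightarrow> nat \<Rightarrow> 'k) (Suc 0) = 0" by (simp only: mpow_Suc mm_zero_right)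
  then show "0 \<in> nilpotents"
    using mat.subspace_0[OF sub] unfolding nilpotents_def by blast
next
  fix c and u :: "nat \<Rightarrow> nat \<Rightarrow> 'k" assume u: "u \<in> nilpotents"
  have "mm n u (mscale c (mone n)) = mscale c u"
    using u C_mats by (auto simp: nilpotents_def mm_scale_right mm_one_right)
  then show "mscale c u \<in> nilpotents"
    using nilpotents_mult_right[OF u, of "mscale c (mone n)"] one_C mat.subspace_scale[OF sub] by auto
next
  fix u v assume u: "u \<in> nilpotents" and v: "v \<in> nilpotents"
  show "u + v \<in> nilpotents"
  proof (rule ccontr)
    assume neg: "u + v \<notin> nilpotents"
    have "u + v \<in> C" using u v mat.subspace_add[OF sub] by (auto simp: nilpotents_def)
    then obtain w where w: "w \<in> C" "mm n (u + v) w = mone n"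
      using nilpotent_or_unit[OF conn, of "u + v"] neg by (auto simp: nilpotents_def)
    then have "mone n - mm n u w = mm n v w"
      by (simp add: mm_add_left algebra_simps)
    then show False
      using nilpotents_one_minus[OF nilpotents_mult_right[OF u w(1)]] nilpotents_mult_right[OF v w(1)] by simp
  qed
qed

text \<open>Nakayama's lemma in the form used here: if \<open>U'\<close> is a maximal proper submodule of \<open>U\<close> and
  \<open>u \<in> U\<close>, then \<open>u nilpotents + U'\<close> is a submodule between them; it cannot be all of \<open>U\<close>, since
  \<open>u = u m + v\<close> with nilpotent \<open>m\<close> and \<open>v \<in> U'\<close> would give \<open>u = u m\<^sup>k\<close> modulo \<open>U'\<close> for all \<open>k\<close>.\<close>

lemma nilpotents_descend:
  assumes U: "submodule U" and U': "submodule U'" "U' \<subseteq> U"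
    and max: "\<And>V. submodule V \<Longrightarrow> U' \<subseteq> V \<Longrightarrow> V \<subseteq> U \<Longrightarrow> V = U' \<or> V = U"
    and u: "u \<in> U" and m: "m \<in> nilpotents"
  shows "mm n u m \<in> U'"
proof -
  have sU': "mat.subspace U'" and sU: "mat.subspace U" using U U' by (auto simp: submodule_def)
  have um: "u \<in> mats n" using U u by (auto simp: submodule_def)
  define V where "V = {mm n u m + v | m v. m \<in> nilpotents \<and> v \<in> U'}"
  have zero: "0 \<in> nilpotents" using nilpotents_subspace by (rule mat.subspace_0)
  have sub1: "U' \<subseteq> V"
  proof
    fix v assume "v \<in> U'"
    moreover have "v = mm n u 0 + v" by simp
    ultimately show "v \<in> V" unfolding V_def using zero by blast
  qed
  have sub2: "V \<subseteq> U"
    using U U'(2) u mat.subspace_add[OF sU] by (fastforce simp: V_def submodule_def nilpotents_def)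
  have "submodule V"
    unfolding submodule_def mat.subspace_def
  proof (intro conjI ballI allI)
    show "0 \<in> V" using sub1 mat.subspace_0[OF sU'] by blast
    show "V \<subseteq> mats n" using sub2 U by (auto simp: submodule_def)
  next
    fix x y assume "x \<in> V" "y \<in> V"
    then obtain m v m' v' where *: "m \<in> nilpotents" "v \<in> U'" "m' \<in> nilpotents" "v' \<in> U'"
      "x = mm n u m + v" "y = mm n u m' + v'" by (auto simp: V_def)
    then have "x + y = mm n u (m + m') + (v + v')" by (simp add: mm_add_right algebra_simps)
    then show "x + y \<in> V"
      unfolding V_def using * mat.subspace_add[OF sU'] mat.subspace_add[OF nilpotents_subspace] by blast
  next
    fix c x assume "x \<in> V"
    then obtain m v where *: "m \<in> nilpotents" "v \<in> U'" "x = mm n u m + v" by (auto simp: V_def)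
    then have "mscale c x = mm n u (mscale c m) + mscale c v"
      by (simp add: mm_scale_right mscale_add)
    then show "mscale c x \<in> V"
      unfolding V_def using * mat.subspace_scale[OF sU'] mat.subspace_scale[OF nilpotents_subspace] by blast
  next
    fix x w assume "x \<in> V" and w: "w \<in> C"
    then obtain m v where *: "m \<in> nilpotents" "v \<in> U'" "x = mm n u m + v" by (auto simp: V_def)
    then have "mm n x w = mm n u (mm n m w) + mm n v w"
      by (simp add: mm_add_left mm_assoc)
    moreover have "mm n v w \<in> U'" using U' * w by (auto simp: submodule_def)
    ultimately show "mm n x w \<in> V"
      unfolding V_def using * nilpotents_mult_right[OF _ w] by blast
  qed
  with max sub1 sub2 consider "V = U'" | "V = U" by blast
  then show ?thesis
  proof cases
    case 1
    have "mm n u m + 0 \<in> V" unfolding V_def using m mat.subspace_0[OF sU'] by blast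
    then show ?thesis using 1 by simp
  next
    case 2
    then obtain m' v where mv: "m' \<in> nilpotents" "v \<in> U'" "u = mm n u m' + v"
      using u by (auto simp: V_def)
    obtain k where k: "mpow n m' k = 0" and m': "m' \<in> C" using mv(1) by (auto simp: nilpotents_def)
    have "u - mm n u (mpow n m' k) \<in> U'" for k
    proof (induction k)
      case 0
      then show ?case using um mat.subspace_0[OF sU'] by (simp add: mm_one_right)
    next
      case (Suc k)
      have "u - mm n u (mpow n m' (Suc k)) = (u - mm n u m') + mm n (u - mm n u (mpow n m' k)) m'"
        by (simp add: mpow_Suc mm_diff_left mm_assoc)
      moreover have "u - mm n u m' = v" using mv(3) by (metis add_diff_cancel_left')
      ultimately show ?case
        using mv(2) Suc m' U'(1) mat.subspace_add[OF sU'] by (auto simp: submodule_def)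
    qed
    from this[of k] have "u \<in> U'" using k by simp
    then show ?thesis using U'(1) m by (auto simp: submodule_def nilpotents_def)
  qed
qed

end

end

section \<open>Composition series over a finite field\<close>

lemma card_mats: "finite (mats n :: (nat \<Rightarrow> nat \<Rightarrow> 'k::{field,finite}) set)"
  "card (mats n :: (nat \<Rightarrow> nat \<Rightarrow> 'k::{field,finite}) set) \<le> card (UNIV :: 'k set) ^ (n * n)"
proof -
  let ?r = "\<lambda>f :: nat \<Rightarrow> nat \<Rightarrow> 'k. restrict (\<lambda>(i, j). f i j) ({..<n} \<times> {..<n})"
  let ?P = "({..<n} \<times> {..<n}) \<rightarrow>\<^sub>E (UNIV :: 'k set)"
  have inj: "inj_on ?r (mats n)"
  proof (rule inj_onI, intro ext)
    fix f g :: "nat \<Rightarrow> nat \<Rightarrow> 'k" and i j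
    assume *: "f \<in> mats n" "g \<in> mats n" "?r f = ?r g"
    show "f i j = g i j"
      using fun_cong[OF *(3), of "(i, j)"] mats_outside[OF *(1), of i j] mats_outside[OF *(2), of i j]
      by (cases "i < n \<and> j < n") auto
  qed
  have fin: "finite ?P" by (intro finite_PiE) auto
  have sub: "?r ` mats n \<subseteq> ?P"
    by (intro image_subsetI) (simp add: PiE_def del: restrict_apply)
  show "finite (mats n :: (nat \<Rightarrow> nat \<Rightarrow> 'k) set)"
    using finite_imageD[OF finite_subset[OF sub fin] inj] .
  have "card (mats n :: (nat \<Rightarrow> nat \<Rightarrow> 'k) set) \<le> card ?P"
    using card_inj_on_le[OF inj sub fin] .
  then show "card (mats n :: (nat \<Rightarrow> nat \<Rightarrow> 'k) set) \<le> card (UNIV :: 'k set) ^ (n * n)"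
    by (simp add: card_PiE card_cartesian_product)
qed

text \<open>For \<open>v\<close> outside \<open>U\<close> the cosets of \<open>U\<close> through the
  multiples of \<open>v\<close> are disjoint, one for each scalar. This expresses a drop of the
  dimension without bases.\<close>

lemma card_proper_subspace:
  fixes U V :: "(nat \<Rightarrow> nat \<Rightarrow> 'k::{field,finite}) set"
  assumes "mat.subspace U" "mat.subspace V" "U \<subset> V" "finite V"
  shows "card (UNIV :: 'k set) * card U \<le> card V"
proof -
  obtain v where v: "v \<in> V" "v \<notin> U" using assms by blast
  let ?f = "\<lambda>(c :: 'k, u). mscale c v + u"
  have "inj_on ?f (UNIV \<times> U)"
  proof (rule inj_onI, clarify)
    fix c d u w assume *: "u \<in> U" "w \<in> U" "mscale c v + u = mscale d v + w"
    have eq: "mscale (c - d) v = w - u"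
      using *(3) by (simp add: mscale_def fun_eq_iff algebra_simps plus_fun_apply minus_apply)
    have "c = d"
    proof (rule ccontr)
      assume "c \<noteq> d"
      then have "v = mscale (inverse (c - d)) (mscale (c - d) v)" by simp
      also have "\<dots> \<in> U" unfolding eq using * assms(1)
        by (intro mat.subspace_scale mat.subspace_diff)
      finally show False using v by simp
    qed
    with * show "c = d \<and> u = w" by simp
  qed
  moreover have "?f ` (UNIV \<times> U) \<subseteq> V"
    using assms v by (auto intro!: mat.subspace_add mat.subspace_scale)
  ultimately have "card ((UNIV :: 'k set) \<times> U) \<le> card V"
    using assms(4) by (intro card_inj_on_le[of ?f])
  then show ?thesis by (simp add: card_cartesian_product)
qed

locale finite_mat_algebra = mat_algebra n C
  for n and C :: "(nat \<Rightarrow> nat \<Rightarrow> 'k::{field,finite}) set"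
begin

lemma maximal_submodule:
  assumes "connected_algebra" "n > 0" "submodule U" "U \<noteq> {0}"
  obtains U' where "submodule U'" "U' \<subset> U" "\<And>V. submodule V \<Longrightarrow> U' \<subseteq> V \<Longrightarrow> V \<subseteq> U \<Longrightarrow> V = U' \<or> V = U"
proof -
  have fin: "finite U" using assms(3)
    by (intro finite_subset[OF _ card_mats(1)]) (auto simp: submodule_def)
  let ?S = "{V. submodule V \<and> V \<subset> U}"
  have "finite ?S" using fin by (intro finite_subset[of ?S "Pow U"]) auto
  moreover have "?S \<noteq> {}"
  proof -
    have "{0} \<in> ?S"
      using assms submodule_zero by (auto simp: submodule_def mat.subspace_0)
    then show ?thesis by (intro notI) simp
  qed
  ultimately have "\<exists>m\<in>?S. \<forall>b\<in>?S. m \<subseteq> b \<longrightarrow> m = b" by (rule finite_has_maximal)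
  then obtain U' where U': "U' \<in> ?S" "\<forall>b\<in>?S. U' \<subseteq> b \<longrightarrow> U' = b" by (rule bexE)
  show ?thesis
  proof (rule that[of U'])
    show "submodule U'" "U' \<subset> U" using U'(1) by simp_all
    fix V assume V: "submodule V" "U' \<subseteq> V" "V \<subseteq> U"
    show "V = U' \<or> V = U"
    proof (cases "V = U")
      case False
      then have "V \<in> ?S" using V by simp
      then show ?thesis using U'(2) V(2) by auto
    qed simp
  qed
qed

lemma nilpotent_list_nilpotents:
  assumes conn: "connected_algebra" and pos: "n > 0" and ms: "den n ` set ms \<subseteq> nilpotents"
  shows "nilpotent_list [0..<n] ms"
proof -
  let ?q = "card (UNIV :: 'k set)"
  \<comment> \<open>One step down a composition series: some maximal proper submodule, with {0}
    repeated once it is reached.\<close>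
  define next_sub where "next_sub = (\<lambda>U. if U = {0} then {0} else
    SOME U'. submodule U' \<and> U' \<subset> U \<and> (\<forall>V. submodule V \<longrightarrow> U' \<subseteq> V \<longrightarrow> V \<subseteq> U \<longrightarrow> V = U' \<or> V = U))"
  define U where "U = (\<lambda>k. (next_sub ^^ k) (mats n))"
  have next_sub: "submodule (next_sub W) \<and> next_sub W \<subset> W \<and>
      (\<forall>V. submodule V \<longrightarrow> next_sub W \<subseteq> V \<longrightarrow> V \<subseteq> W \<longrightarrow> V = next_sub W \<or> V = W)"
    if "submodule W" "W \<noteq> {0}" for W
  proof -
    have "\<exists>U'. submodule U' \<and> U' \<subset> W \<and> (\<forall>V. submodule V \<longrightarrow> U' \<subseteq> V \<longrightarrow> V \<subseteq> W \<longrightarrow> V = U' \<or> V = W)"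
      using maximal_submodule[OF conn pos that] by metis
    from someI_ex[OF this] show ?thesis using that by (simp add: next_sub_def)
  qed
  have zero: "next_sub {0} = {0}" by (simp add: next_sub_def)
  have subm: "submodule (U k)" for k
  proof (induction k)
    case 0
    then show ?case using submodule_mats by (simp add: U_def)
  next
    case (Suc k)
    then show ?case using next_sub[of "U k"] zero by (cases "U k = {0}") (auto simp: U_def)
  qed
  have fin: "finite (U k)" for k
    using subm[of k] by (intro finite_subset[OF _ card_mats(1)]) (auto simp: submodule_def)
  \<comment> \<open>Each step above {0} loses at least a factor \<open>?q\<close>; at k = n * n at
    most one element is left, so the chain has arrived at {0}.\<close>
  have card: "U k = {0} \<or> card (U k) * ?q ^ k \<le> ?q ^ (n * n)" for k
  proof (induction k)
    case 0
    then show ?case by (simp add: U_def card_mats(2))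
  next
    case (Suc k)
    show ?case
    proof (cases "U k = {0}")
      case True
      then show ?thesis using zero by (simp add: U_def)
    next
      case False
      then have "U (Suc k) \<subset> U k" using next_sub[OF subm False] by (simp add: U_def)
      then have "?q * card (U (Suc k)) \<le> card (U k)"
        using subm fin by (intro card_proper_subspace) (auto simp: submodule_def)
      then have "?q * card (U (Suc k)) * ?q ^ k \<le> card (U k) * ?q ^ k"
        by (rule mult_le_mono1)
      also have "\<dots> \<le> ?q ^ (n * n)"
        using Suc False by simp
      also have "?q * card (U (Suc k)) * ?q ^ k = card (U (Suc k)) * ?q ^ Suc k"
        by (simp only: power_Suc ac_simps)
      finally show ?thesis by simp
    qed
  qed
  have q: "?q > 0" by (simp add: card_gt_0_iff)
  have "U (n * n) \<subseteq> {0}"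
  proof (cases "U (n * n) = {0}")
    case False
    with card[of "n * n"] have "card (U (n * n)) \<le> 1" using q by simp
    moreover have "0 \<in> U (n * n)" using subm[of "n * n"] by (auto simp: submodule_def mat.subspace_0)
    ultimately show ?thesis using fin[of "n * n"] by (metis card_le_Suc0_iff_eq One_nat_def singletonI subsetI)
  qed simp
  then show ?thesis
  proof (rule nilpotent_listI[of n U, rotated 2])
    show "mone n \<in> U 0" by (simp add: U_def)
    show "mat.subspace (U k)" for k using subm[of k] by (simp add: submodule_def)
    fix k u m assume u: "u \<in> U k" and "m \<in> den n ` set ms"
    then have m: "m \<in> nilpotents" using ms by blast
    show "mm n u m \<in> U (Suc k)"
    proof (cases "U k = {0}")
      case True
      then show ?thesis using u zero by (simp add: U_def)
    next
      case False
      have "U (Suc k) = next_sub (U k)" by (simp add: U_def)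
      then show ?thesis
        using next_sub[OF subm False] nilpotents_descend[OF conn pos subm[of k] _ _ _ u m, of "U (Suc k)"] by auto
    qed
  qed
qed

end

section \<open>Passing to the algebraic closure\<close>

interpretation ac: field_hom "to_ac :: 'k::field \<Rightarrow> 'k alg_closure"
  by unfold_locales simp_all

definition ext :: "(nat \<Rightarrow> nat \<Rightarrow> 'k::field) \<Rightarrow> nat \<Rightarrow> nat \<Rightarrow> 'k alg_closure" where
  "ext u = (\<lambda>i j. to_ac (u i j))"

lemma den_hm: "den n (map (map to_ac) A) = ext (den n A)"
  by (simp add: den_def ext_def ac.ent_hm fun_eq_iff)

lemma ext_mm: "ext (mm n u v) = mm n (ext u) (ext v)"
  by (simp add: ext_def mm_def to_ac_sum)

lemma ext_mone: "ext (mone n) = mone n"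
  by (simp add: ext_def mone_def fun_eq_iff)

lemma ext_diff: "ext (u - v) = ext u - ext v"
  by (simp add: ext_def fun_eq_iff minus_apply)

lemma ext_scale: "ext (mscale c u) = mscale (to_ac c) (ext u)"
  by (simp add: ext_def mscale_def)

lemma ext_mpow: "ext (mpow n u k) = mpow n (ext u) k"
  by (induction k) (simp_all only: mpow_0 mpow_Suc ext_mone ext_mm)

lemma ext_eq_iff: "ext u = ext v \<longleftrightarrow> u = v"
  by (simp add: ext_def fun_eq_iff)

lemma ext_0 [simp]: "ext 0 = 0"
  by (simp add: ext_def fun_eq_iff zero_fun_apply)

lemma ext_mats: "ext u \<in> mats n \<longleftrightarrow> u \<in> mats n"
  by (simp add: ext_def mats_def)

section \<open>Commutants and eigenvalues over the closure\<close>

lemma mat_algebra_commutant: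
  fixes S :: "(nat \<Rightarrow> nat \<Rightarrow> 'k::field) set"
  assumes "S \<subseteq> mats n" shows "mat_algebra n (commutant n S)"
proof
  show "mat.subspace (commutant n S)"
    using subspace_mats[of n, where 'a = 'k] unfolding mat.subspace_def commutant_def
    by (auto simp: mm_add_left mm_add_right mm_scale_left mm_scale_right)
  show "commutant n S \<subseteq> mats n" by (auto simp: commutant_def)
  show "mone n \<in> commutant n S"
    using assms by (auto simp: commutant_def mm_one_left mm_one_right subset_iff)
  show "mm n u v \<in> commutant n S" if "u \<in> commutant n S" "v \<in> commutant n S" for u v
    using that by (auto simp: commutant_def mm_mats) (metis mm_assoc)
qed

lemma commutant_ext: "u \<in> commutant n S \<Longrightarrow> ext u \<in> commutant n (ext ` S)"
  by (auto simp: commutant_def ext_mats simp flip: ext_mm)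

text \<open>If no u - c were nilpotent, all would be units, and the linear factors of an
  annihilating polynomial could be cancelled one after the other until a nonzero constant
  annihilates \<open>u\<close>.\<close>

lemma shifted_nilpotent:
  fixes C :: "(nat \<Rightarrow> nat \<Rightarrow> 'k::alg_closed_field) set"
  assumes "mat_algebra n C" "mat_algebra.connected_algebra n C" "n > 0" "u \<in> C"
  shows "\<exists>c k. mpow n (u - mscale c (mone n)) k = 0"
proof (rule ccontr)
  interpret mat_algebra n C by fact
  assume neg: "\<not> ?thesis"
  have u: "u \<in> mats n" using assms(4) C_mats by blast
  have unit: "\<exists>v\<in>C. mm n v (u - mscale c (mone n)) = mone n" for c
  proof -
    have "u - mscale c (mone n) \<in> C"
      using assms(4) one_C by (intro mat.subspace_diff[OF sub] mat.subspace_scale[OF sub])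
    then show ?thesis using nilpotent_or_unit[OF assms(2)] neg by metis
  qed
  have "p \<noteq> 0 \<Longrightarrow> act n u p = 0 \<Longrightarrow> False" for p
  proof (induction "degree p" arbitrary: p rule: less_induct)
    case less
    show False
    proof (cases "degree p = 0")
      case True
      then obtain a where a: "p = [:a:]" by (metis degree_eq_zeroE)
      then have "mscale (inverse a) (mscale a (mone n)) = (0 :: nat \<Rightarrow> nat \<Rightarrow> 'k)"
        using less.prems(2) by (simp add: act_const[OF u])
      then show False using less.prems(1) a mone_nonzero[OF assms(2,3)] by simp
    next
      case False
      then obtain c where "poly p c = 0"
        using alg_closed_imp_poly_has_root[of p] by auto
      then obtain r where r: "p = [:- c, 1:] * r"
        by (auto simp: poly_eq_0_iff_dvd)
      obtain v where v: "v \<in> C" "mm n v (u - mscale c (mone n)) = mone n"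
        using unit by blast
      have "mscale (- c) (mone n) = - mscale c (mone n)"
        by (simp add: mscale_def fun_eq_iff)
      then have "act n u [:- c, 1:] = u - mscale c (mone n)"
        by (simp add: act_linear[OF u])
      then have "0 = mm n (u - mscale c (mone n)) (act n u r)"
        using less.prems(2) by (simp only: r act_mult[OF u])
      then have "0 = mm n v (mm n (u - mscale c (mone n)) (act n u r))" by simp
      also have "\<dots> = act n u r"
        using v(2) act_mats[OF u] by (simp add: mm_one_left flip: mm_assoc)
      finally have "act n u r = 0" by simp
      moreover have "r \<noteq> 0" using less.prems(1) r by auto
      moreover have "degree r < degree p"
        using \<open>r \<noteq> 0\<close> by (simp add: r degree_mult_eq del: mult_pCons_left)
      ultimately show False using less.hyps by blast
    qed
  qed
  then show False using annihilating_poly[OF u] by blast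
qed

text \<open>The map is additive and only 0 has a vanishing power, so it is injective; an injective
  map of a finite set into itself is onto.\<close>

lemma frobenius_surj:
  fixes a :: "'k::{field,finite}"
  shows "\<exists>d. d ^ (CHAR('k) ^ k) = a"
proof -
  note prime = prime_CHAR_semidom[where ?'a = 'k, OF finite_imp_CHAR_pos[OF finite]]
  have "inj (\<lambda>x :: 'k. x ^ (CHAR('k) ^ k))"
  proof (rule injI)
    fix x y :: 'k assume eq: "x ^ (CHAR('k) ^ k) = y ^ (CHAR('k) ^ k)"
    have "(y + (x - y)) ^ (CHAR('k) ^ k) = y ^ (CHAR('k) ^ k) + (x - y) ^ (CHAR('k) ^ k)"
      by (rule freshmans_dream'[OF prime refl])
    then have "(x - y) ^ (CHAR('k) ^ k) = 0" using eq by simp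
    then show "x = y" by simp
  qed
  then have "surj (\<lambda>x :: 'k. x ^ (CHAR('k) ^ k))"
    by (rule finite_UNIV_inj_surj[OF finite])
  then show ?thesis by (metis surjD)
qed

text \<open>If \<open>q \<ge> k\<close> is a power of the characteristic, then \<open>0 = (u - c)\<^sup>q = u\<^sup>q - c\<^sup>q\<close>, so that \<open>c\<^sup>q\<close>
  lies in the small field, and so does \<open>c\<close>, since Frobenius is bijective there.\<close>

lemma eigenvalue_descends:
  fixes u :: "nat \<Rightarrow> nat \<Rightarrow> 'k::{field,finite}"
  assumes "u \<in> mats n" "n > 0" "mpow n (ext u - mscale c (mone n)) k = 0"
  shows "c \<in> range to_ac"
proof -
  define q where "q = CHAR('k) ^ k"
  note prime = prime_CHAR_semidom[where ?'a = 'k, OF finite_imp_CHAR_pos[OF finite]]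
  have "CHAR('k) > 1" using prime by (rule prime_gt_1_nat)
  then have "k \<le> q" unfolding q_def by (simp add: power_gt_expt less_imp_le)
  have e: "ext u \<in> mats n" using assms(1) by (simp add: ext_mats)
  have "mscale (- c) (mone n) = - mscale c (mone n)"
    by (simp add: mscale_def fun_eq_iff)
  then have lin: "act n (ext u) [:- c, 1:] = ext u - mscale c (mone n)"
    by (simp add: act_linear[OF e])
  have "[:- c, 1:] ^ q = [:- c, 1:] ^ k * [:- c, 1:] ^ (q - k)"
    using \<open>k \<le> q\<close> by (simp flip: power_add)
  then have "act n (ext u) ([:- c, 1:] ^ q) = 0"
    using assms(3) by (simp only: act_mult[OF e] act_power[OF e] lin mm_zero_left)
  \<comment> \<open>The power is expanded in the commutative polynomial ring and only then evaluated
    at the matrix.\<close>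
  moreover have "[:- c, 1:] ^ q = [:0, 1:] ^ q + [:(- c) ^ q:]"
  proof -
    have "([:0, 1:] + [:- c:]) ^ q = [:0, 1:] ^ q + [:- c:] ^ q"
      using prime by (intro freshmans_dream'[where n = k]) (simp_all add: q_def)
    then show ?thesis by (simp add: poly_const_pow)
  qed
  ultimately have "ext (mpow n u q) + mscale ((- c) ^ q) (mone n) = 0"
    by (simp only: act_add act_power[OF e] act_X[OF e] act_const[OF e] ext_mpow)
  \<comment> \<open>Position (0, 0) exists since n > 0; there the scalar matrix has the entry
    \<open>(- c) ^ q\<close>, and the other summand comes from the small field.\<close>
  then have "(ext (mpow n u q) + mscale ((- c) ^ q) (mone n)) 0 0 = 0"
    by (simp add: zero_fun_apply)
  then have 0: "to_ac (mpow n u q 0 0) + (- c) ^ q = 0"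
    using assms(2) by (simp add: ext_def plus_fun_apply mscale_def mone_def)
  obtain d where d: "d ^ q = mpow n u q 0 0"
    using frobenius_surj unfolding q_def by blast
  have "(to_ac d + (- c)) ^ q = to_ac d ^ q + (- c) ^ q"
    using prime by (intro freshmans_dream'[where n = k]) (simp_all add: q_def)
  then have "(to_ac d - c) ^ q = 0" using 0 by (simp flip: d)
  then have "c = to_ac d" by simp
  then show ?thesis by simp
qed

section \<open>Correctness of the decision procedure\<close>

lemma pick_shift: "\<exists>c. den n (pick Fs [0..<n] b) = den n b - mscale c (mone n)"
proof (induction Fs)
  case Nil
  have "den n b = den n b - mscale 0 (mone n)" by simp
  then show ?case by (auto simp: pick_def)
next
  case (Cons c Fs)
  show ?case
  proof (cases "nilpotent_list [0..<n] [msub [0..<n] c (ident [0..<n]) b]")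
    case True
    then have "pick (c # Fs) [0..<n] b = msub [0..<n] c (ident [0..<n]) b" by (simp add: pick_def)
    then show ?thesis by (auto simp: den_msub den_ident)
  next
    case False
    then have "pick (c # Fs) [0..<n] b = pick Fs [0..<n] b" by (simp add: pick_def)
    then show ?thesis using Cons by simp
  qed
qed

lemma pick_nilpotent:
  assumes "c \<in> set Fs" "nilpotent_list [0..<n] [msub [0..<n] c (ident [0..<n]) b]"
  shows "nilpotent_list [0..<n] [pick Fs [0..<n] b]"
  using assms by (induction Fs) (auto simp: pick_def)

lemma decide_correct:
  fixes Fs :: "'k::{field,finite} list"
  assumes "set Fs = UNIV"
  shows "decide Fs [0..<n] Ms \<longleftrightarrow>
    mat_algebra.connected_algebra n (commutant n (ext ` den n ` set Ms))"
proof -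
  let ?S = "den n ` set Ms"
  let ?bs = "commutant_basis [0..<n] Ms"
  let ?hm = "map (map to_ac) :: 'k list list \<Rightarrow> 'k alg_closure list list"
  interpret K: mat_algebra n "commutant n (ext ` ?S)"
    by (rule mat_algebra_commutant) (auto simp: ext_mats)
  interpret k: finite_mat_algebra n "commutant n ?S"
    by (intro finite_mat_algebra.intro mat_algebra_commutant) auto
  have span: "mat.span (den n ` set ?bs) = commutant n ?S"
    by (rule span_commutant_basis)
  show ?thesis
  proof
    assume "decide Fs [0..<n] Ms"
    \<comment> \<open>The test has been passed over the small field; by naturality it is passed over
      the closure.\<close>
    then have nil: "nilpotent_list [0..<n] (map ?hm (map (pick Fs [0..<n]) ?bs))"
      unfolding decide_def ac.nilpotent_list_hm .
    let ?M = "den n ` set (map ?hm (map (pick Fs [0..<n]) ?bs))"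
    \<comment> \<open>Elimination commutes with the extension, so the basis found over the small
      field spans the commutant over the closure.\<close>
    have "commutant n (ext ` ?S) = mat.span (den n ` set (map ?hm ?bs))"
      using span_commutant_basis[of n "map ?hm Ms"]
      by (simp only: ac.commutant_basis_hm) (simp add: image_image den_hm)
    also have "\<dots> \<subseteq> mat.span (insert (mone n) ?M)"
    proof (intro mat.span_minimal mat.subspace_span subsetI)
      fix w assume "w \<in> den n ` set (map ?hm ?bs)"
      then obtain b where b: "b \<in> set ?bs" "w = ext (den n b)" by (auto simp: den_hm)
      obtain c where "den n (pick Fs [0..<n] b) = den n b - mscale c (mone n)"
        using pick_shift by blast
      then have "w = den n (?hm (pick Fs [0..<n] b)) + mscale (to_ac c) (mone n)"
        by (simp add: b den_hm ext_diff ext_scale ext_mone)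
      moreover have "den n (?hm (pick Fs [0..<n] b)) \<in> ?M" using b by auto
      ultimately show "w \<in> mat.span (insert (mone n) ?M)"
        by (auto intro!: mat.span_add mat.span_scale intro: mat.span_base)
    qed
    finally have sub: "commutant n (ext ` ?S) \<subseteq> mat.span (insert (mone n) ?M)" .
    show "K.connected_algebra"
      unfolding K.connected_algebra_def
    proof (intro ballI impI)
      fix e assume e: "e \<in> commutant n (ext ` ?S)" "mm n e e = e"
      then have em: "e \<in> mats n" by (simp add: commutant_def)
      obtain c where c: "e - mscale c (mone n) \<in> mat.span ?M"
        using e(1) sub mat.span_breakdown_eq by blast
      let ?m = "e - mscale c (mone n)"
      have m: "mpow n ?m (n * n) = 0"
        using nilpotent_listD[OF nil c] .
      \<comment> \<open>With e = c + m and m nilpotent, e is a left eigenvector of m for 1 - c, and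
        1 - e is one for -c. Since c cannot be both 0 and 1, one of e and 1 - e vanishes.\<close>
      have "mm n e ?m = mscale (1 - c) e"
        using e(2) em by (simp add: mm_diff_right mm_scale_right mm_one_right)
          (simp add: mscale_def fun_eq_iff algebra_simps minus_apply)
      then have 1: "c \<noteq> 1 \<Longrightarrow> e = 0"
        using not_nilpotent_eigen[OF em _ _ m, of "1 - c"] by simp
      have "mone n - e \<in> mats n" using em by (intro mat.subspace_diff[OF subspace_mats]) auto
      moreover have "mm n (mone n - e) ?m = mscale (- c) (mone n - e)"
        using e(2) em by (simp add: mm_diff_right mm_diff_left mm_scale_right mm_one_right mm_one_left)
      ultimately have "c \<noteq> 0 \<Longrightarrow> mone n - e = 0"
        using not_nilpotent_eigen[of "mone n - e" n ?m "- c", OF _ _ _ m] by simp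
      with 1 show "e = 0 \<or> e = mone n" by (cases "c = 0") auto
    qed
  next
    assume conn: "K.connected_algebra"
    show "decide Fs [0..<n] Ms"
    proof (cases "n = 0")
      case True
      then show ?thesis
        by (auto simp: decide_def nilpotent_list_def prs_def list_all_iff)
    next
      case False
      then have pos: "n > 0" by simp
      \<comment> \<open>Idempotents over the small field remain idempotents over the closure, so the
        hypothesis descends.\<close>
      have conn': "k.connected_algebra"
        unfolding k.connected_algebra_def
      proof (intro ballI impI)
        fix e assume e: "e \<in> commutant n ?S" "mm n e e = e"
        then have "mm n (ext e) (ext e) = ext e" by (simp flip: ext_mm)
        with conn commutant_ext[OF e(1)] have "ext e = 0 \<or> ext e = mone n"
          by (simp add: K.connected_algebra_def)
        then show "e = 0 \<or> e = mone n"
          using ext_eq_iff[of e 0] ext_eq_iff[of e "mone n"] by (simp add: ext_mone)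
      qed
      have pick: "den n (pick Fs [0..<n] b) \<in> k.nilpotents" if b: "b \<in> set ?bs" for b
      proof -
        have bC: "den n b \<in> commutant n ?S" using mat.span_base[of "den n b" "den n ` set ?bs"] b unfolding span by simp
        obtain c k where ck: "mpow n (ext (den n b) - mscale c (mone n)) k = 0"
          using shifted_nilpotent[OF K.mat_algebra_axioms conn pos commutant_ext[OF bC]] by blast
        then obtain d where d: "c = to_ac d"
          using eigenvalue_descends[OF den_mats pos] by blast
        let ?m = "den n b - mscale d (mone n)"
        have "ext (mpow n ?m k) = 0"
          using ck by (simp add: d ext_mpow ext_diff ext_scale ext_mone)
        then have "ext (mpow n ?m k) = ext 0" by simp
        then have "mpow n ?m k = 0" by (simp only: ext_eq_iff)
        then have "?m \<in> k.nilpotents"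
          using bC k.one_C mat.subspace_diff[OF k.sub] mat.subspace_scale[OF k.sub]
          by (auto simp: k.nilpotents_def)
        then have "nilpotent_list [0..<n] [msub [0..<n] d (ident [0..<n]) b]"
          by (intro k.nilpotent_list_nilpotents[OF conn' pos]) (simp add: den_msub den_ident)
        \<comment> \<open>Which scalar \<open>pick\<close> has taken is left open: once some scalar
          passes, the result of \<open>pick\<close> passes too.\<close>
        then have "nilpotent_list [0..<n] [pick Fs [0..<n] b]"
          using pick_nilpotent assms by blast
        then have "mpow n (den n (pick Fs [0..<n] b)) (n * n) = 0"
          by (rule nilpotent_listD) (simp add: mat.span_base)
        moreover obtain c' where "den n (pick Fs [0..<n] b) = den n b - mscale c' (mone n)"
          using pick_shift by blast
        ultimately show ?thesis
          using bC k.one_C mat.subspace_diff[OF k.sub] mat.subspace_scale[OF k.sub]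
          by (auto simp: k.nilpotents_def)
      qed
      show ?thesis
        unfolding decide_def
        by (rule k.nilpotent_list_nilpotents[OF conn' pos]) (use pick in auto)
    qed
  qed
qed

section \<open>Endomorphisms as block matrices\<close>

lemma mat_mult_entry:
  assumes "A \<in> carrier_mat a m" "B \<in> carrier_mat m b" "i < a" "j < b"
  shows "(A * B) $$ (i, j) = (\<Sum>k<m. A $$ (i, k) * B $$ (k, j))"
  using assms by (simp add: scalar_prod_def atLeast0LessThan)

definition trivial_idempotents :: "('v, 'e) pre_digraph \<Rightarrow> ('v, 'e, 'k::field) rep \<Rightarrow> bool" where
  "trivial_idempotents G \<rho> \<longleftrightarrow> (\<forall>f. rep_hom G \<rho> \<rho> f \<and> (\<forall>v\<in>verts G. f v * f v = f v) \<longrightarrow>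
     (\<forall>v\<in>verts G. f v = 0\<^sub>m (vdim \<rho> v) (vdim \<rho> v)) \<or> (\<forall>v\<in>verts G. f v = 1\<^sub>m (vdim \<rho> v)))"

locale numbered_rep =
  fixes G :: "(nat, nat) pre_digraph" and \<rho> :: "(nat, nat, 'k::field) rep" and N :: nat
  assumes wf: "wf_digraph G" and verts: "verts G = {..<N}" and rep: "quiver_rep G \<rho>"
begin

definition idx :: "(nat \<times> nat) list" where
  "idx = index_list (map (vdim \<rho>) [0..<N])"

abbreviation n :: nat where "n \<equiv> length idx"

abbreviation vx :: "nat \<Rightarrow> nat" where "vx a \<equiv> fst (idx ! a)"
abbreviation co :: "nat \<Rightarrow> nat" where "co a \<equiv> snd (idx ! a)"

lemma idx_eq: "idx = concat (map (\<lambda>v. map (Pair v) [0..<vdim \<rho> v]) [0..<N])"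
  unfolding idx_def index_list_def by (rule arg_cong[where f = concat]) (simp add: nthd_nth)

lemma set_idx: "set idx = (SIGMA v:{..<N}. {..<vdim \<rho> v})"
  by (auto simp: idx_eq)

lemma distinct_idx: "distinct idx"
proof -
  have "distinct (concat (map (\<lambda>v. map (Pair v) [0..<d v]) [0..<M]))" for d :: "nat \<Rightarrow> nat" and M
    by (induction M) (auto simp: distinct_map inj_on_def)
  then show ?thesis by (simp add: idx_eq)
qed

lemma idx_bounds: "a < n \<Longrightarrow> vx a < N \<and> co a < vdim \<rho> (vx a)"
proof -
  assume "a < n"
  then have "idx ! a \<in> (SIGMA v:{..<N}. {..<vdim \<rho> v})"
    unfolding set_idx[symmetric] by (rule nth_mem)
  then obtain v i where "idx ! a = (v, i)" "v < N" "i < vdim \<rho> v" by blast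
  then show ?thesis by simp
qed

lemma idx_inj: "a < n \<Longrightarrow> b < n \<Longrightarrow> vx a = vx b \<Longrightarrow> co a = co b \<Longrightarrow> a = b"
  using distinct_idx by (metis nth_eq_iff_index_eq prod_eqI)

lemma idx_surj:
  assumes "v < N" "i < vdim \<rho> v"
  obtains a where "a < n" "vx a = v" "co a = i"
proof -
  have "(v, i) \<in> set idx" using assms by (simp add: set_idx)
  then show ?thesis using that by (metis in_set_conv_nth fst_conv snd_conv)
qed

lemma sum_block:
  assumes "v < N"
  shows "(\<Sum>k<n. if vx k = v then g (co k) else 0) = (\<Sum>i<vdim \<rho> v. g i)"
proof -
  have "(\<Sum>k<n. if vx k = v then g (co k) else 0) = (\<Sum>k\<in>{k. k < n \<and> vx k = v}. g (co k))"
    by (rule sum.mono_neutral_cong_right) auto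
  also have "\<dots> = (\<Sum>i<vdim \<rho> v. g i)"
  proof (rule sum.reindex_bij_betw)
    show "bij_betw co {k. k < n \<and> vx k = v} {..<vdim \<rho> v}"
      unfolding bij_betw_def
    proof
      show "inj_on co {k. k < n \<and> vx k = v}" by (intro inj_onI) (rule idx_inj, auto)
      show "co ` {k. k < n \<and> vx k = v} = {..<vdim \<rho> v}"
      proof (intro equalityI subsetI)
        fix i assume "i \<in> co ` {k. k < n \<and> vx k = v}"
        then obtain k where "k < n" "vx k = v" "i = co k" by blast
        then show "i \<in> {..<vdim \<rho> v}" using idx_bounds[of k] by simp
      next
        fix i assume "i \<in> {..<vdim \<rho> v}"
        then obtain k where "k < n" "vx k = v" "co k = i" using idx_surj[OF assms] by auto
        then show "i \<in> co ` {k. k < n \<and> vx k = v}" by blast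
      qed
    qed
  qed
  finally show ?thesis .
qed

text \<open>When only the positions in the block of one vertex \<open>v\<close> contribute, the long
  sum over all positions is an ordinary matrix product over the coordinates at
  \<open>v\<close>.\<close>

lemma mm_entry:
  assumes "v < N" "A \<in> carrier_mat x (vdim \<rho> v)" "B \<in> carrier_mat (vdim \<rho> v) y" "i < x" "j < y"
    and "\<And>k. k < n \<Longrightarrow> u a k * w k b = (if vx k = v then A $$ (i, co k) * B $$ (co k, j) else 0)"
  shows "mm n u w a b = (A * B) $$ (i, j)"
proof -
  have "mm n u w a b = (\<Sum>k<n. if vx k = v then A $$ (i, co k) * B $$ (co k, j) else 0)"
    unfolding mm_def using assms(6) by (intro sum.cong refl) auto
  also have "\<dots> = (\<Sum>k<vdim \<rho> v. A $$ (i, k) * B $$ (k, j))"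
    by (rule sum_block[OF assms(1), of "\<lambda>k. A $$ (i, k) * B $$ (k, j)"])
  finally show ?thesis using mat_mult_entry[OF assms(2-5)] by simp
qed

section \<open>Block matrices of vertices, arcs and endomorphisms\<close>

definition vmat :: "nat \<Rightarrow> nat \<Rightarrow> nat \<Rightarrow> 'k" where
  "vmat v = (\<lambda>a b. if a < n \<and> b < n \<and> a = b \<and> vx a = v then 1 else 0)"

definition amat :: "nat \<Rightarrow> nat \<Rightarrow> nat \<Rightarrow> 'k" where
  "amat e = (\<lambda>a b. if a < n \<and> b < n \<and> vx a = head G e \<and> vx b = tail G e
     then emat \<rho> e $$ (co a, co b) else 0)"

definition blk :: "(nat \<Rightarrow> 'k mat) \<Rightarrow> nat \<Rightarrow> nat \<Rightarrow> 'k" where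
  "blk f = (\<lambda>a b. if a < n \<and> b < n \<and> vx a = vx b then f (vx a) $$ (co a, co b) else 0)"

definition square_family :: "(nat \<Rightarrow> 'k mat) \<Rightarrow> bool" where
  "square_family f \<longleftrightarrow> (\<forall>v<N. f v \<in> carrier_mat (vdim \<rho> v) (vdim \<rho> v))"

lemma arc_dims:
  assumes "e \<in> arcs G"
  shows "head G e < N" "tail G e < N" "emat \<rho> e \<in> carrier_mat (vdim \<rho> (head G e)) (vdim \<rho> (tail G e))"
  using assms rep wf_digraph.head_in_verts[OF wf] wf_digraph.tail_in_verts[OF wf]
  by (auto simp: verts quiver_rep_def)

lemma blk_mats: "blk f \<in> mats n"
  by (auto simp: blk_def mats_def)

lemma blk_mult:
  assumes "square_family f" "square_family g"
  shows "mm n (blk f) (blk g) = blk (\<lambda>v. f v * g v)"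
proof (intro ext)
  fix a b
  show "mm n (blk f) (blk g) a b = blk (\<lambda>v. f v * g v) a b"
  proof (cases "a < n \<and> b < n \<and> vx a = vx b")
    case True
    then have v: "vx a < N" "co a < vdim \<rho> (vx a)" "co b < vdim \<rho> (vx a)"
      using idx_bounds[of a] idx_bounds[of b] by auto
    have "mm n (blk f) (blk g) a b = (f (vx a) * g (vx a)) $$ (co a, co b)"
      by (rule mm_entry[OF v(1) _ _ v(2,3)]) (use True assms v in \<open>auto simp: square_family_def blk_def\<close>)
    then show ?thesis using True by (simp add: blk_def)
  next
    case False
    then show ?thesis
      unfolding mm_def blk_def by (subst if_not_P) (auto intro!: sum.neutral)
  qed
qed

lemma blk_amat:
  assumes "square_family f" "e \<in> arcs G"
  shows "mm n (blk f) (amat e) = (\<lambda>a b. if a < n \<and> b < n \<and> vx a = head G e \<and> vx b = tail G e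
     then (f (head G e) * emat \<rho> e) $$ (co a, co b) else 0)"
proof (intro ext)
  fix a b
  note e = arc_dims[OF assms(2)]
  show "mm n (blk f) (amat e) a b = (if a < n \<and> b < n \<and> vx a = head G e \<and> vx b = tail G e
     then (f (head G e) * emat \<rho> e) $$ (co a, co b) else 0)"
  proof (cases "a < n \<and> b < n \<and> vx a = head G e \<and> vx b = tail G e")
    case True
    then have v: "co a < vdim \<rho> (head G e)" "co b < vdim \<rho> (tail G e)"
      using idx_bounds[of a] idx_bounds[of b] by auto
    have "mm n (blk f) (amat e) a b = (f (head G e) * emat \<rho> e) $$ (co a, co b)"
      by (rule mm_entry[OF e(1) _ e(3) v])
        (use True assms e in \<open>auto simp: square_family_def blk_def amat_def\<close>)
    then show ?thesis using True by simp
  next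
    case False
    then show ?thesis
      unfolding mm_def blk_def amat_def by (subst if_not_P) (auto intro!: sum.neutral)
  qed
qed

lemma amat_blk:
  assumes "square_family f" "e \<in> arcs G"
  shows "mm n (amat e) (blk f) = (\<lambda>a b. if a < n \<and> b < n \<and> vx a = head G e \<and> vx b = tail G e
     then (emat \<rho> e * f (tail G e)) $$ (co a, co b) else 0)"
proof (intro ext)
  fix a b
  note e = arc_dims[OF assms(2)]
  show "mm n (amat e) (blk f) a b = (if a < n \<and> b < n \<and> vx a = head G e \<and> vx b = tail G e
     then (emat \<rho> e * f (tail G e)) $$ (co a, co b) else 0)"
  proof (cases "a < n \<and> b < n \<and> vx a = head G e \<and> vx b = tail G e")
    case True
    then have v: "co a < vdim \<rho> (head G e)" "co b < vdim \<rho> (tail G e)"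
      using idx_bounds[of a] idx_bounds[of b] by auto
    have "mm n (amat e) (blk f) a b = (emat \<rho> e * f (tail G e)) $$ (co a, co b)"
      by (rule mm_entry[OF e(2) e(3) _ v])
        (use True assms e in \<open>auto simp: square_family_def blk_def amat_def\<close>)
    then show ?thesis using True by simp
  next
    case False
    then show ?thesis
      unfolding mm_def blk_def amat_def by (subst if_not_P) (auto intro!: sum.neutral)
  qed
qed

lemma vmat_mult: "u \<in> mats n \<Longrightarrow> mm n (vmat v) u = (\<lambda>a b. if vx a = v then u a b else 0)"
proof (intro ext)
  fix a b assume u: "u \<in> mats n"
  have "mm n (vmat v) u a b = (\<Sum>k<n. if k = a then (if vx a = v then u a b else 0) else 0)"
    unfolding mm_def vmat_def by (intro sum.cong refl) auto
  then show "mm n (vmat v) u a b = (if vx a = v then u a b else 0)"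
    using mats_outside[OF u, of a b] by (simp add: sum.delta)
qed

lemma mult_vmat: "u \<in> mats n \<Longrightarrow> mm n u (vmat v) = (\<lambda>a b. if vx b = v then u a b else 0)"
proof (intro ext)
  fix a b assume u: "u \<in> mats n"
  have "mm n u (vmat v) a b = (\<Sum>k<n. if k = b then (if vx b = v then u a b else 0) else 0)"
    unfolding mm_def vmat_def by (intro sum.cong refl) auto
  then show "mm n u (vmat v) a b = (if vx b = v then u a b else 0)"
    using mats_outside[OF u, of a b] by (simp add: sum.delta)
qed

lemma blk_eqD:
  assumes "square_family f" "square_family g" "blk f = blk g" "v < N"
  shows "f v = g v"
proof (rule eq_matI)
  have dims: "f v \<in> carrier_mat (vdim \<rho> v) (vdim \<rho> v)" "g v \<in> carrier_mat (vdim \<rho> v) (vdim \<rho> v)"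
    using assms by (auto simp: square_family_def)
  then show "dim_row (f v) = dim_row (g v)" "dim_col (f v) = dim_col (g v)" by auto
  fix i j assume "i < dim_row (g v)" "j < dim_col (g v)"
  then have ij: "i < vdim \<rho> v" "j < vdim \<rho> v" using dims by auto
  obtain a where a: "a < n" "vx a = v" "co a = i" using idx_surj[OF assms(4) ij(1)] by blast
  obtain b where b: "b < n" "vx b = v" "co b = j" using idx_surj[OF assms(4) ij(2)] by blast
  show "f v $$ (i, j) = g v $$ (i, j)"
    using fun_cong[OF fun_cong[OF assms(3), of a], of b] a b by (simp add: blk_def)
qed

lemma square_zero: "square_family (\<lambda>v. 0\<^sub>m (vdim \<rho> v) (vdim \<rho> v))"
  and square_one: "square_family (\<lambda>v. 1\<^sub>m (vdim \<rho> v))"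
  by (auto simp: square_family_def)

lemma blk_zero: "blk (\<lambda>v. 0\<^sub>m (vdim \<rho> v) (vdim \<rho> v)) = 0"
  using idx_bounds by (auto simp: blk_def fun_eq_iff zero_fun_apply) (metis index_zero_mat(1))

lemma blk_one: "blk (\<lambda>v. 1\<^sub>m (vdim \<rho> v)) = mone n"
proof (intro ext)
  fix a b
  show "blk (\<lambda>v. 1\<^sub>m (vdim \<rho> v)) a b = mone n a b"
    using idx_bounds[of a] idx_bounds[of b] idx_inj[of a b] by (auto simp: blk_def mone_def)
qed

definition gens :: "(nat \<Rightarrow> nat \<Rightarrow> 'k) set" where
  "gens = vmat ` {..<N} \<union> amat ` arcs G"

lemma gens_mats: "gens \<subseteq> mats n"
  by (auto simp: gens_def vmat_def amat_def mats_def split: if_splits)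

text \<open>A block diagonal matrix commutes with the vertex projections anyway; commuting with
  \<open>amat e\<close> is the intertwining equation at the arc \<open>e\<close>, read off in the
  block of its head and tail.\<close>

lemma blk_commutant:
  assumes "square_family f"
  shows "blk f \<in> commutant n gens \<longleftrightarrow> rep_hom G \<rho> \<rho> f"
proof
  assume hom: "rep_hom G \<rho> \<rho> f"
  have "mm n (blk f) (vmat v) = mm n (vmat v) (blk f)" for v
    by (simp add: vmat_mult mult_vmat blk_mats) (auto simp: blk_def fun_eq_iff)
  moreover have "mm n (blk f) (amat e) = mm n (amat e) (blk f)" if "e \<in> arcs G" for e
  proof -
    have "f (head G e) * emat \<rho> e = emat \<rho> e * f (tail G e)"
      using hom that by (simp add: rep_hom_def)
    then show ?thesis by (simp only: blk_amat[OF assms that] amat_blk[OF assms that])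
  qed
  ultimately show "blk f \<in> commutant n gens" by (auto simp: commutant_def blk_mats gens_def)
next
  assume comm: "blk f \<in> commutant n gens"
  have "f (head G e) * emat \<rho> e = emat \<rho> e * f (tail G e)" if e: "e \<in> arcs G" for e
  proof -
    note d = arc_dims[OF e]
    have f: "f (head G e) \<in> carrier_mat (vdim \<rho> (head G e)) (vdim \<rho> (head G e))"
      "f (tail G e) \<in> carrier_mat (vdim \<rho> (tail G e)) (vdim \<rho> (tail G e))"
      using assms d by (auto simp: square_family_def)
    have eq: "mm n (blk f) (amat e) = mm n (amat e) (blk f)"
      using comm e by (auto simp: commutant_def gens_def)
    show ?thesis
    proof (rule eq_matI)
      fix i j assume "i < dim_row (emat \<rho> e * f (tail G e))" "j < dim_col (emat \<rho> e * f (tail G e))"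
      then have ij: "i < vdim \<rho> (head G e)" "j < vdim \<rho> (tail G e)" using d f by auto
      obtain a where a: "a < n" "vx a = head G e" "co a = i" using idx_surj[OF d(1) ij(1)] by blast
      obtain b where b: "b < n" "vx b = tail G e" "co b = j" using idx_surj[OF d(2) ij(2)] by blast
      show "(f (head G e) * emat \<rho> e) $$ (i, j) = (emat \<rho> e * f (tail G e)) $$ (i, j)"
        using fun_cong[OF fun_cong[OF eq, of a], of b] a b
        by (simp add: blk_amat[OF assms e] amat_blk[OF assms e] del: index_mult_mat)
    qed (use d f in auto)
  qed
  then show "rep_hom G \<rho> \<rho> f"
    using assms by (auto simp: rep_hom_def square_family_def verts)
qed

text \<open>Commuting with the projection to the vertex of row \<open>a\<close> kills every entry
  outside the diagonal blocks. The blocks are then cut out by \<open>pos\<close>, the inverse of the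
  numbering of basis vectors.\<close>

lemma commutant_blk:
  assumes "u \<in> commutant n gens"
  obtains f where "square_family f" "u = blk f"
proof -
  have u: "u \<in> mats n" and comm: "\<And>v. v < N \<Longrightarrow> mm n u (vmat v) = mm n (vmat v) u"
    using assms by (auto simp: commutant_def gens_def)
  define pos where "pos = (\<lambda>v i. SOME a. a < n \<and> vx a = v \<and> co a = i)"
  have pos: "pos (vx a) (co a) = a" if "a < n" for a
  proof -
    have "pos (vx a) (co a) < n \<and> vx (pos (vx a) (co a)) = vx a \<and> co (pos (vx a) (co a)) = co a"
      unfolding pos_def by (rule someI[of _ a]) (use that in simp)
    then show ?thesis using idx_inj that by blast
  qed
  define f where "f = (\<lambda>v. mat (vdim \<rho> v) (vdim \<rho> v) (\<lambda>(i, j). u (pos v i) (pos v j)))"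
  have "u a b = blk f a b" for a b
  proof (cases "a < n \<and> b < n")
    case True
    then have ab: "a < n" "b < n" by auto
    have "mm n u (vmat (vx a)) a b = mm n (vmat (vx a)) u a b"
      using comm idx_bounds[OF ab(1)] by simp
    then have "vx a \<noteq> vx b \<Longrightarrow> u a b = 0"
      by (simp add: vmat_mult[OF u] mult_vmat[OF u] split: if_splits)
    moreover have "vx a = vx b \<Longrightarrow> f (vx a) $$ (co a, co b) = u a b"
      using idx_bounds[OF ab(1)] idx_bounds[OF ab(2)] pos[OF ab(1)] pos[OF ab(2)]
      by (simp add: f_def)
    ultimately show ?thesis using ab by (auto simp: blk_def)
  next
    case False
    then show ?thesis using mats_outside[OF u] by (auto simp: blk_def)
  qed
  then have "u = blk f" by (intro ext)
  moreover have "square_family f" by (simp add: square_family_def f_def)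
  ultimately show ?thesis using that by blast
qed

text \<open>\<open>blk\<close> identifies endomorphisms, taken on the vertices, with the elements of
  the commutant and respects products, 0 and 1; hence idempotents correspond.\<close>

lemma connected_iff_trivial_idempotents:
  "mat_algebra.connected_algebra n (commutant n gens) \<longleftrightarrow> trivial_idempotents G \<rho>"
proof -
  interpret A: mat_algebra n "commutant n gens"
    by (rule mat_algebra_commutant[OF gens_mats])
  note blk_eq = blk_eqD[where f = f and g = g for f g]
  show ?thesis
  proof
    assume conn: A.connected_algebra
    show "trivial_idempotents G \<rho>"
      unfolding trivial_idempotents_def
    proof (intro allI impI, elim conjE)
      fix f assume hom: "rep_hom G \<rho> \<rho> f" and idem: "\<forall>v\<in>verts G. f v * f v = f v"
      have sq: "square_family f" using hom by (auto simp: rep_hom_def square_family_def verts)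
      have "mm n (blk f) (blk f) = blk f"
        unfolding blk_mult[OF sq sq] using idem idx_bounds by (auto simp: blk_def fun_eq_iff verts)
      then have "blk f = 0 \<or> blk f = mone n"
        using conn blk_commutant[OF sq] hom unfolding A.connected_algebra_def by blast
      then show "(\<forall>v\<in>verts G. f v = 0\<^sub>m (vdim \<rho> v) (vdim \<rho> v)) \<or> (\<forall>v\<in>verts G. f v = 1\<^sub>m (vdim \<rho> v))"
        using blk_eqD[OF sq square_zero] blk_eqD[OF sq square_one]
        by (auto simp: blk_zero blk_one verts)
    qed
  next
    assume triv: "trivial_idempotents G \<rho>"
    show A.connected_algebra
      unfolding A.connected_algebra_def
    proof (intro ballI impI)
      fix e assume e: "e \<in> commutant n gens" "mm n e e = e"
      obtain f where f: "square_family f" "e = blk f" using commutant_blk[OF e(1)] by blast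
      have sq: "square_family (\<lambda>v. f v * f v)" using f(1) by (auto simp: square_family_def)
      have "\<forall>v\<in>verts G. f v * f v = f v"
        using blk_eqD[OF sq f(1)] e(2) by (simp add: f(2) blk_mult[OF f(1) f(1)] verts)
      moreover have "rep_hom G \<rho> \<rho> f" using blk_commutant[OF f(1)] e(1) f(2) by simp
      ultimately have "(\<forall>v\<in>verts G. f v = 0\<^sub>m (vdim \<rho> v) (vdim \<rho> v)) \<or> (\<forall>v\<in>verts G. f v = 1\<^sub>m (vdim \<rho> v))"
        using triv unfolding trivial_idempotents_def by blast
      then show "e = 0 \<or> e = mone n"
      proof
        assume "\<forall>v\<in>verts G. f v = 0\<^sub>m (vdim \<rho> v) (vdim \<rho> v)"
        then have "blk f = blk (\<lambda>v. 0\<^sub>m (vdim \<rho> v) (vdim \<rho> v))"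
          using idx_bounds unfolding blk_def verts by (intro ext) simp
        then show ?thesis unfolding blk_zero f(2) by (rule disjI1)
      next
        assume "\<forall>v\<in>verts G. f v = 1\<^sub>m (vdim \<rho> v)"
        then have "blk f = blk (\<lambda>v. 1\<^sub>m (vdim \<rho> v))"
          using idx_bounds unfolding blk_def verts by (intro ext) simp
        then show ?thesis unfolding blk_one f(2) by (rule disjI2)
      qed
    qed
  qed
qed

end

section \<open>Splitting idempotent matrices\<close>

text \<open>If d > m, both factors are padded with zeros to square matrices with product 1; but the
  padded left factor has a zero column, hence determinant 0.\<close>

lemma right_inverse_dim:
  fixes A :: "'k::field mat"
  assumes A: "A \<in> carrier_mat d m" and B: "B \<in> carrier_mat m d" and AB: "A * B = 1\<^sub>m d"
  shows "d \<le> m"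
proof (rule ccontr)
  assume "\<not> d \<le> m"
  then have m: "m < d" by simp
  define A' where "A' = mat d d (\<lambda>(i, j). if j < m then A $$ (i, j) else 0)"
  define B' where "B' = mat d d (\<lambda>(i, j). if i < m then B $$ (i, j) else 0)"
  have A'c: "A' \<in> carrier_mat d d" and B'c: "B' \<in> carrier_mat d d"
    by (simp_all add: A'_def B'_def)
  have "A' * B' = 1\<^sub>m d"
  proof (rule eq_matI)
    fix i j assume "i < dim_row (1\<^sub>m d :: 'k mat)" "j < dim_col (1\<^sub>m d :: 'k mat)"
    then have ij: "i < d" "j < d" by auto
    have "(A' * B') $$ (i, j) = (\<Sum>k<d. if k < m then A $$ (i, k) * B $$ (k, j) else 0)"
      unfolding mat_mult_entry[OF A'c B'c ij] using ij
      by (intro sum.cong refl) (simp add: A'_def B'_def)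
    also have "\<dots> = (\<Sum>k<m. A $$ (i, k) * B $$ (k, j))"
      using m by (intro sum.mono_neutral_cong_right) auto
    also have "\<dots> = (1\<^sub>m d :: 'k mat) $$ (i, j)"
      unfolding mat_mult_entry[OF A B ij, symmetric] AB ..
    finally show "(A' * B') $$ (i, j) = (1\<^sub>m d :: 'k mat) $$ (i, j)" .
  qed (use A'c B'c in auto)
  then have "det A' * det B' = 1"
    using det_mult[OF A'c B'c] by simp
  moreover have "det A' = (\<Sum>i<d. A' $$ (i, m) * cofactor A' i m)"
    by (rule laplace_expansion_column[OF A'c m])
  then have "det A' = 0" using m by (simp add: A'_def)
  ultimately show False by simp
qed

text \<open>In a factorization of \<open>A\<close> over an index set of minimal size the columns of the left factor are
  linearly independent: otherwise one column could be absorbed into the others.\<close>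

lemma minimal_factorization_independent:
  fixes A :: "nat \<Rightarrow> nat \<Rightarrow> 'k::field" and S :: "nat set"
  assumes fin: "finite S" and fac: "\<And>i j. i < n \<Longrightarrow> j < n \<Longrightarrow> A i j = (\<Sum>k\<in>S. p i k * q k j)"
    and min: "\<And>(T :: nat set) p q. finite T \<Longrightarrow> card T < card S \<Longrightarrow>
      \<exists>i<n. \<exists>j<n. A i j \<noteq> (\<Sum>k\<in>T. p i k * q k j)"
    and x: "\<And>i. i < n \<Longrightarrow> (\<Sum>k\<in>S. p i k * x k) = 0" and k: "k \<in> S"
  shows "x k = 0"
proof (rule ccontr)
  assume nz: "x k \<noteq> 0"
  let ?T = "S - {k}"
  let ?q = "\<lambda>l j. q l j - x l / x k * q k j"
  have "card ?T < card S" using fin k by (intro psubset_card_mono) auto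
  moreover have "A i j = (\<Sum>l\<in>?T. p i l * ?q l j)" if "i < n" "j < n" for i j
  proof -
    have "(\<Sum>l\<in>?T. p i l * x l) + p i k * x k = 0"
      using x[OF that(1)] sum.remove[OF fin k, of "\<lambda>k. p i k * x k"] by (simp add: add.commute)
    then have pk: "(\<Sum>l\<in>?T. p i l * x l) = - (p i k * x k)"
      by (simp add: eq_neg_iff_add_eq_0)
    have "(\<Sum>l\<in>?T. p i l * ?q l j) = (\<Sum>l\<in>?T. p i l * q l j) - (\<Sum>l\<in>?T. p i l * x l) * (q k j / x k)"
      by (simp add: algebra_simps sum_subtractf sum_distrib_left sum_distrib_right)
    also have "\<dots> = (\<Sum>l\<in>?T. p i l * q l j) + p i k * q k j"
      using nz unfolding pk by (simp add: field_simps)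
    also have "\<dots> = A i j"
      using fac[OF that] sum.remove[OF fin k, of "\<lambda>l. p i l * q l j"] by (simp add: add.commute)
    finally show ?thesis by simp
  qed
  ultimately show False using min[of ?T p ?q] fin by auto
qed

text \<open>In a factorization A = P Q of minimal inner size P has independent columns and Q
  independent rows. From P (Q P - 1) Q = A^2 - A = 0 both outer factors can be cancelled, which
  gives Q P = 1.\<close>

lemma idempotent_splits:
  fixes A :: "'k::field mat"
  assumes A: "A \<in> carrier_mat n n" and idem: "A * A = A"
  obtains r P Q where "P \<in> carrier_mat n r" "Q \<in> carrier_mat r n" "P * Q = A" "Q * P = 1\<^sub>m r"
proof -
  define a where "a = (\<lambda>i j. A $$ (i, j))"
  define F where "F = (\<lambda>S :: nat set. \<lambda>p q. \<forall>i<n. \<forall>j<n. a i j = (\<Sum>k\<in>S. p i k * q k j))"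
  \<comment> \<open>A = A 1 is a factorization, so a minimal one exists.\<close>
  have "F {..<n} a (\<lambda>k j. if k = j then 1 else 0)"
    by (auto simp: F_def if_distrib[where f = "\<lambda>x. _ * x"] sum.delta cong: if_cong)
  then have ex: "\<exists>r S p q. finite S \<and> card S = r \<and> F S p q" by blast
  define r where "r = (LEAST r. \<exists>S p q. finite S \<and> card S = r \<and> F S p q)"
  obtain S p q where S: "finite S" "card S = r" "F S p q"
    using LeastI_ex[OF ex] unfolding r_def by blast
  have min: "\<not> F T p' q'" if "finite T" "card T < card S" for T p' q'
  proof
    assume "F T p' q'"
    with that(1) have "\<exists>S p q. finite S \<and> card S = card T \<and> F S p q" by blast
    then have "r \<le> card T" unfolding r_def by (rule Least_le)
    with that(2) S(2) show False by simp
  qed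
  have fac: "a i j = (\<Sum>k\<in>S. p i k * q k j)" if "i < n" "j < n" for i j
    using S(3) that by (simp add: F_def)
  have left: "x k = 0" if "\<And>i. i < n \<Longrightarrow> (\<Sum>k\<in>S. p i k * x k) = 0" "k \<in> S" for x k
    by (rule minimal_factorization_independent[OF S(1) fac _ that]) (use min in \<open>auto simp: F_def\<close>)
  \<comment> \<open>Independence of the rows of the right factor is independence of columns for the
    transposed factorization, whose minimal size is the same.\<close>
  have right: "x k = 0" if x: "\<And>j. j < n \<Longrightarrow> (\<Sum>k\<in>S. x k * q k j) = 0" and k: "k \<in> S" for x k
  proof (rule minimal_factorization_independent[OF S(1), where A = "\<lambda>i j. a j i" and p = "\<lambda>i k. q k i"
        and q = "\<lambda>k j. p j k"])
    show "\<exists>i<n. \<exists>j<n. a j i \<noteq> (\<Sum>k\<in>T. p' i k * q' k j)"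
      if T: "finite T" "card T < card S" for T and p' q' :: "nat \<Rightarrow> nat \<Rightarrow> 'k"
      using min[OF T, of "\<lambda>i k. q' k i" "\<lambda>k j. p' j k"] by (auto simp: F_def mult.commute)
  qed (use fac x k in \<open>auto simp: mult.commute\<close>)
  \<comment> \<open>The matrix Q P - 1, indexed by \<open>S\<close>.\<close>
  define M where "M = (\<lambda>k l. (\<Sum>m<n. q k m * p m l) - (if k = l then 1 else 0))"
  have aa: "(\<Sum>m<n. a i m * a m j) = a i j" if "i < n" "j < n" for i j
    using mat_mult_entry[OF A A that] idem by (simp add: a_def)
  have pMq: "(\<Sum>k\<in>S. p i k * (\<Sum>l\<in>S. M k l * q l j)) = 0" if ij: "i < n" "j < n" for i j
  proof -
    have "(\<Sum>l\<in>S. (if k = l then 1 else 0) * q l j) = q k j" if "k \<in> S" for k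
      using that S(1) by (simp add: if_distrib[where f = "\<lambda>x. x * _"] sum.delta cong: if_cong)
    then have "(\<Sum>k\<in>S. p i k * (\<Sum>l\<in>S. M k l * q l j)) =
        (\<Sum>k\<in>S. p i k * (\<Sum>l\<in>S. (\<Sum>m<n. q k m * p m l) * q l j)) - (\<Sum>k\<in>S. p i k * q k j)"
      by (simp add: M_def left_diff_distrib right_diff_distrib sum_subtractf)
    also have "(\<Sum>k\<in>S. p i k * (\<Sum>l\<in>S. (\<Sum>m<n. q k m * p m l) * q l j)) =
        (\<Sum>k\<in>S. \<Sum>l\<in>S. \<Sum>m<n. (p i k * q k m) * (p m l * q l j))"
      by (simp add: sum_distrib_left sum_distrib_right mult.assoc)
    also have "\<dots> = (\<Sum>k\<in>S. \<Sum>m<n. \<Sum>l\<in>S. (p i k * q k m) * (p m l * q l j))"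
      by (intro sum.cong refl sum.swap)
    also have "\<dots> = (\<Sum>m<n. \<Sum>k\<in>S. \<Sum>l\<in>S. (p i k * q k m) * (p m l * q l j))"
      by (rule sum.swap)
    also have "\<dots> = (\<Sum>m<n. a i m * a m j)"
      using ij fac by (simp add: sum_product)
    finally show ?thesis using aa[OF ij] fac[OF ij] by simp
  qed
  have "M k l = 0" if "k \<in> S" "l \<in> S" for k l
  proof -
    have "(\<Sum>l\<in>S. M k l * q l j) = 0" if "j < n" for j
      using left[of "\<lambda>k. \<Sum>l\<in>S. M k l * q l j" k] pMq that \<open>k \<in> S\<close> by blast
    then show ?thesis using right[of "M k" l] that by blast
  qed
  then have qp: "(\<Sum>m<n. q k m * p m l) = (if k = l then 1 else 0)" if "k \<in> S" "l \<in> S" for k l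
    using that by (simp add: M_def)
  obtain h where h: "bij_betw h {..<r} S"
    using S(1,2) by (metis bij_betw_from_nat_into_finite ex_bij_betw_nat_finite atLeast0LessThan)
  define P where "P = mat n r (\<lambda>(i, k). p i (h k))"
  define Q where "Q = mat r n (\<lambda>(k, j). q (h k) j)"
  have c: "P \<in> carrier_mat n r" "Q \<in> carrier_mat r n" by (simp_all add: P_def Q_def)
  have hS: "h k \<in> S" if "k < r" for k using h that by (auto simp: bij_betw_def)
  have hinj: "h k = h l \<longleftrightarrow> k = l" if "k < r" "l < r" for k l
    using h that by (auto simp: bij_betw_def inj_on_def)
  have "P * Q = A"
  proof (rule eq_matI)
    fix i j assume "i < dim_row A" "j < dim_col A"
    then have ij: "i < n" "j < n" using A by auto
    have "(P * Q) $$ (i, j) = (\<Sum>k<r. p i (h k) * q (h k) j)"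
      unfolding mat_mult_entry[OF c ij] using ij by (intro sum.cong refl) (simp add: P_def Q_def)
    also have "\<dots> = (\<Sum>k\<in>S. p i k * q k j)"
      by (rule sum.reindex_bij_betw[OF h])
    finally show "(P * Q) $$ (i, j) = A $$ (i, j)" using fac[OF ij] by (simp add: a_def)
  qed (use A c in auto)
  moreover have "Q * P = 1\<^sub>m r"
  proof (rule eq_matI)
    fix k l assume "k < dim_row (1\<^sub>m r :: 'k mat)" "l < dim_col (1\<^sub>m r :: 'k mat)"
    then have kl: "k < r" "l < r" by auto
    have "(Q * P) $$ (k, l) = (\<Sum>m<n. q (h k) m * p m (h l))"
      unfolding mat_mult_entry[OF c(2,1) kl] using kl by (intro sum.cong refl) (simp add: P_def Q_def)
    then show "(Q * P) $$ (k, l) = (1\<^sub>m r :: 'k mat) $$ (k, l)"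
      using qp[OF hS hS] hinj kl by simp
  qed (use c in auto)
  ultimately show ?thesis using that c by blast
qed

section \<open>Idempotent endomorphisms and decompositions\<close>

text \<open>The idempotent P Q at the tail can be moved across the arc to the head, where
  \<open>Q'\<close> absorbs it. So the maps \<open>Q\<close> commute with the arcs when the summand
  carries the arc maps Q' E P.\<close>

lemma absorb_arc:
  fixes E :: "'k::field mat"
  assumes "P \<in> carrier_mat t r" "Q \<in> carrier_mat r t" "Q' \<in> carrier_mat r' s" "f \<in> carrier_mat s s"
    "g \<in> carrier_mat t t" "E \<in> carrier_mat s t"
    and "P * Q = g" "Q' * f = Q'" "f * E = E * g"
  shows "Q' * E * P * Q = Q' * E"
proof -
  have "Q' * E * P * Q = Q' * E * (P * Q)"
    by (rule assoc_mult_mat[of _ r' t _ r _ t]) (use assms in \<open>auto intro: mult_carrier_mat\<close>)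
  also have "\<dots> = Q' * (E * g)"
    unfolding assms(7) by (rule assoc_mult_mat[of _ r' s _ t _ t]) (use assms in auto)
  also have "\<dots> = Q' * f * E"
    unfolding assms(9)[symmetric] by (rule assoc_mult_mat[of _ r' s _ s _ t, symmetric]) (use assms in auto)
  finally show ?thesis by (simp only: assms(8))
qed

lemma idempotent_family_splits:
  fixes A :: "'v \<Rightarrow> 'k::field mat"
  assumes A: "\<forall>v\<in>V. A v \<in> carrier_mat (d v) (d v)" and idem: "\<forall>v\<in>V. A v * A v = A v"
  shows "\<exists>r P Q. \<forall>v\<in>V. P v \<in> carrier_mat (d v) (r v) \<and> Q v \<in> carrier_mat (r v) (d v) \<and>
    P v * Q v = A v \<and> Q v * P v = 1\<^sub>m (r v) \<and> Q v * A v = Q v \<and> A v * P v = P v"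
proof -
  have "\<forall>v\<in>V. \<exists>r P Q. P \<in> carrier_mat (d v) r \<and> Q \<in> carrier_mat r (d v) \<and> P * Q = A v \<and> Q * P = 1\<^sub>m r"
  proof
    fix v assume v: "v \<in> V"
    show "\<exists>r P Q. P \<in> carrier_mat (d v) r \<and> Q \<in> carrier_mat r (d v) \<and> P * Q = A v \<and> Q * P = 1\<^sub>m r"
      using idempotent_splits[OF bspec[OF A v] bspec[OF idem v]] by metis
  qed
  then obtain r P Q where PQ: "\<And>v. v \<in> V \<Longrightarrow> P v \<in> carrier_mat (d v) (r v)"
    "\<And>v. v \<in> V \<Longrightarrow> Q v \<in> carrier_mat (r v) (d v)"
    "\<And>v. v \<in> V \<Longrightarrow> P v * Q v = A v" "\<And>v. v \<in> V \<Longrightarrow> Q v * P v = 1\<^sub>m (r v)"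
    by metis
  have "Q v * A v = Q v" "A v * P v = P v" if v: "v \<in> V" for v
    using assoc_mult_mat[OF PQ(2)[OF v] PQ(1)[OF v] PQ(2)[OF v]]
      assoc_mult_mat[OF PQ(1)[OF v] PQ(2)[OF v] PQ(1)[OF v]] PQ[OF v] by simp_all
  with PQ show ?thesis by (intro exI[of _ r] exI[of _ P] exI[of _ Q]) simp
qed

lemma orthogonal_factors:
  fixes f :: "'k::field mat"
  assumes c: "Q \<in> carrier_mat r d" "f \<in> carrier_mat d d" "g \<in> carrier_mat d d" "P \<in> carrier_mat d r'"
    and "Q * f = Q" "g * P = P" "f * g = 0\<^sub>m d d"
  shows "Q * P = 0\<^sub>m r r'"
proof -
  have "Q * P = (Q * f) * (g * P)" by (simp only: assms(5,6))
  also have "\<dots> = Q * (f * (g * P))"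
    by (rule assoc_mult_mat[OF c(1,2) mult_carrier_mat[OF c(3,4)]])
  also have "f * (g * P) = f * g * P"
    by (rule assoc_mult_mat[OF c(2,3,4), symmetric])
  finally show ?thesis
    by (simp only: assms(7) left_mult_zero_mat[OF c(4)] right_mult_zero_mat[OF c(1)])
qed

text \<open>A nontrivial idempotent f decomposes the representation into the images of f and 1 - f.
  Splitting both at every vertex supplies coordinates on the images, and stacking the two coordinate
  maps gives the isomorphism.\<close>

lemma idempotents_if_indecomposable:
  assumes wf: "wf_digraph G" and rep: "quiver_rep G \<rho>" and indec: "indecomposable G \<rho>"
  shows "trivial_idempotents G \<rho>"
  unfolding trivial_idempotents_def
proof (intro allI impI, elim conjE, rule ccontr)
  fix f assume hom: "rep_hom G \<rho> \<rho> f" and idem: "\<forall>v\<in>verts G. f v * f v = f v"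
    and nontriv: "\<not> ((\<forall>v\<in>verts G. f v = 0\<^sub>m (vdim \<rho> v) (vdim \<rho> v)) \<or> (\<forall>v\<in>verts G. f v = 1\<^sub>m (vdim \<rho> v)))"
  let ?d = "vdim \<rho>"
  have f: "f v \<in> carrier_mat (?d v) (?d v)" if "v \<in> verts G" for v
    using hom that by (simp add: rep_hom_def)
  have "\<forall>v\<in>verts G. f v \<in> carrier_mat (?d v) (?d v)" using f by blast
  from idempotent_family_splits[OF this idem]
  obtain r P Q where "\<forall>v\<in>verts G. P v \<in> carrier_mat (?d v) (r v) \<and> Q v \<in> carrier_mat (r v) (?d v) \<and>
      P v * Q v = f v \<and> Q v * P v = 1\<^sub>m (r v) \<and> Q v * f v = Q v \<and> f v * P v = P v"
    by (elim exE)
  then have PQ: "\<And>v. v \<in> verts G \<Longrightarrow> P v \<in> carrier_mat (?d v) (r v)"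
    "\<And>v. v \<in> verts G \<Longrightarrow> Q v \<in> carrier_mat (r v) (?d v)"
    "\<And>v. v \<in> verts G \<Longrightarrow> P v * Q v = f v" "\<And>v. v \<in> verts G \<Longrightarrow> Q v * P v = 1\<^sub>m (r v)"
    and Qf: "\<And>v. v \<in> verts G \<Longrightarrow> Q v * f v = Q v" and fP: "\<And>v. v \<in> verts G \<Longrightarrow> f v * P v = P v"
    by simp_all
  define f' where "f' = (\<lambda>v. 1\<^sub>m (?d v) - f v)"
  have f': "f' v \<in> carrier_mat (?d v) (?d v)" if "v \<in> verts G" for v
    unfolding f'_def by (rule minus_carrier_mat[OF f[OF that]])
  have f0: "f v * f' v = 0\<^sub>m (?d v) (?d v)" "f' v * f v = 0\<^sub>m (?d v) (?d v)" if v: "v \<in> verts G" for v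
  proof -
    have "f v * f' v = f v * 1\<^sub>m (?d v) - f v * f v"
      unfolding f'_def by (rule mult_minus_distrib_mat[OF f[OF v] _ f[OF v]]) simp
    then show "f v * f' v = 0\<^sub>m (?d v) (?d v)"
      using f[OF v] idem v by simp
    have "f' v * f v = 1\<^sub>m (?d v) * f v - f v * f v"
      unfolding f'_def by (rule minus_mult_distrib_mat[OF _ f[OF v] f[OF v]]) simp
    then show "f' v * f v = 0\<^sub>m (?d v) (?d v)"
      using f[OF v] idem v by simp
  qed
  have idem': "f' v * f' v = f' v" if v: "v \<in> verts G" for v
  proof -
    have "f' v * f' v = f' v * 1\<^sub>m (?d v) - f' v * f v"
      using mult_minus_distrib_mat[OF f'[OF v] one_carrier_mat f[OF v]] by (simp only: f'_def)
    then show ?thesis using f'[OF v] by (simp add: f0[OF v]) (intro eq_matI, auto)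
  qed
  have "\<forall>v\<in>verts G. f' v \<in> carrier_mat (?d v) (?d v)" "\<forall>v\<in>verts G. f' v * f' v = f' v"
    using f' idem' by blast+
  from idempotent_family_splits[OF this]
  obtain r' P' Q' where "\<forall>v\<in>verts G. P' v \<in> carrier_mat (?d v) (r' v) \<and> Q' v \<in> carrier_mat (r' v) (?d v) \<and>
      P' v * Q' v = f' v \<and> Q' v * P' v = 1\<^sub>m (r' v) \<and> Q' v * f' v = Q' v \<and> f' v * P' v = P' v"
    by (elim exE)
  then have PQ': "\<And>v. v \<in> verts G \<Longrightarrow> P' v \<in> carrier_mat (?d v) (r' v)"
    "\<And>v. v \<in> verts G \<Longrightarrow> Q' v \<in> carrier_mat (r' v) (?d v)"
    "\<And>v. v \<in> verts G \<Longrightarrow> P' v * Q' v = f' v" "\<And>v. v \<in> verts G \<Longrightarrow> Q' v * P' v = 1\<^sub>m (r' v)"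
    and Qf': "\<And>v. v \<in> verts G \<Longrightarrow> Q' v * f' v = Q' v" and fP': "\<And>v. v \<in> verts G \<Longrightarrow> f' v * P' v = P' v"
    by simp_all
  have QP': "Q v * P' v = 0\<^sub>m (r v) (r' v)" and Q'P: "Q' v * P v = 0\<^sub>m (r' v) (r v)" if v: "v \<in> verts G" for v
    using orthogonal_factors[OF PQ(2)[OF v] f[OF v] f'[OF v] PQ'(1)[OF v] Qf[OF v] fP'[OF v] f0(1)[OF v]]
      orthogonal_factors[OF PQ'(2)[OF v] f'[OF v] f[OF v] PQ(1)[OF v] Qf'[OF v] fP[OF v] f0(2)[OF v]] .
  \<comment> \<open>The image of f as a representation: \<open>P\<close> embeds its coordinate space
    and \<open>Q\<close> projects onto it.\<close>
  define \<sigma> where "\<sigma> = (\<lparr>vdim = r, emat = (\<lambda>e. Q (head G e) * emat \<rho> e * P (tail G e))\<rparr> :: ('a, 'b, 'c) rep)"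
  define \<tau> where "\<tau> = (\<lparr>vdim = r', emat = (\<lambda>e. Q' (head G e) * emat \<rho> e * P' (tail G e))\<rparr> :: ('a, 'b, 'c) rep)"
  have arc: "head G e \<in> verts G" "tail G e \<in> verts G" "emat \<rho> e \<in> carrier_mat (?d (head G e)) (?d (tail G e))"
    if "e \<in> arcs G" for e
    using that rep wf_digraph.head_in_verts[OF wf] wf_digraph.tail_in_verts[OF wf]
    by (auto simp: quiver_rep_def)
  have "quiver_rep G \<sigma>" "quiver_rep G \<tau>"
    
    unfolding quiver_rep_def \<sigma>_def \<tau>_def rep.simps
    using mult_carrier_mat[OF mult_carrier_mat[OF PQ(2)[OF arc(1)] arc(3)] PQ(1)[OF arc(2)]]
      mult_carrier_mat[OF mult_carrier_mat[OF PQ'(2)[OF arc(1)] arc(3)] PQ'(1)[OF arc(2)]] by blast+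
  moreover have "\<not> zero_rep G \<sigma>"
  proof
    assume z: "zero_rep G \<sigma>"
    have 0: "f v = 0\<^sub>m (?d v) (?d v)" if v: "v \<in> verts G" for v
    proof -
      have "r v = 0" using z v by (simp add: zero_rep_def \<sigma>_def)
      then have "P v * Q v = 0\<^sub>m (?d v) (?d v)"
        using PQ(1,2)[OF v] by (intro eq_matI) (auto simp: scalar_prod_def)
      then show ?thesis using PQ(3)[OF v] by simp
    qed
    with nontriv show False by blast
  qed
  moreover have "\<not> zero_rep G \<tau>"
  proof
    assume z: "zero_rep G \<tau>"
    have 1: "f v = 1\<^sub>m (?d v)" if v: "v \<in> verts G" for v
    proof -
      have "r' v = 0" using z v by (simp add: zero_rep_def \<tau>_def)
      then have "P' v * Q' v = 0\<^sub>m (?d v) (?d v)"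
        using PQ'(1,2)[OF v] by (intro eq_matI) (auto simp: scalar_prod_def)
      then have z: "1\<^sub>m (?d v) - f v = 0\<^sub>m (?d v) (?d v)" using PQ'(3)[OF v] by (simp add: f'_def)
      show ?thesis
      proof (rule eq_matI)
        fix i j assume "i < dim_row (1\<^sub>m (?d v) :: 'c mat)" "j < dim_col (1\<^sub>m (?d v) :: 'c mat)"
        then show "f v $$ (i, j) = (1\<^sub>m (?d v) :: 'c mat) $$ (i, j)"
          using arg_cong[OF z, of "\<lambda>A. A $$ (i, j)"] f[OF v] by auto
      qed (use f[OF v] in auto)
    qed
    with nontriv show False by blast
  qed
  moreover have "rep_isomorphic G \<rho> (direct_sum \<sigma> \<tau>)"
    unfolding rep_isomorphic_def
  proof (intro exI conjI ballI)
    \<comment> \<open>A block column and a block row, written with empty second column or row so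
      that the multiplication rule for four blocks applies.\<close>
    let ?g = "\<lambda>v. four_block_mat (Q v) (0\<^sub>m (r v) 0) (Q' v) (0\<^sub>m (r' v) 0)"
    let ?h = "\<lambda>v. four_block_mat (P v) (P' v) (0\<^sub>m 0 (r v)) (0\<^sub>m 0 (r' v))"
    have g: "?g v \<in> carrier_mat (r v + r' v) (?d v)" and h: "?h v \<in> carrier_mat (?d v) (r v + r' v)"
      if v: "v \<in> verts G" for v
      using PQ(1,2)[OF v] PQ'(1,2)[OF v] by auto
    have gh: "?g v * ?h v = 1\<^sub>m (r v + r' v)" if v: "v \<in> verts G" for v
    proof -
      note c = PQ(1,2)[OF v] PQ'(1,2)[OF v]
      have "?g v * ?h v = four_block_mat (Q v * P v + 0\<^sub>m (r v) 0 * 0\<^sub>m 0 (r v)) (Q v * P' v + 0\<^sub>m (r v) 0 * 0\<^sub>m 0 (r' v))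
          (Q' v * P v + 0\<^sub>m (r' v) 0 * 0\<^sub>m 0 (r v)) (Q' v * P' v + 0\<^sub>m (r' v) 0 * 0\<^sub>m 0 (r' v))"
        by (rule mult_four_block_mat) (use c in auto)
      also have "\<dots> = four_block_mat (1\<^sub>m (r v)) (0\<^sub>m (r v) (r' v)) (0\<^sub>m (r' v) (r v)) (1\<^sub>m (r' v))"
        by (simp add: PQ(4)[OF v] PQ'(4)[OF v] QP'[OF v] Q'P[OF v])
      finally show ?thesis by simp
    qed
    have hg: "?h v * ?g v = 1\<^sub>m (?d v)" if v: "v \<in> verts G" for v
    proof -
      note c = PQ(1,2)[OF v] PQ'(1,2)[OF v]
      have "?h v * ?g v = four_block_mat (P v * Q v + P' v * Q' v) (P v * 0\<^sub>m (r v) 0 + P' v * 0\<^sub>m (r' v) 0)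
          (0\<^sub>m 0 (r v) * Q v + 0\<^sub>m 0 (r' v) * Q' v) (0\<^sub>m 0 (r v) * 0\<^sub>m (r v) 0 + 0\<^sub>m 0 (r' v) * 0\<^sub>m (r' v) 0)"
        by (rule mult_four_block_mat) (use c in auto)
      also have "P v * Q v + P' v * Q' v = 1\<^sub>m (?d v)"
        unfolding PQ(3)[OF v] PQ'(3)[OF v] f'_def using f[OF v] by (intro eq_matI) auto
      also have "four_block_mat (1\<^sub>m (?d v)) (P v * 0\<^sub>m (r v) 0 + P' v * 0\<^sub>m (r' v) 0)
          (0\<^sub>m 0 (r v) * Q v + 0\<^sub>m 0 (r' v) * Q' v) (0\<^sub>m 0 (r v) * 0\<^sub>m (r v) 0 + 0\<^sub>m 0 (r' v) * 0\<^sub>m (r' v) 0) = 1\<^sub>m (?d v)"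
        using c by (intro eq_matI) auto
      finally show ?thesis .
    qed
    show "rep_hom G \<rho> (direct_sum \<sigma> \<tau>) ?g"
      unfolding rep_hom_def
    proof (intro conjI ballI)
      fix v assume "v \<in> verts G"
      then show "?g v \<in> carrier_mat (vdim (direct_sum \<sigma> \<tau>) v) (vdim \<rho> v)"
        using g by (simp add: direct_sum_def \<sigma>_def \<tau>_def)
    next
      fix e assume e: "e \<in> arcs G"
      let ?s = "head G e" and ?t = "tail G e" and ?E = "emat \<rho> e"
      note a = arc[OF e]
      note c = PQ(1,2)[OF a(1)] PQ'(1,2)[OF a(1)] PQ(1,2)[OF a(2)] PQ'(1,2)[OF a(2)] f[OF a(1)] f[OF a(2)] a(3)
      have comm: "f ?s * ?E = ?E * f ?t" using hom e by (simp add: rep_hom_def)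
      have E1: "Q ?s * ?E * P ?t * Q ?t = Q ?s * ?E"
        by (rule absorb_arc[OF PQ(1,2)[OF a(2)] PQ(2)[OF a(1)] f[OF a(1)] f[OF a(2)] a(3) PQ(3)[OF a(2)] Qf[OF a(1)] comm])
      have comm': "f' ?s * ?E = ?E * f' ?t"
      proof -
        have "f' ?s * ?E = 1\<^sub>m (?d ?s) * ?E - f ?s * ?E"
          unfolding f'_def by (rule minus_mult_distrib_mat[OF _ f[OF a(1)] a(3)]) simp
        also have "\<dots> = ?E * 1\<^sub>m (?d ?t) - ?E * f ?t"
          using c by (simp add: comm)
        also have "\<dots> = ?E * f' ?t"
          unfolding f'_def by (rule mult_minus_distrib_mat[OF a(3) _ f[OF a(2)], symmetric]) simp
        finally show ?thesis .
      qed
      have E2: "Q' ?s * ?E * P' ?t * Q' ?t = Q' ?s * ?E"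
        by (rule absorb_arc[OF PQ'(1,2)[OF a(2)] PQ'(2)[OF a(1)] f'[OF a(1)] f'[OF a(2)] a(3) PQ'(3)[OF a(2)] Qf'[OF a(1)] comm'])
      have "?E = four_block_mat ?E (0\<^sub>m (?d ?s) 0) (0\<^sub>m 0 (?d ?t)) (0\<^sub>m 0 0)"
        using c by (intro eq_matI) auto
      then have "?g ?s * ?E = ?g ?s * four_block_mat ?E (0\<^sub>m (?d ?s) 0) (0\<^sub>m 0 (?d ?t)) (0\<^sub>m 0 0)"
        by simp
      also have "\<dots> = four_block_mat (Q ?s * ?E + 0\<^sub>m (r ?s) 0 * 0\<^sub>m 0 (?d ?t)) (Q ?s * 0\<^sub>m (?d ?s) 0 + 0\<^sub>m (r ?s) 0 * 0\<^sub>m 0 0)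
          (Q' ?s * ?E + 0\<^sub>m (r' ?s) 0 * 0\<^sub>m 0 (?d ?t)) (Q' ?s * 0\<^sub>m (?d ?s) 0 + 0\<^sub>m (r' ?s) 0 * 0\<^sub>m 0 0)"
        by (rule mult_four_block_mat) (use c in auto)
      also have "\<dots> = four_block_mat (Q ?s * ?E) (0\<^sub>m (r ?s) 0) (Q' ?s * ?E) (0\<^sub>m (r' ?s) 0)"
        using c by (intro arg_cong4[where f = four_block_mat]) (auto intro!: eq_matI simp: scalar_prod_def)
      finally have lhs: "?g ?s * ?E = four_block_mat (Q ?s * ?E) (0\<^sub>m (r ?s) 0) (Q' ?s * ?E) (0\<^sub>m (r' ?s) 0)" .
      let ?A = "Q ?s * ?E * P ?t" and ?B = "Q' ?s * ?E * P' ?t"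
      have "emat (direct_sum \<sigma> \<tau>) e * ?g ?t = four_block_mat ?A (0\<^sub>m (r ?s) (r' ?t)) (0\<^sub>m (r' ?s) (r ?t)) ?B * ?g ?t"
        using c by (simp add: direct_sum_def \<sigma>_def \<tau>_def)
      also have "\<dots> = four_block_mat (?A * Q ?t + 0\<^sub>m (r ?s) (r' ?t) * Q' ?t) (?A * 0\<^sub>m (r ?t) 0 + 0\<^sub>m (r ?s) (r' ?t) * 0\<^sub>m (r' ?t) 0)
          (0\<^sub>m (r' ?s) (r ?t) * Q ?t + ?B * Q' ?t) (0\<^sub>m (r' ?s) (r ?t) * 0\<^sub>m (r ?t) 0 + ?B * 0\<^sub>m (r' ?t) 0)"
        by (rule mult_four_block_mat) (use c in auto)
      also have "\<dots> = four_block_mat (Q ?s * ?E) (0\<^sub>m (r ?s) 0) (Q' ?s * ?E) (0\<^sub>m (r' ?s) 0)"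
        unfolding E1 E2
        using c by (intro arg_cong4[where f = four_block_mat]) (auto intro!: eq_matI simp: scalar_prod_def)
      finally show "?g ?s * ?E = emat (direct_sum \<sigma> \<tau>) e * ?g ?t" using lhs by simp
    qed
    fix v assume v: "v \<in> verts G"
    \<comment> \<open>\<open>invertible_mat\<close> demands a square matrix; the equations in both
      directions force equal dimensions.\<close>
    have "r v + r' v = ?d v"
      using right_inverse_dim[OF g[OF v] h[OF v] gh[OF v]] right_inverse_dim[OF h[OF v] g[OF v] hg[OF v]] by simp
    then have dims: "dim_row (?g v) = r v + r' v" "dim_col (?g v) = r v + r' v" "dim_row (?h v) = ?d v"
      using carrier_matD[OF g[OF v]] carrier_matD[OF h[OF v]] by simp_all
    have "?g v * ?h v = 1\<^sub>m (dim_row (?g v))" unfolding dims by (rule gh[OF v])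
    moreover have "?h v * ?g v = 1\<^sub>m (dim_row (?h v))" unfolding dims by (rule hg[OF v])
    moreover have "dim_col (?g v) = dim_row (?g v)" unfolding dims by (rule refl)
    ultimately show "invertible_mat (?g v)"
      unfolding invertible_mat_def inverts_mat_def square_mat.simps by blast
  qed
  ultimately show False using indec unfolding indecomposable_def by blast
qed

text \<open>The projection D to the first summand is carried back along the isomorphism f to the
  idempotent endomorphism f^-1 D f; if this is 0 or 1 everywhere, then so is D, and one summand is
  zero.\<close>

lemma indecomposable_if_idempotents:
  assumes wf: "wf_digraph G" and rep: "quiver_rep G \<rho>" and triv: "trivial_idempotents G \<rho>"
  shows "indecomposable G \<rho>"
  unfolding indecomposable_def
proof (intro notI, elim exE conjE)
  fix \<sigma> \<tau> assume st: "quiver_rep G \<sigma>" "quiver_rep G \<tau>" "\<not> zero_rep G \<sigma>" "\<not> zero_rep G \<tau>"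
    "rep_isomorphic G \<rho> (direct_sum \<sigma> \<tau>)"
  let ?d = "vdim \<rho>" and ?r = "vdim \<sigma>" and ?r' = "vdim \<tau>"
  obtain f where hom: "rep_hom G \<rho> (direct_sum \<sigma> \<tau>) f" and inv: "\<And>v. v \<in> verts G \<Longrightarrow> invertible_mat (f v)"
    using st(5) unfolding rep_isomorphic_def by blast
  have f: "f v \<in> carrier_mat (?r v + ?r' v) (?d v)" if "v \<in> verts G" for v
    using hom that by (simp add: rep_hom_def direct_sum_def)
  have "\<exists>B. B \<in> carrier_mat (?d v) (?r v + ?r' v) \<and> f v * B = 1\<^sub>m (?r v + ?r' v) \<and> B * f v = 1\<^sub>m (?d v)"
    if v: "v \<in> verts G" for v
  proof -
    obtain B where B: "f v * B = 1\<^sub>m (dim_row (f v))" "B * f v = 1\<^sub>m (dim_row B)"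
      using inv[OF v] unfolding invertible_mat_def inverts_mat_def by blast
    have "dim_col B = ?r v + ?r' v" using arg_cong[OF B(1), of dim_col] f[OF v] by simp
    moreover have "dim_row B = ?d v" using arg_cong[OF B(2), of dim_col] f[OF v] by simp
    ultimately show ?thesis using B f[OF v] by (intro exI[of _ B]) auto
  qed
  then obtain B where B: "\<And>v. v \<in> verts G \<Longrightarrow> B v \<in> carrier_mat (?d v) (?r v + ?r' v)"
    "\<And>v. v \<in> verts G \<Longrightarrow> f v * B v = 1\<^sub>m (?r v + ?r' v)" "\<And>v. v \<in> verts G \<Longrightarrow> B v * f v = 1\<^sub>m (?d v)"
    by metis
  define D where "D = (\<lambda>v. four_block_mat (1\<^sub>m (?r v)) (0\<^sub>m (?r v) (?r' v)) (0\<^sub>m (?r' v) (?r v)) (0\<^sub>m (?r' v) (?r' v)) :: 'c mat)"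
  have D: "D v \<in> carrier_mat (?r v + ?r' v) (?r v + ?r' v)" for v by (simp add: D_def)
  have DD: "D v * D v = D v" for v
    unfolding D_def
    by (subst mult_four_block_mat[of _ "?r v" "?r v" _ "?r' v" _ "?r' v" _ _ "?r v" _ "?r' v"]) auto
  define e where "e = (\<lambda>v. B v * (D v * f v))"
  have e: "e v \<in> carrier_mat (?d v) (?d v)" if "v \<in> verts G" for v
    unfolding e_def
    by (rule mult_carrier_mat[OF B(1)[OF that] mult_carrier_mat[OF D f[OF that]]])
  have feB: "f v * e v * B v = D v" if v: "v \<in> verts G" for v
  proof -
    note c = f[OF v] B(1)[OF v] D[of v]
    have "f v * e v = (f v * B v) * (D v * f v)"
      unfolding e_def by (rule assoc_mult_mat[symmetric]) (use c in \<open>auto intro: mult_carrier_mat\<close>)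
    then have "f v * e v = D v * f v" using c by (simp add: B(2)[OF v])
    then have "f v * e v * B v = D v * (f v * B v)"
      using c by (simp add: assoc_mult_mat[of _ "?r v + ?r' v" "?r v + ?r' v" _ "?d v" _ "?r v + ?r' v"])
    then show ?thesis using c by (simp add: B(2)[OF v])
  qed
  have idem: "e v * e v = e v" if v: "v \<in> verts G" for v
  proof -
    note c = f[OF v] B(1)[OF v] D[of v]
    have "e v * e v = B v * ((D v * f v) * (B v * (D v * f v)))"
      unfolding e_def by (rule assoc_mult_mat) (use c in \<open>auto intro: mult_carrier_mat\<close>)
    also have "(D v * f v) * (B v * (D v * f v)) = D v * (f v * (B v * (D v * f v)))"
      by (rule assoc_mult_mat) (use c in \<open>auto intro: mult_carrier_mat\<close>)
    also have "f v * (B v * (D v * f v)) = (f v * B v) * (D v * f v)"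
      by (rule assoc_mult_mat[symmetric]) (use c in \<open>auto intro: mult_carrier_mat\<close>)
    also have "\<dots> = D v * f v" using c by (simp add: B(2)[OF v])
    also have "D v * (D v * f v) = D v * D v * f v"
      by (rule assoc_mult_mat[symmetric]) (use c in \<open>auto intro: mult_carrier_mat\<close>)
    finally show ?thesis by (simp add: DD e_def)
  qed
  have "rep_hom G \<rho> \<rho> e"
    unfolding rep_hom_def
  proof (intro conjI ballI)
    fix a assume a: "a \<in> arcs G"
    let ?s = "head G a" and ?t = "tail G a" and ?E = "emat \<rho> a" and ?F = "emat (direct_sum \<sigma> \<tau>) a"
    have st': "?s \<in> verts G" "?t \<in> verts G"
      using a wf_digraph.head_in_verts[OF wf] wf_digraph.tail_in_verts[OF wf] by auto
    have E: "?E \<in> carrier_mat (?d ?s) (?d ?t)" and S: "emat \<sigma> a \<in> carrier_mat (?r ?s) (?r ?t)"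
      and T: "emat \<tau> a \<in> carrier_mat (?r' ?s) (?r' ?t)"
      using a rep st by (auto simp: quiver_rep_def)
    have F: "?F \<in> carrier_mat (?r ?s + ?r' ?s) (?r ?t + ?r' ?t)"
      and Feq: "?F = four_block_mat (emat \<sigma> a) (0\<^sub>m (?r ?s) (?r' ?t)) (0\<^sub>m (?r' ?s) (?r ?t)) (emat \<tau> a)"
      using S T by (auto simp: direct_sum_def)
    note c = f[OF st'(1)] f[OF st'(2)] B(1)[OF st'(1)] B(1)[OF st'(2)] D[of ?s] D[of ?t] E F
    have comm: "f ?s * ?E = ?F * f ?t" using hom a by (simp add: rep_hom_def)
    have DF: "D ?s * ?F = ?F * D ?t"
    proof -
      have "D ?s * ?F = four_block_mat (emat \<sigma> a) (0\<^sub>m (?r ?s) (?r' ?t)) (0\<^sub>m (?r' ?s) (?r ?t)) (0\<^sub>m (?r' ?s) (?r' ?t))"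
        unfolding D_def Feq
        by (subst mult_four_block_mat[of _ "?r ?s" "?r ?s" _ "?r' ?s" _ "?r' ?s" _ _ "?r ?t" _ "?r' ?t"]) (use S T in auto)
      moreover have "?F * D ?t = four_block_mat (emat \<sigma> a) (0\<^sub>m (?r ?s) (?r' ?t)) (0\<^sub>m (?r' ?s) (?r ?t)) (0\<^sub>m (?r' ?s) (?r' ?t))"
        unfolding D_def Feq
        by (subst mult_four_block_mat[of _ "?r ?s" "?r ?t" _ "?r' ?t" _ "?r' ?s" _ _ "?r ?t" _ "?r' ?t"]) (use S T in auto)
      ultimately show ?thesis by simp
    qed
    \<comment> \<open>The inverse of the isomorphism is a homomorphism too.\<close>
    have EB: "?E * B ?t = B ?s * ?F"
    proof -
      have "B ?s * ?F = B ?s * (?F * (f ?t * B ?t))" using c by (simp add: B(2)[OF st'(2)])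
      also have "?F * (f ?t * B ?t) = ?F * f ?t * B ?t"
        by (rule assoc_mult_mat[symmetric]) (use c in \<open>auto intro: mult_carrier_mat\<close>)
      also have "\<dots> = f ?s * (?E * B ?t)"
        unfolding comm[symmetric] by (rule assoc_mult_mat) (use c in \<open>auto intro: mult_carrier_mat\<close>)
      also have "B ?s * (f ?s * (?E * B ?t)) = B ?s * f ?s * (?E * B ?t)"
        by (rule assoc_mult_mat[symmetric]) (use c in \<open>auto intro: mult_carrier_mat\<close>)
      also have "\<dots> = ?E * B ?t" using c by (simp add: B(3)[OF st'(1)])
      finally show ?thesis by simp
    qed
    have "e ?s * ?E = B ?s * (D ?s * f ?s * ?E)"
      unfolding e_def by (rule assoc_mult_mat) (use c in \<open>auto intro: mult_carrier_mat\<close>)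
    also have "D ?s * f ?s * ?E = D ?s * (f ?s * ?E)"
      by (rule assoc_mult_mat) (use c in \<open>auto intro: mult_carrier_mat\<close>)
    also have "\<dots> = D ?s * ?F * f ?t"
      unfolding comm by (rule assoc_mult_mat[symmetric]) (use c in \<open>auto intro: mult_carrier_mat\<close>)
    also have "\<dots> = ?F * (D ?t * f ?t)"
      unfolding DF by (rule assoc_mult_mat) (use c in \<open>auto intro: mult_carrier_mat\<close>)
    also have "B ?s * (?F * (D ?t * f ?t)) = B ?s * ?F * (D ?t * f ?t)"
      by (rule assoc_mult_mat[symmetric]) (use c in \<open>auto intro: mult_carrier_mat\<close>)
    also have "\<dots> = ?E * e ?t"
      unfolding EB[symmetric] e_def by (rule assoc_mult_mat) (use c in \<open>auto intro: mult_carrier_mat\<close>)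
    finally show "e ?s * ?E = ?E * e ?t" .
  qed (use e in auto)
  then consider "\<forall>v\<in>verts G. e v = 0\<^sub>m (?d v) (?d v)" | "\<forall>v\<in>verts G. e v = 1\<^sub>m (?d v)"
    using triv idem unfolding trivial_idempotents_def by blast
  \<comment> \<open>D = f e B is 0 or 1 at every vertex. Its first diagonal entry is 1 unless the
    first summand is zero there, and its entry at \<open>(?r v, ?r v)\<close> is 0 unless the second
    is.\<close>
  then show False
  proof cases
    case 1
    have "?r v = 0" if v: "v \<in> verts G" for v
    proof (rule ccontr)
      assume nz: "?r v \<noteq> 0"
      have "D v = 0\<^sub>m (?r v + ?r' v) (?r v + ?r' v)"
        using feB[OF v] 1 v f[OF v] B(1)[OF v]
        by (simp add: right_mult_zero_mat[of _ "?r v + ?r' v"] left_mult_zero_mat[of _ _ "?r v + ?r' v"])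
      from arg_cong[OF this, of "\<lambda>A. A $$ (0, 0)"] show False using nz by (simp add: D_def)
    qed
    then show False using st(3) by (simp add: zero_rep_def)
  next
    case 2
    have "?r' v = 0" if v: "v \<in> verts G" for v
    proof (rule ccontr)
      assume nz: "?r' v \<noteq> 0"
      have "D v = 1\<^sub>m (?r v + ?r' v)"
        using feB[OF v] 2 v f[OF v] B(1,2)[OF v] by simp
      from arg_cong[OF this, of "\<lambda>A. A $$ (?r v, ?r v)"] show False using nz by (simp add: D_def)
    qed
    then show False using st(4) by (simp add: zero_rep_def)
  qed
qed

section \<open>Encoded inputs\<close>

lemma enc_list_map: "enc_list f (map g xs) = enc_list (\<lambda>x. f (g x)) xs"
  by (induction xs) auto

text \<open>The input at the level of lists, which \<open>eI\<close> encodes exactly as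
  \<open>enc_input\<close> does; it links the machine input with the argument of
  \<open>algorithm\<close>.\<close>

definition list_input :: "(nat, nat) pre_digraph \<Rightarrow> (nat, nat, 'k) rep \<Rightarrow> nat list \<times> (nat \<times> nat \<times> 'k list list) list" where
  "list_input G \<pi> = (map (vdim \<pi>) [0..<card (verts G)],
     map (\<lambda>e. (tail G e, head G e, mat_to_list (emat \<pi> e))) [0..<card (arcs G)])"

lemma (in coded_field) enc_input_eq: "enc_input code G \<pi> = eI (list_input G \<pi>)"
  by (simp add: enc_input_def list_input_def epair_def enc_list_map enc_mat_def)

lemma ent_mat_to_list:
  "i < dim_row A \<Longrightarrow> j < dim_col A \<Longrightarrow> ent (mat_to_list A) i j = A $$ (i, j)"
  by (simp add: ent_def mat_to_list_def nthd_nth)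

lemma numberedD:
  assumes "numbered G"
  shows "verts G = {..<card (verts G)}" and "arcs G = {..<card (arcs G)}"
proof -
  obtain n m where nm: "verts G = {..<n}" "arcs G = {..<m}"
    using assms by (auto simp: numbered_def)
  show "verts G = {..<card (verts G)}" unfolding nm(1) by (simp only: card_lessThan)
  show "arcs G = {..<card (arcs G)}" unfolding nm(2) by (simp only: card_lessThan)
qed

lemma algorithm_correct:
  fixes \<pi> :: "(nat, nat, 'k::{field,finite}) rep"
  assumes G: "quiver G" "numbered G" and rep: "quiver_rep G \<pi>" and Fs: "set Fs = UNIV"
  shows "algorithm Fs (list_input G \<pi>) \<longleftrightarrow> absolutely_indecomposable G \<pi>"
proof -
  define N where "N = card (verts G)"
  define M where "M = card (arcs G)"
  have verts: "verts G = {..<N}" and arcs: "arcs G = {..<M}"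
    unfolding N_def M_def by (rule numberedD[OF G(2)])+
  have wf: "wf_digraph G" using G(1) by (simp add: quiver_def fin_digraph_def)
  \<comment> \<open>The block matrices are formed for the representation over the closure; its
    dimensions and hence its index list are those of the given one.\<close>
  interpret R: numbered_rep G "extend_to_closure \<pi>" N
    using wf verts rep by unfold_locales (auto simp: quiver_rep_def extend_to_closure_def wf_digraph_def)
  let ?idx = "index_list (map (vdim \<pi>) [0..<N])"
  have vd: "vdim (extend_to_closure \<pi>) = vdim \<pi>"
    and ed: "emat (extend_to_closure \<pi>) = (\<lambda>e. map_mat to_ac (emat \<pi> e))"
    by (simp_all add: extend_to_closure_def)
  have idx: "R.idx = ?idx" unfolding R.idx_def vd by (rule refl)
  let ?Ms = "map (vertex_mat ?idx) [0..<N] @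
    map (arc_mat ?idx) (map (\<lambda>e. (tail G e, head G e, mat_to_list (emat \<pi> e))) [0..<M])"
  have vmat: "ext (den R.n (vertex_mat ?idx v)) = R.vmat v" for v
    unfolding vertex_mat_def R.vmat_def ext_def idx[symmetric] den_tab
    by (auto simp: fun_eq_iff nthd_nth)
  have amat: "ext (den R.n (arc_mat ?idx (tail G e, head G e, mat_to_list (emat \<pi> e)))) = R.amat e"
    if e: "e \<in> arcs G" for e
  proof -
    have "emat \<pi> e \<in> carrier_mat (vdim \<pi> (head G e)) (vdim \<pi> (tail G e))"
      using rep e by (simp add: quiver_rep_def)
    then have "ent (mat_to_list (emat \<pi> e)) (R.co a) (R.co b) = emat \<pi> e $$ (R.co a, R.co b)"
      and "R.co a < dim_row (emat \<pi> e)" "R.co b < dim_col (emat \<pi> e)"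
      if "a < R.n" "b < R.n" "R.vx a = head G e" "R.vx b = tail G e" for a b
      using R.idx_bounds[OF that(1)] R.idx_bounds[OF that(2)] that(3,4)
      by (auto simp: vd intro!: ent_mat_to_list)
    then show ?thesis
      unfolding arc_mat_def R.amat_def ext_def idx[symmetric] den_tab
      by (auto simp: fun_eq_iff nthd_nth ed)
  qed
  have "set ?Ms = vertex_mat ?idx ` {..<N} \<union>
      (\<lambda>e. arc_mat ?idx (tail G e, head G e, mat_to_list (emat \<pi> e))) ` arcs G"
    by (simp add: arcs image_image atLeast0LessThan)
  then have "ext ` den R.n ` set ?Ms = (\<lambda>v. ext (den R.n (vertex_mat ?idx v))) ` {..<N} \<union>
      (\<lambda>e. ext (den R.n (arc_mat ?idx (tail G e, head G e, mat_to_list (emat \<pi> e))))) ` arcs G"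
    by (simp only: image_Un image_image)
  also have "\<dots> = R.gens"
    unfolding R.gens_def vmat by (intro arg_cong2[where f = union] image_cong refl amat)
  finally have gens: "ext ` den R.n ` set ?Ms = R.gens" .
  have "algorithm Fs (list_input G \<pi>) \<longleftrightarrow> decide Fs [0..<R.n] ?Ms"
    unfolding algorithm_def list_input_def fst_conv snd_conv N_def[symmetric] M_def[symmetric] idx
    by (simp only: length_map length_upt diff_zero)
  also have "\<dots> \<longleftrightarrow> trivial_idempotents G (extend_to_closure \<pi>)"
    unfolding decide_correct[OF Fs] gens by (rule R.connected_iff_trivial_idempotents)
  also have "\<dots> \<longleftrightarrow> absolutely_indecomposable G \<pi>"
    unfolding absolutely_indecomposable_def
    using idempotents_if_indecomposable[OF wf R.rep] indecomposable_if_idempotents[OF wf R.rep] by blast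
  finally show ?thesis .
qed

text \<open>At most \<open>x\<close> dimensions, each at most \<open>x\<close>, and at most
  \<open>x\<close> arcs, each with two vertex numbers below \<open>x\<close> and at most
  \<open>x\<close> rows of at most \<open>x\<close> entries; the 2 and the last 1 are cells of
  pairs.\<close>

lemma (in coded_field) size_input:
  assumes G: "quiver G" "numbered G" and rep: "quiver_rep G \<pi>"
    and x: "total_dim G \<pi> + card (verts G) + card (arcs G) \<le> x"
  shows "size (eI (list_input G \<pi>)) \<le> x * (x + 1) + x * ((x + x + x * (x * (bound + 1) + 1) + 2) + 1) + 1"
proof -
  have vlt: "v \<in> verts G \<longleftrightarrow> v < card (verts G)" and alt: "e \<in> arcs G \<longleftrightarrow> e < card (arcs G)" for v e
    using numberedD[OF G(2)] by (metis lessThan_iff)+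
  have wf: "wf_digraph G" and fin: "finite (verts G)"
    using G(1) by (auto simp: quiver_def fin_digraph_def fin_digraph.finite_verts)
  have dim: "vdim \<pi> v \<le> x" if "v \<in> verts G" for v
    using member_le_sum[OF that, of "vdim \<pi>"] fin x by (simp add: total_dim_def)
  have "size (eJ (fst (list_input G \<pi>))) \<le> x * (x + 1)"
    using x dim vlt by (intro size_enc_list_le') (auto simp: list_input_def)
  moreover have "size (enc_list (epair enc_nat (epair enc_nat em)) (snd (list_input G \<pi>)))
      \<le> x * ((x + x + x * (x * (bound + 1) + 1) + 2) + 1)"
  proof (rule size_enc_list_le')
    show "length (snd (list_input G \<pi>)) \<le> x" using x by (simp add: list_input_def)
    fix A assume "A \<in> set (snd (list_input G \<pi>))"
    then obtain e where e: "e \<in> arcs G" "A = (tail G e, head G e, mat_to_list (emat \<pi> e))"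
      using alt by (auto simp: list_input_def)
    have ends: "tail G e \<in> verts G" "head G e \<in> verts G"
      using wf_digraph.tail_in_verts[OF wf e(1)] wf_digraph.head_in_verts[OF wf e(1)] by auto
    have lt: "v < x" if "v \<in> verts G" for v using that vlt[of v] x by simp
    have c: "emat \<pi> e \<in> carrier_mat (vdim \<pi> (head G e)) (vdim \<pi> (tail G e))"
      using rep e(1) by (simp add: quiver_rep_def)
    have "size (em (mat_to_list (emat \<pi> e))) \<le> x * (x * (bound + 1) + 1)"
    proof (rule size_enc_list_le')
      show "length (mat_to_list (emat \<pi> e)) \<le> x"
        using c dim[OF ends(2)] by (simp add: mat_to_list_def)
      fix row assume "row \<in> set (mat_to_list (emat \<pi> e))"
      then show "size (enc_list ek row) \<le> x * (bound + 1)"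
        using c dim[OF ends(1)] code_le_bound by (intro size_enc_list_le') (auto simp: mat_to_list_def)
    qed
    then show "size (epair enc_nat (epair enc_nat em) A) \<le> x + x + x * (x * (bound + 1) + 1) + 2"
      using lt[OF ends(1)] lt[OF ends(2)] by (simp add: e(2) epair_def)
  qed
  ultimately show ?thesis by (simp add: epair_def)
qed

text \<open>The bound counts vertices and arcs besides the total dimension because the input lists
  all of them, including vertices of dimension 0 and any number of parallel arcs.\<close>

theorem theorem2:
  fixes code :: "'k::{field,finite} \<Rightarrow> nat"
  assumes "inj code"
  shows "\<exists>(P :: program) (p :: nat poly).
    \<forall>(G :: (nat, nat) pre_digraph) (\<pi> :: (nat, nat, 'k) rep).
      quiver G \<and> numbered G \<and> quiver_rep G \<pi> \<longrightarrow>
        (\<exists>v t. runs P (enc_input code G \<pi>) v t \<and>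
               t \<le> poly p (total_dim G \<pi> + card (verts G) + card (arcs G)) \<and>
               (v \<noteq> Leaf \<longleftrightarrow> absolutely_indecomposable G \<pi>))"
proof -
  interpret coded_field code using assms by unfold_locales
  \<comment> \<open>The list of all scalars is part of the program, which may depend on the fixed
    field.\<close>
  obtain Fs :: "'k list" where Fs: "set Fs = UNIV" using finite_list[OF finite[of "UNIV :: 'k set"]] by blast
  obtain P p where P: "\<And>I. \<exists>t\<le>poly p (size (eI I)). runs P (eI I) (ebool (algorithm Fs I)) t"
    using pt_runs[OF pt_algorithm] by metis
  define s :: "nat poly" where "s = [:0, 1:] * [:1, 1:] + [:0, 1:] * ([:2, 2:] + [:0, 1:] * ([:0, 1:] * [:bound + 1:] + 1) + 1) + 1"
  show ?thesis
  proof (intro exI[of _ P] exI[of _ "pcompose p s"] allI impI, elim conjE)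
    fix G :: "(nat, nat) pre_digraph" and \<pi> :: "(nat, nat, 'k) rep"
    assume G: "quiver G" "numbered G" "quiver_rep G \<pi>"
    let ?x = "total_dim G \<pi> + card (verts G) + card (arcs G)" and ?I = "list_input G \<pi>"
    obtain t where t: "t \<le> poly p (size (eI ?I))" "runs P (eI ?I) (ebool (algorithm Fs ?I)) t"
      using P by blast
    have "poly s ?x = ?x * (?x + 1) + ?x * ((?x + ?x + ?x * (?x * (bound + 1) + 1) + 2) + 1) + 1"
      by (simp add: s_def algebra_simps)
    then have "size (eI ?I) \<le> poly s ?x"
      using size_input[OF G order_refl] by simp
    then have "t \<le> poly (pcompose p s) ?x"
      using t(1) nat_poly_mono[of _ _ p] by (fastforce simp: poly_pcompose intro: order_trans)
    moreover have "ebool (algorithm Fs ?I) \<noteq> Leaf \<longleftrightarrow> absolutely_indecomposable G \<pi>"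
      using algorithm_correct[OF G Fs] by (simp add: ebool_def)
    ultimately show "\<exists>v t. runs P (enc_input code G \<pi>) v t \<and> t \<le> poly (pcompose p s) ?x \<and>
        (v \<noteq> Leaf \<longleftrightarrow> absolutely_indecomposable G \<pi>)"
      using t(2) unfolding enc_input_eq by blast
  qed
qed

end
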